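(* If $\mathrm{SNR}=\frac{(a-b)^2}{k(a+(k-1)b)}>1$, then there exists a consistent and efficient estimator of the parameters $a,b,k$ in $\mathrm{SBM}(n,k,a,b)$; that is, there is a polynomial-time algorithm that, given only the graph $G$ of $(\sigma,G)\sim\mathrm{SBM}(n,k,a,b)$ (without knowledge of $a,b,k$), outputs $(\hat a,\hat b,\hat k)$ converging in probability to $(a,b,k)$ as $n\to\infty$, for all parameters $a,b,k$ with $\mathrm{SNR}>1$.
   Context: $\mathrm{SBM}(n,k,a,b)$: each vertex $v\in[n]$ is independently assigned a uniform community $\sigma_v\in[k]$; then for every $v\ne v'$ an edge is placed independently with probability $a/n$ if $\sigma_v=\sigma_{v'}$ and $b/n$ otherwise; $G$ is the resulting graph. Here $k\ge2$, $a,b\ge0$ are fixed as $n\to\infty$. *)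

theory Defs
  imports "HOL-Probability.Probability" "HOL-Computational_Algebra.Polynomial"
begin

section \<open>The stochastic block model\<close>

text \<open>
  The vertices are \<open>0, \<dots>, n - 1\<close> and the communities are \<open>0, \<dots>, k - 1\<close>.  A graph is its set
  of edges, an edge being a two-element set of vertices.
\<close>

definition simple_graph :: "nat \<Rightarrow> nat set set \<Rightarrow> bool" where
  "simple_graph n E \<longleftrightarrow> (\<forall>e\<in>E. e \<subseteq> {..<n} \<and> card e = 2)"

definition communities :: "nat \<Rightarrow> nat \<Rightarrow> (nat \<Rightarrow> nat) pmf" where
  "communities n k = Pi_pmf {..<n} 0 (\<lambda>_. pmf_of_set {..<k})"

text \<open>
  The coins are indexed by the pairs \<open>(u, v)\<close> with \<open>u < v < n\<close>, one for each unordered pair.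
  \<^const>\<open>bernoulli_pmf\<close> truncates its parameter to \<open>[0, 1]\<close>; as \<open>a\<close> and \<open>b\<close> are fixed and
  nonnegative, this matters only for the finitely many \<open>n < max a b\<close>.
\<close>

definition SBM :: "nat \<Rightarrow> nat \<Rightarrow> real \<Rightarrow> real \<Rightarrow> ((nat \<Rightarrow> nat) \<times> nat set set) pmf" where
  "SBM n k a b =
     bind_pmf (communities n k) (\<lambda>\<sigma>.
       map_pmf (\<lambda>coin. (\<sigma>, {{u, v} | u v. u < v \<and> v < n \<and> coin (u, v)}))
         (Pi_pmf {(u, v). u < v \<and> v < n} False
           (\<lambda>(u, v). bernoulli_pmf ((if \<sigma> u = \<sigma> v then a else b) / real n))))"

definition SNR :: "nat \<Rightarrow> real \<Rightarrow> real \<Rightarrow> real" where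
  "SNR k a b = (a - b)\<^sup>2 / (real k * (a + (real k - 1) * b))"

text \<open>The random variables \<open>X n\<close> may live on different probability spaces; the limit is a constant.\<close>

definition converges_in_prob ::
    "(nat \<Rightarrow> 'a pmf) \<Rightarrow> (nat \<Rightarrow> 'a \<Rightarrow> 'b::metric_space) \<Rightarrow> 'b \<Rightarrow> bool" where
  "converges_in_prob M X c \<longleftrightarrow>
     (\<forall>\<epsilon>>0. (\<lambda>n. measure_pmf.prob (M n) {\<omega>. dist (X n \<omega>) c > \<epsilon>}) \<longlonglongrightarrow> 0)"

section \<open>Polynomial-time algorithms\<close>

text \<open>
  The model of computation is a deterministic random-access machine over the natural numbers, with
  structured control flow.  A state consists of registers, addressed only by constants of the
  program, and of a memory with indirect addressing.  Every instruction and every test costs one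
  unit.  The only arithmetic operations are addition and truncated subtraction, so that the
  largest number present at most doubles in a step (up to program constants); hence, by the usual
  simulation, polynomial time on this machine is polynomial time on Turing machines.
\<close>

datatype com =
    Const nat nat        (* R[x] := c *)
  | Add nat nat nat      (* R[x] := R[y] + R[z] *)
  | Sub nat nat nat      (* R[x] := R[y] - R[z], truncated at 0 *)
  | Load nat nat         (* R[x] := M[R[y]] *)
  | Store nat nat        (* M[R[x]] := R[y] *)
  | Seq com com
  | If nat com com       (* the test is R[x] \<noteq> 0 *)
  | While nat com        (* the test is R[x] \<noteq> 0 *)

type_synonym state = "(nat \<Rightarrow> nat) \<times> (nat \<Rightarrow> nat)"

text \<open>\<open>exec c s t s'\<close>: started in \<open>s\<close>, the program \<open>c\<close> halts in \<open>s'\<close> after exactly \<open>t\<close> steps.\<close>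

inductive exec :: "com \<Rightarrow> state \<Rightarrow> nat \<Rightarrow> state \<Rightarrow> bool" where
  Const: "exec (Const x c) (R, M) 1 (R(x := c), M)"
| Add: "exec (Add x y z) (R, M) 1 (R(x := R y + R z), M)"
| Sub: "exec (Sub x y z) (R, M) 1 (R(x := R y - R z), M)"
| Load: "exec (Load x y) (R, M) 1 (R(x := M (R y)), M)"
| Store: "exec (Store x y) (R, M) 1 (R, M(R x := R y))"
| Seq: "exec c s t s' \<Longrightarrow> exec d s' u s'' \<Longrightarrow> exec (Seq c d) s (t + u) s''"
| IfTrue: "fst s x \<noteq> 0 \<Longrightarrow> exec c s t s' \<Longrightarrow> exec (If x c d) s (1 + t) s'"
| IfFalse: "fst s x = 0 \<Longrightarrow> exec d s t s' \<Longrightarrow> exec (If x c d) s (1 + t) s'"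
| WhileFalse: "fst s x = 0 \<Longrightarrow> exec (While x c) s 1 s"
| WhileTrue: "fst s x \<noteq> 0 \<Longrightarrow> exec c s t s' \<Longrightarrow> exec (While x c) s' u s'' \<Longrightarrow>
    exec (While x c) s (1 + t + u) s''"

inductive_cases exec_ConstE: "exec (Const x c) s t s'"
inductive_cases exec_AddE: "exec (Add x y z) s t s'"
inductive_cases exec_SubE: "exec (Sub x y z) s t s'"
inductive_cases exec_LoadE: "exec (Load x y) s t s'"
inductive_cases exec_StoreE: "exec (Store x y) s t s'"
inductive_cases exec_SeqE: "exec (Seq c d) s t s'"
inductive_cases exec_IfE: "exec (If x c d) s t s'"
inductive_cases exec_WhileE: "exec (While x c) s t s'"

lemma exec_deterministic:
  "exec c s t s' \<Longrightarrow> exec c s u s'' \<Longrightarrow> t = u \<and> s' = s''"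
proof (induction arbitrary: u s'' rule: exec.induct)
  case (Seq c s t s' d v r)
  from Seq.prems show ?case by (rule exec_SeqE) (metis Seq.IH)
next
  case (IfTrue s x c t s' d)
  obtain v where v: "u = Suc v" "exec c s v s''"
    using IfTrue.prems IfTrue.hyps(1) by (auto elim: exec_IfE)
  show ?case using IfTrue.IH[OF v(2)] v(1) by simp
next
  case (IfFalse s x d t s' c)
  obtain v where v: "u = Suc v" "exec d s v s''"
    using IfFalse.prems IfFalse.hyps(1) by (auto elim: exec_IfE)
  show ?case using IfFalse.IH[OF v(2)] v(1) by simp
next
  case (WhileFalse s x c)
  then show ?case by (auto elim: exec_WhileE)
next
  case (WhileTrue s x c t s' v r)
  obtain t' v' q where w: "u = Suc (t' + v')" "exec c s t' q" "exec (While x c) q v' s''"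
    using WhileTrue.prems WhileTrue.hyps(1) by (auto elim: exec_WhileE)
  from WhileTrue.IH(1)[OF w(2)] have q: "t = t'" "s' = q" by auto
  from WhileTrue.IH(2) w(3) q(2) have "v = v' \<and> r = s''" by blast
  with w(1) q(1) show ?case by simp
qed (erule exec_ConstE exec_AddE exec_SubE exec_LoadE exec_StoreE, simp)+

text \<open>
  The input is the number of vertices, in register 0, together with the adjacency matrix, stored
  row by row in the memory; all other registers and cells are 0.
\<close>

definition graph_input :: "nat \<Rightarrow> nat set set \<Rightarrow> state" where
  "graph_input n E =
     ((\<lambda>_. 0)(0 := n),
      \<lambda>m. if m < n * n \<and> {m div n, m mod n} \<in> E then 1 else 0)"

text \<open>
  The output is two nonnegative rationals, given by numerator and denominator (where a
  denominator 0 gives the value 0), and a natural number.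
\<close>

definition estimate_output :: "state \<Rightarrow> real \<times> real \<times> real" where
  "estimate_output s =
     (let R = fst s in (real (R 0) / real (R 1), real (R 2) / real (R 3), real (R 4)))"

definition polytime_graph_estimator ::
    "(nat \<Rightarrow> nat set set \<Rightarrow> real \<times> real \<times> real) \<Rightarrow> bool" where
  "polytime_graph_estimator f \<longleftrightarrow>
     (\<exists>(c :: com) (p :: nat poly). \<forall>n E. simple_graph n E \<longrightarrow>
        (\<exists>t s. exec c (graph_input n E) t s \<and> t \<le> poly p n \<and> estimate_output s = f n E))"

end

theory Submission
  imports Defs "HOL-Real_Asymp.Real_Asymp"
begin

text \<open>
  Write \<open>d = (a + (k - 1) b) / k\<close> and \<open>s = (a - b) / k\<close>, so that \<open>a = d + (k - 1) s\<close>,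
  \<open>b = d - s\<close>, and \<open>SNR > 1\<close> means \<open>s\<^sup>2 > d\<close>.  The average degree \<open>D\<close> of the graph estimates \<open>d\<close>.
  For slowly growing \<open>j\<close>, the number \<open>X j\<close> of rooted oriented cycles of length \<open>j\<close> has mean about
  \<open>d ^ j + (k - 1) s ^ j\<close> and variance about \<open>2 j d ^ j\<close>, which is negligible against \<open>s ^ (2 j)\<close>;
  hence \<open>Y j = X j - D ^ j\<close> is \<open>(k - 1) s ^ j (1 + o(1))\<close>.  So \<open>Y (m + 1) / Y m\<close> estimates \<open>s\<close>, and
  \<open>k - 1\<close> is \<open>(Y m)\<^sup>2 / Y (2 m)\<close> rounded.

  To count in polynomial time, cycles are replaced by closed non-backtracking walks that visit their
  starting point only once, which are counted by dynamic programming using additions only.  Such a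
  walk that is not a cycle has more edges than vertices, so that with high probability there is none
  as long as \<open>j\<close> grows like \<open>log log n\<close>.  All loops of the program are bounded by \<open>n\<close>, so that
  its running time is polynomial for syntactic reasons.
\<close>

section \<open>Expressions and programs over the random-access machine\<close>

text \<open>The obstacle is that \<open>(k - 1) s ^ j\<close> is hidden behind the larger term
  \<open>d ^ j\<close>. The error of \<open>D\<close> is of order \<open>n ^ (-1/2)\<close>, so
  exchanging \<open>d ^ j\<close> for \<open>D ^ j\<close> costs little for short walks. On the
  other hand \<open>j\<close> must tend to infinity: relative to \<open>s ^ (2 j)\<close> the
  variance is of order \<open>j (d / s\<^sup>2) ^ j\<close>, which vanishes in the limit exactly
  because SNR exceeds 1. Taking the bit length twice gives a computable length between these
  demands. The length \<open>m\<close> is even, so \<open>s ^ m\<close> and \<open>s ^ (2 m)\<close>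
  are positive even when \<open>a < b\<close>; the sign of \<open>s\<close> enters only through
  \<open>Y (m + 1)\<close>. The machine cannot multiply, but bounded loops multiply by
  \<open>n\<close>, by the degree sum and by any number that is at most \<open>n\<close>. Hence all
  quantities are scaled by powers of \<open>n\<close> to become integers, and in
  \<open>(Y m)\<^sup>2 / Y (2 m)\<close> one factor is replaced by its integer part, which is at
  most \<open>n\<close> with high probability. Once the quotient is within 1/2 of
  \<open>k - 1\<close>, rounding makes the estimate of \<open>k\<close> exact.\<close>

datatype expr =
    V nat
  | N nat
  | Plus expr expr
  | Minus expr expr
  | Ld expr
  | Cond expr expr expr
  | Sum nat expr

text \<open>\<open>Sum\<close> is the only iteration and always runs over the indices below
  \<open>R 0\<close>. It also stands in for multiplication: a constant summand is multiplied by
  \<open>n\<close>, a summand guarded by \<open>Cond\<close> by the number of indices that pass the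
  test.\<close>

primrec ev :: "expr \<Rightarrow> (nat \<Rightarrow> nat) \<Rightarrow> (nat \<Rightarrow> nat) \<Rightarrow> nat" where
  "ev (V x) R M = R x"
| "ev (N c) R M = c"
| "ev (Plus e f) R M = ev e R M + ev f R M"
| "ev (Minus e f) R M = ev e R M - ev f R M"
| "ev (Ld e) R M = M (ev e R M)"
| "ev (Cond b e f) R M = (if ev b R M \<noteq> 0 then ev e R M else ev f R M)"
| "ev (Sum x e) R M = (\<Sum>i<R 0. ev e (R(x := i)) M)"

primrec wf_expr :: "nat \<Rightarrow> expr \<Rightarrow> bool" where
  "wf_expr r (V x) \<longleftrightarrow> x < r"
| "wf_expr r (N c) \<longleftrightarrow> True"
| "wf_expr r (Plus e f) \<longleftrightarrow> wf_expr r e \<and> wf_expr r f"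
| "wf_expr r (Minus e f) \<longleftrightarrow> wf_expr r e \<and> wf_expr r f"
| "wf_expr r (Ld e) \<longleftrightarrow> wf_expr r e"
| "wf_expr r (Cond b e f) \<longleftrightarrow> wf_expr r b \<and> wf_expr r e \<and> wf_expr r f"
| "wf_expr r (Sum x e) \<longleftrightarrow> 0 < x \<and> x < r \<and> wf_expr r e"

definition copy :: "nat \<Rightarrow> nat \<Rightarrow> com" where
  "copy x y = Seq (Const x 0) (Add x x y)"

text \<open>Registers form a stack: the value ends up in \<open>h\<close>, everything below
  \<open>h\<close> is preserved, everything above is scratch. For \<open>Sum x e\<close>,
  \<open>h\<close> saves \<open>x\<close>, \<open>h + 1\<close> accumulates, and
  \<open>h + 2\<close> counts downwards because the only test of the machine is against 0.\<close>

primrec comp_expr :: "expr \<Rightarrow> nat \<Rightarrow> com" where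
  "comp_expr (V x) h = copy h x"
| "comp_expr (N c) h = Const h c"
| "comp_expr (Plus e f) h =
     Seq (comp_expr e h) (Seq (comp_expr f (h + 1)) (Add h h (h + 1)))"
| "comp_expr (Minus e f) h =
     Seq (comp_expr e h) (Seq (comp_expr f (h + 1)) (Sub h h (h + 1)))"
| "comp_expr (Ld e) h = Seq (comp_expr e h) (Load h h)"
| "comp_expr (Cond b e f) h = Seq (comp_expr b h) (If h (comp_expr e h) (comp_expr f h))"
| "comp_expr (Sum x e) h =
     Seq (copy h x) (Seq (Const (h + 1) 0) (Seq (copy (h + 2) 0)
       (Seq (While (h + 2)
               (Seq (Const (h + 3) 1) (Seq (Sub (h + 2) (h + 2) (h + 3)) (Seq (copy x (h + 2))
                 (Seq (comp_expr e (h + 3)) (Add (h + 1) (h + 1) (h + 3)))))))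
         (Seq (copy x h) (copy h (h + 1))))))"

text \<open>A bound, not the exact time: \<open>Cond\<close> is charged for both branches. In
  \<open>Sum\<close>, 6 covers the loop test and the five steps around \<open>e\<close> in each
  round, and 10 the steps outside the rounds together with the final test.\<close>

primrec cost_expr :: "expr \<Rightarrow> nat poly" where
  "cost_expr (V x) = 2"
| "cost_expr (N c) = 1"
| "cost_expr (Plus e f) = cost_expr e + cost_expr f + 1"
| "cost_expr (Minus e f) = cost_expr e + cost_expr f + 1"
| "cost_expr (Ld e) = cost_expr e + 1"
| "cost_expr (Cond b e f) = cost_expr b + cost_expr e + cost_expr f + 1"
| "cost_expr (Sum x e) = [:0, 1:] * (cost_expr e + 6) + 10"

text \<open>Compiled code leaves arbitrary values in the registers from \<open>r\<close> on, and
  expressions must not see them. \<open>0 < r\<close> because \<open>Sum\<close> reads register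
  0.\<close>

lemma ev_cong:
  "wf_expr r e \<Longrightarrow> 0 < r \<Longrightarrow> (\<And>y. y < r \<Longrightarrow> R y = R' y) \<Longrightarrow> ev e R M = ev e R' M"
proof (induction e arbitrary: R R')
  case (V x)
  then show ?case by simp
next
  case (N c)
  then show ?case by simp
next
  case (Plus e f)
  from Plus.prems(1) have "wf_expr r e" "wf_expr r f" by simp_all
  from Plus.IH(1)[OF this(1) Plus.prems(2,3)] Plus.IH(2)[OF this(2) Plus.prems(2,3)]
  show ?case by simp
next
  case (Minus e f)
  from Minus.prems(1) have "wf_expr r e" "wf_expr r f" by simp_all
  from Minus.IH(1)[OF this(1) Minus.prems(2,3)] Minus.IH(2)[OF this(2) Minus.prems(2,3)]
  show ?case by simp
next
  case (Ld e)
  from Ld.prems(1) have "wf_expr r e" by simp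
  from Ld.IH[OF this Ld.prems(2,3)] show ?case by simp
next
  case (Cond b e f)
  from Cond.prems(1) have "wf_expr r b" "wf_expr r e" "wf_expr r f" by simp_all
  from Cond.IH(1)[OF this(1) Cond.prems(2,3)] Cond.IH(2)[OF this(2) Cond.prems(2,3)]
    Cond.IH(3)[OF this(3) Cond.prems(2,3)]
  show ?case by simp
next
  case (Sum x e)
  have wf: "wf_expr r e" using Sum.prems(1) by simp
  have "ev e (R(x := i)) M = ev e (R'(x := i)) M" for i
  proof (rule Sum.IH[OF wf Sum.prems(2)])
    show "(R(x := i)) y = (R'(x := i)) y" if "y < r" for y
      using Sum.prems(3)[OF that] unfolding fun_upd_def by presburger
  qed
  moreover have "R 0 = R' 0" using Sum.prems(2,3) by blast
  ultimately show ?case unfolding ev.simps by presburger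
qed

lemma exec_copy:
  "x \<noteq> y \<Longrightarrow> exec (copy x y) (R, M) 2 (R(x := R y), M)"
proof -
  assume "x \<noteq> y"
  have "exec (Add x x y) (R(x := 0), M) 1 ((R(x := 0))(x := (R(x := 0)) x + (R(x := 0)) y), M)"
    by (rule exec.Add)
  then have "exec (copy x y) (R, M) (1 + 1) ((R(x := 0))(x := (R(x := 0)) x + (R(x := 0)) y), M)"
    unfolding copy_def by (rule exec.Seq[OF exec.Const])
  then show ?thesis using \<open>x \<noteq> y\<close> by (simp add: numeral_2_eq_2)
qed

text \<open>Here \<open>I i\<close> is the invariant with \<open>i\<close> rounds to go.\<close>

lemma exec_while_countdown:
  assumes step: "\<And>i s. i < n \<Longrightarrow> I (Suc i) s \<Longrightarrow> fst s h \<noteq> 0 \<and>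
      (\<exists>t s'. exec c s t s' \<and> t \<le> T \<and> I i s')"
    and stop: "\<And>s. I 0 s \<Longrightarrow> fst s h = 0"
    and init: "I n s"
  shows "\<exists>t s'. exec (While h c) s t s' \<and> t \<le> n * (T + 1) + 1 \<and> I 0 s'"
  using step init
proof (induction n arbitrary: s)
  case 0
  have "exec (While h c) s 1 s" by (rule exec.WhileFalse[OF stop[OF 0(2)]])
  then show ?case using 0(2) by (intro exI[of _ "1::nat"] exI[of _ s]) simp
next
  case (Suc n)
  from Suc.prems(1)[of n s] Suc.prems(2) obtain t s' where
    1: "fst s h \<noteq> 0" "exec c s t s'" "t \<le> T" "I n s'" by auto
  obtain u s'' where 2: "exec (While h c) s' u s''" "u \<le> n * (T + 1) + 1" "I 0 s''"
    using Suc.IH[of s'] Suc.prems(1) 1(4) by (metis less_SucI)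
  have "exec (While h c) s (1 + t + u) s''" by (rule exec.WhileTrue[OF 1(1,2) 2(1)])
  moreover have "1 + t + u \<le> Suc n * (T + 1) + 1" using 1(3) 2(2) by simp
  ultimately show ?case using 2(3) by blast
qed

lemma comp_expr_correct:
  "wf_expr r e \<Longrightarrow> 0 < r \<Longrightarrow> r \<le> h \<Longrightarrow>
   \<exists>t R'. exec (comp_expr e h) (R, M) t (R', M) \<and> (\<forall>y<h. R' y = R y) \<and> R' h = ev e R M \<and>
     t \<le> poly (cost_expr e) (R 0)"
proof (induction e arbitrary: h R)
  case (V x)
  have "exec (copy h x) (R, M) 2 (R(h := R x), M)" by (rule exec_copy) (use V in auto)
  then show ?case
    by (intro exI[of _ "2::nat"] exI[of _ "R(h := R x)"]) (simp del: fun_upd_apply, simp)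
next
  case (N c)
  have "exec (Const h c) (R, M) 1 (R(h := c), M)" by (rule exec.Const)
  then show ?case
    by (intro exI[of _ "1::nat"] exI[of _ "R(h := c)"]) (simp del: fun_upd_apply, simp)
next
  case (Plus e f)
  obtain t R1 where 1: "exec (comp_expr e h) (R, M) t (R1, M)" "\<forall>y<h. R1 y = R y"
      "R1 h = ev e R M" "t \<le> poly (cost_expr e) (R 0)"
    using Plus.IH(1)[of h R] Plus.prems by auto
  obtain u R2 where 2: "exec (comp_expr f (h + 1)) (R1, M) u (R2, M)" "\<forall>y<h + 1. R2 y = R1 y"
      "R2 (h + 1) = ev f R1 M" "u \<le> poly (cost_expr f) (R1 0)"
    using Plus.IH(2)[of "h + 1" R1] Plus.prems by auto
  have "ev f R1 M = ev f R M" by (rule ev_cong[of r]) (use Plus.prems 1 in auto)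
  moreover define R3 where "R3 = R2(h := R2 h + R2 (h + 1))"
  ultimately have "\<forall>y<h. R3 y = R y" "R3 h = ev (Plus e f) R M"
      "t + (u + 1) \<le> poly (cost_expr (Plus e f)) (R 0)"
    using 1 2 Plus.prems by auto
  moreover have "exec (comp_expr (Plus e f) h) (R, M) (t + (u + 1)) (R3, M)"
    unfolding comp_expr.simps R3_def by (intro exec.Seq[OF 1(1)] exec.Seq[OF 2(1)] exec.Add)
  ultimately show ?case by blast
next
  case (Minus e f)
  obtain t R1 where 1: "exec (comp_expr e h) (R, M) t (R1, M)" "\<forall>y<h. R1 y = R y"
      "R1 h = ev e R M" "t \<le> poly (cost_expr e) (R 0)"
    using Minus.IH(1)[of h R] Minus.prems by auto
  obtain u R2 where 2: "exec (comp_expr f (h + 1)) (R1, M) u (R2, M)" "\<forall>y<h + 1. R2 y = R1 y"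
      "R2 (h + 1) = ev f R1 M" "u \<le> poly (cost_expr f) (R1 0)"
    using Minus.IH(2)[of "h + 1" R1] Minus.prems by auto
  have "ev f R1 M = ev f R M" by (rule ev_cong[of r]) (use Minus.prems 1 in auto)
  moreover define R3 where "R3 = R2(h := R2 h - R2 (h + 1))"
  ultimately have "\<forall>y<h. R3 y = R y" "R3 h = ev (Minus e f) R M"
      "t + (u + 1) \<le> poly (cost_expr (Minus e f)) (R 0)"
    using 1 2 Minus.prems by auto
  moreover have "exec (comp_expr (Minus e f) h) (R, M) (t + (u + 1)) (R3, M)"
    unfolding comp_expr.simps R3_def by (intro exec.Seq[OF 1(1)] exec.Seq[OF 2(1)] exec.Sub)
  ultimately show ?case by blast
next
  case (Ld e)
  obtain t R1 where 1: "exec (comp_expr e h) (R, M) t (R1, M)" "\<forall>y<h. R1 y = R y"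
      "R1 h = ev e R M" "t \<le> poly (cost_expr e) (R 0)"
    using Ld.IH[of h R] Ld.prems by auto
  define R2 where "R2 = R1(h := M (R1 h))"
  then have "\<forall>y<h. R2 y = R y" "R2 h = ev (Ld e) R M" "t + 1 \<le> poly (cost_expr (Ld e)) (R 0)"
    using 1 by auto
  moreover have "exec (comp_expr (Ld e) h) (R, M) (t + 1) (R2, M)"
    unfolding comp_expr.simps R2_def by (intro exec.Seq[OF 1(1)] exec.Load)
  ultimately show ?case by blast
next
  case (Cond b e f)
  obtain t R1 where 1: "exec (comp_expr b h) (R, M) t (R1, M)" "\<forall>y<h. R1 y = R y"
      "R1 h = ev b R M" "t \<le> poly (cost_expr b) (R 0)"
    using Cond.IH(1)[of h R] Cond.prems by auto
  obtain u R2 where 2: "exec (comp_expr e h) (R1, M) u (R2, M)" "\<forall>y<h. R2 y = R1 y"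
      "R2 h = ev e R1 M" "u \<le> poly (cost_expr e) (R1 0)"
    using Cond.IH(2)[of h R1] Cond.prems by auto
  obtain v R3 where 3: "exec (comp_expr f h) (R1, M) v (R3, M)" "\<forall>y<h. R3 y = R1 y"
      "R3 h = ev f R1 M" "v \<le> poly (cost_expr f) (R1 0)"
    using Cond.IH(3)[of h R1] Cond.prems by auto
  have ev: "ev e R1 M = ev e R M" "ev f R1 M = ev f R M"
    by (rule ev_cong[of r]; use Cond.prems 1 in auto)+
  have R10: "R1 0 = R 0" using 1 Cond.prems by auto
  show ?case
  proof (cases "ev b R M \<noteq> 0")
    case True
    have "exec (comp_expr (Cond b e f) h) (R, M) (t + (1 + u)) (R2, M)"
      unfolding comp_expr.simps
      by (intro exec.Seq[OF 1(1)] exec.IfTrue) (use True 1 2 in auto)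
    then show ?thesis using True 1 2 ev R10
      by (intro exI[of _ "t + (1 + u)"] exI[of _ R2]) auto
  next
    case False
    have "exec (comp_expr (Cond b e f) h) (R, M) (t + (1 + v)) (R3, M)"
      unfolding comp_expr.simps
      by (intro exec.Seq[OF 1(1)] exec.IfFalse) (use False 1 3 in auto)
    then show ?thesis using False 1 3 ev R10
      by (intro exI[of _ "t + (1 + v)"] exI[of _ R3]) auto
  qed
next
  case (Sum x e)
  define n where "n = R 0"
  have x: "0 < x" "x < h" "x < r" and wf: "wf_expr r e" using Sum.prems by auto
  \<comment> \<open>The counter descends, so with \<open>i\<close> rounds to go the accumulator
    holds the terms from \<open>i\<close> upwards. Register \<open>x\<close> is exempt, its original
    value being kept in \<open>h\<close>.\<close>
  define I where "I i s \<longleftrightarrow> (\<exists>R'. s = (R', M) \<and> (\<forall>y\<le>h. y \<noteq> x \<longrightarrow> y \<noteq> h \<longrightarrow> R' y = R y) \<and>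
      R' h = R x \<and> R' (h + 2) = i \<and> R' (h + 1) = (\<Sum>j\<in>{i..<n}. ev e (R(x := j)) M))" for i s
  let ?body = "Seq (Const (h + 3) 1) (Seq (Sub (h + 2) (h + 2) (h + 3)) (Seq (copy x (h + 2))
                 (Seq (comp_expr e (h + 3)) (Add (h + 1) (h + 1) (h + 3)))))"
  define T where "T = poly (cost_expr e) n + 5"
  have step: "fst s (h + 2) \<noteq> 0 \<and> (\<exists>t s'. exec ?body s t s' \<and> t \<le> T \<and> I i s')"
    if i: "i < n" and I: "I (Suc i) s" for i s
  proof -
    from I obtain R1 where R1: "s = (R1, M)" "\<And>y. y \<le> h \<Longrightarrow> y \<noteq> x \<Longrightarrow> y \<noteq> h \<Longrightarrow> R1 y = R y"
      "R1 h = R x" "R1 (h + 2) = Suc i" "R1 (h + 1) = (\<Sum>j\<in>{Suc i..<n}. ev e (R(x := j)) M)"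
      unfolding I_def by blast
    define R2 where "R2 = R1(h + 3 := 1, h + 2 := i, x := i)"
    have R20: "R2 0 = n" using R1(2)[of 0] x by (simp add: R2_def n_def)
    obtain t R3 where 3: "exec (comp_expr e (h + 3)) (R2, M) t (R3, M)" "\<forall>y<h + 3. R3 y = R2 y"
      "R3 (h + 3) = ev e R2 M" "t \<le> poly (cost_expr e) (R2 0)"
      using Sum.IH[of "h + 3" R2] Sum.prems by auto
    have e: "ev e R2 M = ev e (R(x := i)) M"
      by (rule ev_cong[of r]) (use wf x Sum.prems R1(2) in \<open>auto simp: R2_def\<close>)
    define R4 where "R4 = R3(h + 1 := R3 (h + 1) + R3 (h + 3))"
    have A: "exec (Sub (h + 2) (h + 2) (h + 3)) (R1(h + 3 := 1), M) 1 (R1(h + 3 := 1, h + 2 := i), M)"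
      using exec.Sub[of "h + 2" "h + 2" "h + 3" "R1(h + 3 := 1)" M] R1(4) by simp
    have B: "exec (copy x (h + 2)) (R1(h + 3 := 1, h + 2 := i), M) 2 (R2, M)"
      using exec_copy[of x "h + 2" "R1(h + 3 := 1, h + 2 := i)" M] x by (simp add: R2_def)
    have "exec ?body s (1 + (1 + (2 + (t + 1)))) (R4, M)"
      unfolding R4_def R1(1)
      by (intro exec.Seq[OF exec.Const] exec.Seq[OF A] exec.Seq[OF B] exec.Seq[OF 3(1)] exec.Add)
    moreover have "1 + (1 + (2 + (t + 1))) \<le> T" using 3(4) R20 by (simp add: T_def)
    moreover have "I i (R4, M)"
    proof -
      have s: "(\<Sum>j\<in>{i..<n}. ev e (R(x := j)) M)
          = ev e (R(x := i)) M + (\<Sum>j\<in>{Suc i..<n}. ev e (R(x := j)) M)"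
        using i by (simp add: sum.atLeast_Suc_lessThan)
      have "\<forall>y\<le>h. y \<noteq> x \<longrightarrow> y \<noteq> h \<longrightarrow> R4 y = R y"
        using 3(2) R1(2) by (simp add: R4_def R2_def)
      moreover have "R4 h = R x" "R4 (h + 2) = i"
        using 3(2) R1(3,4) x by (simp_all add: R4_def R2_def)
      moreover have "R4 (h + 1) = (\<Sum>j\<in>{i..<n}. ev e (R(x := j)) M)"
        using 3(2,3) R1(5) x e s by (simp add: R4_def R2_def)
      ultimately show ?thesis unfolding I_def by blast
    qed
    ultimately have "\<exists>t s'. exec ?body s t s' \<and> t \<le> T \<and> I i s'" by blast
    then show ?thesis using R1(1,4) by simp
  qed
  have stop: "fst s (h + 2) = 0" if "I 0 s" for s using that unfolding I_def by force
  define R0 where "R0 = R(h := R x, h + 1 := 0, h + 2 := n)"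
  have "\<forall>y\<le>h. y \<noteq> x \<longrightarrow> y \<noteq> h \<longrightarrow> R0 y = R y" "R0 h = R x" "R0 (h + 2) = n"
      "R0 (h + 1) = (\<Sum>j\<in>{n..<n}. ev e (R(x := j)) M)"
    by (simp_all add: R0_def)
  then have I0: "I n (R0, M)" unfolding I_def by blast
  obtain t s' where W: "exec (While (h + 2) ?body) (R0, M) t s'" "t \<le> n * (T + 1) + 1" "I 0 s'"
    using exec_while_countdown[of n I "h + 2" ?body T "(R0, M)", OF step stop I0] by blast
  from W(3) obtain R1 where R1: "s' = (R1, M)" "\<And>y. y \<le> h \<Longrightarrow> y \<noteq> x \<Longrightarrow> y \<noteq> h \<Longrightarrow> R1 y = R y"
      "R1 h = R x" "R1 (h + 2) = 0" "R1 (h + 1) = (\<Sum>j\<in>{0..<n}. ev e (R(x := j)) M)"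
      unfolding I_def by blast
  have A: "exec (copy h x) (R, M) 2 (R(h := R x), M)" using x by (intro exec_copy) auto
  have B: "exec (copy (h + 2) 0) (R(h := R x, h + 1 := 0), M) 2 (R0, M)"
    using exec_copy[of "h + 2" 0 "R(h := R x, h + 1 := 0)" M] x by (simp add: R0_def n_def)
  have C: "exec (copy x h) (R1, M) 2 (R1(x := R x), M)"
    using exec_copy[of x h R1 M] x R1(3) by simp
  have D: "exec (copy h (h + 1)) (R1(x := R x), M) 2 (R1(x := R x, h := R1 (h + 1)), M)"
    using exec_copy[of h "h + 1" "R1(x := R x)" M] x by simp
  define R2 where "R2 = R1(x := R x, h := R1 (h + 1))"
  have ex: "exec (comp_expr (Sum x e) h) (R, M) (2 + (1 + (2 + (t + (2 + 2))))) (R2, M)"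
    unfolding comp_expr.simps R2_def
    by (intro exec.Seq[OF A] exec.Seq[OF exec.Const] exec.Seq[OF B] exec.Seq[OF C D]
        exec.Seq[OF W(1)[unfolded R1(1)]])
  have "\<forall>y<h. R2 y = R y" using R1 x by (auto simp: R2_def)
  moreover have "R2 h = ev (Sum x e) R M"
    using R1(5) by (simp add: R2_def n_def atLeast0LessThan)
  moreover have "2 + (1 + (2 + (t + (2 + 2)))) \<le> poly (cost_expr (Sum x e)) (R 0)"
    using W(2) by (simp add: T_def n_def algebra_simps)
  ultimately show ?case using ex by blast
qed

section \<open>Programs whose loops all run for \<open>n\<close> rounds\<close>

datatype prog =
    Asg nat expr
  | St expr expr
  | Sq prog prog
  | For nat prog

primrec countdown :: "(nat \<Rightarrow> 's \<Rightarrow> 's) \<Rightarrow> nat \<Rightarrow> 's \<Rightarrow> 's" where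
  "countdown f 0 s = s"
| "countdown f (Suc i) s = countdown f i (f i s)"

primrec run :: "prog \<Rightarrow> state \<Rightarrow> state" where
  "run (Asg x e) = (\<lambda>(R, M). (R(x := ev e R M), M))"
| "run (St e f) = (\<lambda>(R, M). (R, M(ev e R M := ev f R M)))"
| "run (Sq p q) = (\<lambda>s. run q (run p s))"
| "run (For x p) = (\<lambda>s. countdown (\<lambda>i (R, M). run p (R(x := i), M)) (fst s 0) s)"

text \<open>Assignments and loop variables avoid register 0, so every \<open>For\<close>, however
  deeply nested, runs for the same \<open>n\<close> rounds. This is what makes
  \<open>cost_prog\<close> a polynomial in \<open>n\<close>.\<close>

primrec wf_prog :: "nat \<Rightarrow> prog \<Rightarrow> bool" where
  "wf_prog r (Asg x e) \<longleftrightarrow> 0 < x \<and> x < r \<and> wf_expr r e"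
| "wf_prog r (St e f) \<longleftrightarrow> wf_expr r e \<and> wf_expr r f"
| "wf_prog r (Sq p q) \<longleftrightarrow> wf_prog r p \<and> wf_prog r q"
| "wf_prog r (For x p) \<longleftrightarrow> 0 < x \<and> x < r \<and> wf_prog r p"

primrec comp_prog :: "prog \<Rightarrow> nat \<Rightarrow> com" where
  "comp_prog (Asg x e) h = Seq (comp_expr e h) (copy x h)"
| "comp_prog (St e f) h = Seq (comp_expr e h) (Seq (comp_expr f (h + 1)) (Store h (h + 1)))"
| "comp_prog (Sq p q) h = Seq (comp_prog p h) (comp_prog q h)"
| "comp_prog (For x p) h =
     Seq (copy h 0)
       (While h (Seq (Const (h + 1) 1) (Seq (Sub h h (h + 1)) (Seq (copy x h)
         (comp_prog p (h + 1))))))"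

primrec cost_prog :: "prog \<Rightarrow> nat poly" where
  "cost_prog (Asg x e) = cost_expr e + 2"
| "cost_prog (St e f) = cost_expr e + cost_expr f + 1"
| "cost_prog (Sq p q) = cost_prog p + cost_prog q"
| "cost_prog (For x p) = [:0, 1:] * (cost_prog p + 5) + 3"

lemma fst_countdown_0:
  assumes "\<And>i s. fst (f i s) 0 = (fst s 0 :: nat)"
  shows "fst (countdown f n s) 0 = fst s 0"
  by (induction n arbitrary: s) (simp_all add: assms)

lemma run_0: "wf_prog r p \<Longrightarrow> fst (run p s) 0 = fst s 0"
proof (induction p arbitrary: s)
  case (For x p)
  show ?case
    using For by (auto simp: split_beta intro!: fst_countdown_0)
qed (auto simp: split_beta)

text \<open>Two register files are compared: \<open>R\<close> on the machine and \<open>R'\<close>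
  of the source program. Scratch values left by earlier rounds make them differ from
  \<open>r\<close> on, which is why the induction carries both.\<close>

lemma comp_prog_correct:
  "wf_prog r p \<Longrightarrow> 0 < r \<Longrightarrow> r \<le> h \<Longrightarrow> (\<And>y. y < r \<Longrightarrow> R y = R' y) \<Longrightarrow>
   \<exists>t S. exec (comp_prog p h) (R, M) t (S, snd (run p (R', M))) \<and>
     (\<forall>y<r. S y = fst (run p (R', M)) y) \<and> (\<forall>y. r \<le> y \<longrightarrow> y < h \<longrightarrow> S y = R y) \<and>
     t \<le> poly (cost_prog p) (R 0)"
proof (induction p arbitrary: h R R' M)
  case (Asg x e)
  obtain t R1 where 1: "exec (comp_expr e h) (R, M) t (R1, M)" "\<forall>y<h. R1 y = R y"
      "R1 h = ev e R M" "t \<le> poly (cost_expr e) (R 0)"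
    using comp_expr_correct[of r e h R M] Asg.prems by auto
  have e: "ev e R M = ev e R' M" by (rule ev_cong[of r]) (use Asg.prems in auto)
  define R2 where "R2 = R1(x := R1 h)"
  have "exec (comp_prog (Asg x e) h) (R, M) (t + 2) (R2, snd (run (Asg x e) (R', M)))"
    unfolding snd_conv run.simps prod.case comp_prog.simps R2_def
    by (intro exec.Seq[OF 1(1)] exec_copy) (use Asg.prems in auto)
  moreover have "\<forall>y<r. R2 y = fst (run (Asg x e) (R', M)) y"
    "\<forall>y. r \<le> y \<longrightarrow> y < h \<longrightarrow> R2 y = R y" "t + 2 \<le> poly (cost_prog (Asg x e)) (R 0)"
    using 1 e Asg.prems by (auto simp: R2_def)
  ultimately show ?case by blast
next
  case (St e f)
  obtain t R1 where 1: "exec (comp_expr e h) (R, M) t (R1, M)" "\<forall>y<h. R1 y = R y"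
      "R1 h = ev e R M" "t \<le> poly (cost_expr e) (R 0)"
    using comp_expr_correct[of r e h R M] St.prems by auto
  obtain u R2 where 2: "exec (comp_expr f (h + 1)) (R1, M) u (R2, M)" "\<forall>y<h + 1. R2 y = R1 y"
      "R2 (h + 1) = ev f R1 M" "u \<le> poly (cost_expr f) (R1 0)"
    using comp_expr_correct[of r f "h + 1" R1 M] St.prems by auto
  have e: "ev e R M = ev e R' M" "ev f R1 M = ev f R' M"
    by (rule ev_cong[of r]; use St.prems 1 in auto)+
  have "exec (comp_prog (St e f) h) (R, M) (t + (u + 1)) (R2, M(R2 h := R2 (h + 1)))"
    unfolding comp_prog.simps by (intro exec.Seq[OF 1(1)] exec.Seq[OF 2(1)] exec.Store)
  then have "exec (comp_prog (St e f) h) (R, M) (t + (u + 1)) (R2, snd (run (St e f) (R', M)))"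
    using 1 2 e by (simp del: fun_upd_apply)
  moreover have "\<forall>y<r. R2 y = fst (run (St e f) (R', M)) y"
    "\<forall>y. r \<le> y \<longrightarrow> y < h \<longrightarrow> R2 y = R y" "t + (u + 1) \<le> poly (cost_prog (St e f)) (R 0)"
    using 1 2 e St.prems by auto
  ultimately show ?case by blast
next
  case (Sq p q)
  obtain t S where 1: "exec (comp_prog p h) (R, M) t (S, snd (run p (R', M)))"
     "\<forall>y<r. S y = fst (run p (R', M)) y" "\<forall>y. r \<le> y \<longrightarrow> y < h \<longrightarrow> S y = R y"
     "t \<le> poly (cost_prog p) (R 0)"
    using Sq.IH(1)[of h R R' M] Sq.prems by auto
  obtain u S' where 2:
    "exec (comp_prog q h) (S, snd (run p (R', M))) u (S', snd (run q (run p (R', M))))"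
     "\<forall>y<r. S' y = fst (run q (run p (R', M))) y" "\<forall>y. r \<le> y \<longrightarrow> y < h \<longrightarrow> S' y = S y"
     "u \<le> poly (cost_prog q) (S 0)"
    using Sq.IH(2)[of h S "fst (run p (R', M))" "snd (run p (R', M))"] Sq.prems 1 by auto
  have "S 0 = R 0" using 1(2) Sq.prems run_0[of r p "(R', M)"] by auto
  then show ?case using 1 2 exec.Seq[OF 1(1) 2(1)]
    by (intro exI[of _ "t + u"] exI[of _ S']) auto
next
  case (For x p)
  define n where "n = R 0"
  have R'0: "R' 0 = n" using For.prems by (auto simp: n_def)
  define f where "f = (\<lambda>i (R, M). run p (R(x := i), M))"
  define G where "G = run (For x p) (R', M)"
  have wf: "0 < x" "x < r" "wf_prog r p" using For.prems by auto
  have f0: "fst (f i s) 0 = fst s 0" for i s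
    using run_0[OF wf(3)] wf by (simp add: f_def split_beta)
  let ?body = "Seq (Const (h + 1) 1) (Seq (Sub h h (h + 1)) (Seq (copy x h)
         (comp_prog p (h + 1))))"
  define T where "T = poly (cost_prog p) n + 4"
  \<comment> \<open>\<open>R1\<close> is the register file of the source program. Instead of
    describing the current state, the invariant says that the \<open>i\<close> remaining rounds, run
    from \<open>R1\<close>, lead to the final state \<open>G\<close>.\<close>
  define I where "I i s \<longleftrightarrow> fst s h = i \<and> (\<forall>y. r \<le> y \<longrightarrow> y < h \<longrightarrow> fst s y = R y) \<and>
     (\<exists>R1. (\<forall>y<r. fst s y = R1 y) \<and> R1 0 = n \<and> countdown f i (R1, snd s) = G)" for i s
  have step: "fst s h \<noteq> 0 \<and> (\<exists>t s'. exec ?body s t s' \<and> t \<le> T \<and> I i s')"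
    if i: "i < n" and I: "I (Suc i) s" for i s
  proof -
    obtain Q M1 where s: "s = (Q, M1)" by (cases s)
    from I obtain R1 where R1: "\<And>y. y < r \<Longrightarrow> Q y = R1 y" "R1 0 = n"
        "countdown f i (f i (R1, M1)) = G" "Q h = Suc i" "\<And>y. r \<le> y \<Longrightarrow> y < h \<Longrightarrow> Q y = R y"
      by (auto simp: I_def s)
    define Q2 where "Q2 = Q(h + 1 := 1, h := i, x := i)"
    obtain t S where 1: "exec (comp_prog p (h + 1)) (Q2, M1) t (S, snd (run p (R1(x := i), M1)))"
     "\<And>y. y<r \<Longrightarrow> S y = fst (run p (R1(x := i), M1)) y" "\<And>y. r \<le> y \<Longrightarrow> y < h + 1 \<Longrightarrow> S y = Q2 y"
     "t \<le> poly (cost_prog p) (Q2 0)"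
    proof -
      have "Q2 y = (R1(x := i)) y" if "y < r" for y
        using that R1(1) For.prems by (simp add: Q2_def)
      then show ?thesis
        using For.IH[of "h + 1" Q2 "R1(x := i)" M1, OF wf(3) For.prems(2) _ _] that For.prems(3)
        by (simp del: fun_upd_apply) blast
    qed
    have A: "exec (Sub h h (h + 1)) (Q(h + 1 := 1), M1) 1 (Q(h + 1 := 1, h := i), M1)"
      using exec.Sub[of h h "h + 1" "Q(h + 1 := 1)" M1] R1(4) by simp
    have B: "exec (copy x h) (Q(h + 1 := 1, h := i), M1) 2 (Q2, M1)"
      using exec_copy[of x h "Q(h + 1 := 1, h := i)" M1] wf For.prems by (simp add: Q2_def)
    have ex: "exec ?body s (1 + (1 + (2 + t))) (S, snd (run p (R1(x := i), M1)))"
      unfolding s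
      by (intro exec.Seq[OF exec.Const] exec.Seq[OF A] exec.Seq[OF B] 1(1))
    have "Q2 0 = n" using R1(1)[of 0] R1(2) wf For.prems by (simp add: Q2_def)
    then have "1 + (1 + (2 + t)) \<le> T" using 1(4) by (simp add: T_def)
    moreover have "I i (S, snd (run p (R1(x := i), M1)))"
    proof -
      have "S h = i" "\<And>y. r \<le> y \<Longrightarrow> y < h \<Longrightarrow> S y = R y"
        using 1(3) For.prems wf R1(5) by (auto simp: Q2_def)
      moreover have "fst (run p (R1(x := i), M1)) 0 = n"
        using run_0[OF wf(3)] R1(2) wf by simp
      moreover have "countdown f i (run p (R1(x := i), M1)) = G"
        using R1(3) by (simp add: f_def)
      ultimately show ?thesis unfolding I_def using 1(2)
        by (intro conjI exI[of _ "fst (run p (R1(x := i), M1))"]) auto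
    qed
    ultimately have "\<exists>t s'. exec ?body s t s' \<and> t \<le> T \<and> I i s'" using ex by blast
    then show ?thesis using R1(4) s by simp
  qed
  have stop: "fst s h = 0" if "I 0 s" for s using that unfolding I_def by simp
  have I0: "I n (R(h := n), M)"
    unfolding I_def using For.prems R'0
    by (intro conjI exI[of _ R']) (auto simp: G_def f_def)
  obtain t s' where W: "exec (While h ?body) (R(h := n), M) t s'" "t \<le> n * (T + 1) + 1" "I 0 s'"
    using exec_while_countdown[of n I h ?body T "(R(h := n), M)", OF step stop I0] by blast
  have A: "exec (copy h 0) (R, M) 2 (R(h := n), M)"
    using exec_copy[of h 0 R M] For.prems by (simp add: n_def)
  have ex: "exec (comp_prog (For x p) h) (R, M) (2 + t) s'"
    unfolding comp_prog.simps by (intro exec.Seq[OF A W(1)])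
  obtain S M1 where s': "s' = (S, M1)" by (cases s')
  from W(3) s' obtain R1 where R1: "\<forall>y<r. S y = R1 y" "(R1, M1) = G" "\<forall>y. r \<le> y \<longrightarrow> y < h \<longrightarrow> S y = R y"
    by (auto simp: I_def)
  have "2 + t \<le> poly (cost_prog (For x p)) (R 0)"
    using W(2) by (simp add: T_def n_def algebra_simps)
  then show ?case using ex R1 s' unfolding G_def[symmetric]
    by (intro exI[of _ "2 + t"] exI[of _ S]) (auto simp flip: R1(2))
qed

text \<open>Register 0 holds the loop bound throughout, so the first output is moved there at the end.\<close>

lemma polytime_run:
  assumes wf: "wf_prog r p" and r: "5 < r"
    and est: "\<And>n E. est n E = (let R = fst (run p (graph_input n E)) in
       (real (R 5) / real (R 1), real (R 2) / real (R 3), real (R 4)))"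
  shows "polytime_graph_estimator est"
  unfolding polytime_graph_estimator_def
proof (rule exI, rule exI, intro allI impI)
  fix n E
  obtain R M where gi: "graph_input n E = (R, M)" by (cases "graph_input n E")
  have R0: "R 0 = n" using gi by (auto simp: graph_input_def)
  obtain t S where 1: "exec (comp_prog p r) (R, M) t (S, snd (run p (R, M)))"
     "\<forall>y<r. S y = fst (run p (R, M)) y" "t \<le> poly (cost_prog p) (R 0)"
    using comp_prog_correct[OF wf _ order_refl, of R R M] r by auto
  have "exec (Seq (comp_prog p r) (copy 0 5)) (graph_input n E) (t + 2)
      (S(0 := S 5), snd (run p (R, M)))"
    unfolding gi by (rule exec.Seq[OF 1(1) exec_copy]) simp
  moreover have "t + 2 \<le> poly (cost_prog p + 2) n" using 1(3) R0 by simp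
  moreover have "estimate_output (S(0 := S 5), snd (run p (R, M))) = est n E"
    using 1(2) r by (simp add: estimate_output_def est gi Let_def)
  ultimately show "\<exists>t s. exec (Seq (comp_prog p r) (copy 0 5)) (graph_input n E) t s \<and>
      t \<le> poly (cost_prog p + 2) n \<and> estimate_output s = est n E" by blast
qed

section \<open>Tables of non-backtracking walks\<close>

lemma countdown_invariant:
  assumes "P n s" and "\<And>i s. i < n \<Longrightarrow> P (Suc i) s \<Longrightarrow> P i (f i s)"
  shows "P 0 (countdown f n s)"
  using assms by (induction n arbitrary: s) auto

lemma run_For:
  "run (For x p) s = countdown (\<lambda>i s. run p ((fst s)(x := i), snd s)) (fst s 0) s"
  by (simp add: case_prod_unfold)

text \<open>A sum of \<open>n\<close> equal terms. Register 35 is reserved as its index, so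
  \<open>e\<close> must not depend on it.\<close>

definition times_n :: "expr \<Rightarrow> expr" where
  "times_n e = Sum 35 e"

text \<open>Truncated subtraction is nonzero exactly when the inequality is strict, and a test only
  asks for a nonzero value.\<close>

definition less_expr :: "expr \<Rightarrow> expr \<Rightarrow> expr" where
  "less_expr e f = Minus f e"

definition neq :: "expr \<Rightarrow> expr \<Rightarrow> expr" where
  "neq e f = Plus (Minus e f) (Minus f e)"

text \<open>
  The memory is divided into layers of \<open>n * n\<close> cells.  Layer 0 is the input; for a fixed first edge,
  layer \<open>t\<close> counts the walks with \<open>t\<close> edges by their last edge \<open>(x, y)\<close>.
\<close>

definition cell :: "expr \<Rightarrow> expr \<Rightarrow> expr \<Rightarrow> expr" where
  "cell t x y = Plus (times_n (Plus (times_n t) x)) y"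

definition adj :: "expr \<Rightarrow> expr \<Rightarrow> expr" where
  "adj x y = Ld (Plus (times_n x) y)"

text \<open>Adding \<open>e\<close> once for every ordered adjacent pair is a product with the
  degree sum, obtained without multiplication.\<close>

definition times_deg :: "expr \<Rightarrow> expr" where
  "times_deg e = Sum 6 (Sum 7 (Cond (adj (V 6) (V 7)) e (N 0)))"

definition fill :: "expr \<Rightarrow> expr \<Rightarrow> prog" where
  "fill t e = For 8 (For 9 (St (cell t (V 8) (V 9)) e))"

text \<open>Registers 6 and 7 hold the first edge \<open>(u, v)\<close>. An entry
  \<open>(x, y)\<close> of the next layer sums the entries \<open>(w, x)\<close> of the previous
  one; \<open>y \<noteq> u\<close> forbids an early return and \<open>w \<noteq> y\<close> a
  backtracking step. The layers are refilled for every first edge, and as loops have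
  \<open>n\<close> rounds they always reach up to \<open>n + 1\<close>.\<close>

definition walk_tables :: prog where
  "walk_tables =
     Sq (fill (N 1) (Cond (neq (V 8) (V 6)) (N 0) (Cond (neq (V 9) (V 7)) (N 0) (adj (V 6) (V 7)))))
    (Sq (Asg 11 (N 1))
        (For 12 (Sq
          (fill (Plus (V 11) (N 1))
            (Cond (adj (V 8) (V 9)) (Cond (neq (V 9) (V 6))
              (Sum 10 (Cond (neq (V 10) (V 9)) (Ld (cell (V 11) (V 10) (V 8))) (N 0))) (N 0)) (N 0)))
          (Asg 11 (Plus (V 11) (N 1))))))"

text \<open>The test against register 7 keeps the closing edge from being the first edge reversed.
  The closing edge is not part of the tables, so a closed walk of length \<open>j\<close> is read
  from layer \<open>j - 1\<close>.\<close>

definition closing :: "expr \<Rightarrow> expr" where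
  "closing l = Sum 8 (Cond (adj (V 8) (V 6)) (Cond (neq (V 8) (V 7))
      (Sum 10 (Ld (cell l (V 10) (V 8)))) (N 0)) (N 0))"

definition count_walks :: prog where
  "count_walks = For 6 (For 7 (Sq walk_tables
     (Sq (Asg 17 (Plus (V 17) (closing (Minus (V 16) (N 1)))))
     (Sq (Asg 18 (Plus (V 18) (closing (V 16))))
         (Asg 19 (Plus (V 19) (closing (Minus (Plus (V 16) (V 16)) (N 1)))))))))"

text \<open>Comparison with successive powers of 2, produced in register 13 by doubling; the loop
  tries the first \<open>n\<close> of them.\<close>

definition bit_length :: "nat \<Rightarrow> nat \<Rightarrow> prog" where
  "bit_length x y = Sq (Asg 13 (N 1)) (Sq (Asg y (N 0))
     (For 12 (Sq (Asg y (Plus (V y) (Cond (less_expr (V x) (V 13)) (N 0) (N 1))))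
                 (Asg 13 (Plus (V 13) (V 13))))))"

text \<open>
  The number of non-backtracking walks with \<open>t\<close> edges that start with the edge \<open>(u, v)\<close>, end with
  the edge \<open>(x, y)\<close> and do not return to \<open>u\<close>.
\<close>

fun walks :: "(nat \<Rightarrow> nat \<Rightarrow> bool) \<Rightarrow> nat \<Rightarrow> nat \<Rightarrow> nat \<Rightarrow> nat \<Rightarrow> nat \<Rightarrow> nat \<Rightarrow> nat" where
  "walks A n u v 0 x y = 0"
| "walks A n u v (Suc 0) x y = (if x = u \<and> y = v \<and> A u v then 1 else 0)"
| "walks A n u v (Suc (Suc t)) x y =
     (if A x y \<and> y \<noteq> u then \<Sum>w<n. if w \<noteq> y then walks A n u v (Suc t) w x else 0 else 0)"

definition closed_walks :: "(nat \<Rightarrow> nat \<Rightarrow> bool) \<Rightarrow> nat \<Rightarrow> nat \<Rightarrow> nat" where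
  "closed_walks A n j = (\<Sum>u<n. \<Sum>v<n. \<Sum>x<n.
     if A x u \<and> x \<noteq> v then \<Sum>w<n. walks A n u v (j - 1) w x else 0)"

abbreviation in_layer :: "nat \<Rightarrow> nat \<Rightarrow> nat \<Rightarrow> bool" where
  "in_layer n t i \<equiv> n * (n * t) \<le> i \<and> i < n * (n * t) + n * n"

text \<open>While a layer is being filled, only its own cells change; so \<open>t\<close> and
  \<open>e\<close> have to behave well in every memory that agrees with the initial one outside
  layer \<open>T\<close>. Register 35 is arbitrary in the condition on \<open>t\<close> because
  \<open>cell\<close> evaluates \<open>t\<close> inside \<open>times_n\<close>.\<close>

lemma run_fill:
  assumes n: "R 0 = n"
    and t: "\<And>i j k M'. i < n \<Longrightarrow> j < n \<Longrightarrow> (\<And>a. \<not> in_layer n T a \<Longrightarrow> M' a = M a) \<Longrightarrow>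
       ev t (R(8 := i, 9 := j, 35 := k)) M' = T"
    and e: "\<And>i j M'. i < n \<Longrightarrow> j < n \<Longrightarrow> (\<And>a. \<not> in_layer n T a \<Longrightarrow> M' a = M a) \<Longrightarrow>
       ev e (R(8 := i, 9 := j)) M' = g i j"
  shows "\<exists>R' M'. run (fill t e) (R, M) = (R', M') \<and> (\<forall>y. y \<noteq> 8 \<longrightarrow> y \<noteq> 9 \<longrightarrow> R' y = R y) \<and>
    (\<forall>a. \<not> in_layer n T a \<longrightarrow> M' a = M a) \<and>
    (\<forall>i<n. \<forall>j<n. M' (n * (n * T + i) + j) = g i j)"
proof -
  define B where "B = n * (n * T)"
  \<comment> \<open>Both loops count down, so the layer is filled from its top address:
    \<open>F c\<close> is the memory when all its cells from \<open>c\<close> on are done.\<close>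
  define F where "F c = (\<lambda>a. if c \<le> a \<and> a < B + n * n then g ((a - B) div n) ((a - B) mod n) else M a)" for c
  define J where "J i j s \<longleftrightarrow> (\<exists>k. fst s = R(8 := i, 9 := k)) \<and> snd s = F (B + i * n + j)" for i j s
  define I where "I i s \<longleftrightarrow> (\<exists>k l. fst s = R(8 := k, 9 := l)) \<and> snd s = F (B + i * n)" for i s
  define f where "f = (\<lambda>j s. run (St (cell t (V 8) (V 9)) e) ((fst s)(9 := j), snd s))"
  have in_range: "i * n + j < n * n" if "i < n" "j < n" for i j
  proof -
    have "i * n + j < Suc i * n" using that by simp
    also have "\<dots> \<le> n * n" using that by (intro mult_right_mono) auto
    finally show ?thesis .
  qed
  have step: "J i j (f j s)" if ij: "i < n" "j < n" and J: "J i (Suc j) s" for i j s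
  proof -
    define Fc where "Fc = F (B + i * n + Suc j)"
    from J obtain k where s: "s = (R(8 := i, 9 := k), Fc)"
      by (cases s) (auto simp: J_def Fc_def)
    have F: "F c a = M a" if "\<not> in_layer n T a" "B \<le> c" for a c
      using that by (auto simp: F_def B_def)
    have et: "ev t (R(8 := i, 9 := j, 35 := k)) Fc = T" for k
      unfolding Fc_def by (rule t) (use ij F in auto)
    have ee: "ev e (R(8 := i, 9 := j)) Fc = g i j"
      unfolding Fc_def by (rule e) (use ij F in auto)
    have a: "ev (cell t (V 8) (V 9)) (R(8 := i, 9 := j)) Fc = B + i * n + j"
      using n by (simp add: cell_def times_n_def et B_def algebra_simps)
    have "Fc(B + i * n + j := g i j) = F (B + i * n + j)"
      using ij in_range[OF ij] by (auto simp: F_def Fc_def fun_eq_iff)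
    then show ?thesis unfolding J_def f_def s
      using a ee by (auto simp del: fun_upd_apply)
  qed
  have outer: "I i (countdown f (fst s 0) ((fst s)(8 := i), snd s))" if i: "i < n" and I: "I (Suc i) s" for i s
  proof -
    from I obtain k l where s: "fst s = R(8 := k, 9 := l)" "snd s = F (B + Suc i * n)"
      by (auto simp: I_def)
    have "J i n ((fst s)(8 := i), snd s)"
      unfolding J_def using s by (auto simp: algebra_simps intro!: exI[of _ l])
    then have "J i 0 (countdown f n ((fst s)(8 := i), snd s))"
      by (rule countdown_invariant[of "J i"]) (use step[OF i] in blast)
    moreover have "fst s 0 = n" using s n by simp
    ultimately show ?thesis unfolding I_def J_def by auto
  qed
  have I0: "I n (R, M)"
    unfolding I_def
    by (rule conjI, rule exI[of _ "R 8"], rule exI[of _ "R 9"]) (simp, auto simp: F_def fun_eq_iff)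
  have "I 0 (countdown (\<lambda>i s. countdown f (fst s 0) ((fst s)(8 := i), snd s)) n (R, M))"
    by (rule countdown_invariant[of I]) (use I0 outer in auto)
  moreover have "run (fill t e) (R, M) = countdown (\<lambda>i s. countdown f (fst s 0) ((fst s)(8 := i), snd s)) n (R, M)"
    using n by (simp add: fill_def f_def case_prod_unfold)
  ultimately have fin: "I 0 (run (fill t e) (R, M))" by simp
  obtain R' M' where RM: "run (fill t e) (R, M) = (R', M')" by fastforce
  from fin[unfolded RM I_def] have R': "\<forall>y. y \<noteq> 8 \<longrightarrow> y \<noteq> 9 \<longrightarrow> R' y = R y" and M': "M' = F B"
    by auto
  have "M' (n * (n * T + i) + j) = g i j" if "i < n" "j < n" for i j
  proof -
    have "n * (n * T + i) + j = B + (i * n + j)" by (simp add: B_def algebra_simps)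
    then show ?thesis using in_range[OF that] that unfolding M' by (simp add: F_def)
  qed
  then show ?thesis using RM R' M' by (auto simp: F_def B_def)
qed

definition holds_graph :: "(nat \<Rightarrow> nat \<Rightarrow> bool) \<Rightarrow> nat \<Rightarrow> (nat \<Rightarrow> nat) \<Rightarrow> bool" where
  "holds_graph A n M \<longleftrightarrow> (\<forall>i<n. \<forall>j<n. M (n * i + j) = of_bool (A i j))"

lemma cell_bounds:
  fixes i j n T :: nat
  assumes "i < n" "j < n"
  shows "n * (n * T) \<le> n * (n * T + i) + j" "n * (n * T + i) + j < n * (n * T) + n * n"
proof -
  have "n * i + j < n * Suc i" using assms by simp
  also have "\<dots> \<le> n * n" using assms by (intro mult_left_mono) auto
  finally show "n * (n * T) \<le> n * (n * T + i) + j" "n * (n * T + i) + j < n * (n * T) + n * n"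
    by (simp_all add: algebra_simps)
qed

lemma layer_disjoint:
  fixes i j n T T' :: nat
  assumes "i < n" "j < n" "T \<noteq> T'"
  shows "\<not> in_layer n T' (n * (n * T + i) + j)"
proof (cases "T < T'")
  case True
  then have "n * n * Suc T \<le> n * n * T'" by (intro mult_left_mono) auto
  then show ?thesis using cell_bounds[OF assms(1,2), of T] by (simp add: algebra_simps)
next
  case False
  then have "n * n * Suc T' \<le> n * n * T" using assms(3) by (intro mult_left_mono) auto
  then show ?thesis using cell_bounds[OF assms(1,2), of T] by (simp add: algebra_simps)
qed

lemma graph_layer_disjoint:
  fixes i j n T :: nat
  assumes "i < n" "j < n" "T \<noteq> 0"
  shows "\<not> in_layer n T (n * i + j)"
  using layer_disjoint[OF assms(1,2), of 0 T] assms by simp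

lemma ev_neq [simp]:
  "ev (neq e f) R M = 0 \<longleftrightarrow> ev e R M = ev f R M"
  "0 < ev (neq e f) R M \<longleftrightarrow> ev e R M \<noteq> ev f R M"
  by (auto simp: neq_def)

lemma run_walk_tables:
  assumes n: "R 0 = n" and uv: "R 6 = u" "R 7 = v" "u < n" "v < n" and M: "holds_graph A n M"
  shows "\<exists>R' M'. run walk_tables (R, M) = (R', M') \<and> holds_graph A n M' \<and>
    (\<forall>y. y \<notin> {8, 9, 11, 12} \<longrightarrow> R' y = R y) \<and>
    (\<forall>t x y. 1 \<le> t \<longrightarrow> t \<le> n + 1 \<longrightarrow> x < n \<longrightarrow> y < n \<longrightarrow>
       M' (n * (n * t + x) + y) = walks A n u v t x y)"
proof -
  let ?e = "Cond (neq (V 8) (V 6)) (N 0) (Cond (neq (V 9) (V 7)) (N 0) (adj (V 6) (V 7)))"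
  have "\<exists>R' M'. run (fill (N 1) ?e) (R, M) = (R', M') \<and> (\<forall>y. y \<noteq> 8 \<longrightarrow> y \<noteq> 9 \<longrightarrow> R' y = R y) \<and>
    (\<forall>a. \<not> in_layer n 1 a \<longrightarrow> M' a = M a) \<and>
    (\<forall>i<n. \<forall>j<n. M' (n * (n * 1 + i) + j) = walks A n u v 1 i j)"
  proof (rule run_fill[where R = R and n = n, OF n])
    fix i j M' assume ij: "i < n" "j < n"
      and M': "\<And>a. \<not> in_layer n 1 a \<Longrightarrow> M' a = M a"
    have "M' (n * u + v) = M (n * u + v)"
      by (rule M') (use graph_layer_disjoint[OF uv(3,4), of 1] in auto)
    then have "M' (n * u + v) = of_bool (A u v)" using M uv by (simp add: holds_graph_def)
    then show "ev ?e (R(8 := i, 9 := j)) M' = walks A n u v 1 i j"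
      using n uv by (cases "i = u"; cases "j = v") (simp_all add: adj_def times_n_def)
  qed simp
  then obtain R1 M1 where 1: "run (fill (N 1) ?e) (R, M) = (R1, M1)"
      "\<And>y. y \<noteq> 8 \<Longrightarrow> y \<noteq> 9 \<Longrightarrow> R1 y = R y"
      "\<And>a. \<not> in_layer n 1 a \<Longrightarrow> M1 a = M a"
      "\<And>i j. i < n \<Longrightarrow> j < n \<Longrightarrow> M1 (n * (n * 1 + i) + j) = walks A n u v 1 i j" by blast
  have M1: "holds_graph A n M1"
    unfolding holds_graph_def
  proof (intro allI impI)
    fix i j assume ij: "i < n" "j < n"
    have "M1 (n * i + j) = M (n * i + j)"
      by (rule 1(3)) (use graph_layer_disjoint[OF ij, of 1] in auto)
    then show "M1 (n * i + j) = of_bool (A i j)" using M ij by (simp add: holds_graph_def)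
  qed
  \<comment> \<open>Register 11 counts layers upwards while the loop index falls: with
    \<open>i\<close> rounds to go, the layers from 1 to \<open>n - i + 1\<close> are
    complete.\<close>
  define I where "I i s \<longleftrightarrow> (\<forall>y. y \<notin> {8, 9, 11, 12} \<longrightarrow> fst s y = R y) \<and> holds_graph A n (snd s) \<and>
     fst s 11 = n - i + 1 \<and> (\<forall>t x y. 1 \<le> t \<longrightarrow> t \<le> n - i + 1 \<longrightarrow> x < n \<longrightarrow> y < n \<longrightarrow>
       snd s (n * (n * t + x) + y) = walks A n u v t x y)" for i s
  let ?f = "Cond (adj (V 8) (V 9)) (Cond (neq (V 9) (V 6))
              (Sum 10 (Cond (neq (V 10) (V 9)) (Ld (cell (V 11) (V 10) (V 8))) (N 0))) (N 0)) (N 0)"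
  let ?p = "fill (Plus (V 11) (N 1)) ?f"
  let ?q = "Sq ?p (Asg 11 (Plus (V 11) (N 1)))"
  have step: "I i (run ?q ((fst s)(12 := i), snd s))" if i: "i < n" and I: "I (Suc i) s" for i s
  proof -
    define Q where "Q = (fst s)(12 := i)"
    define T where "T = n - i"
    have T: "Q 11 = T" "1 \<le> T" "n - Suc i + 1 = T" using I i by (simp_all add: I_def Q_def T_def)
    have Q: "Q 0 = n" "Q 6 = u" "Q 7 = v" using I n uv by (simp_all add: I_def Q_def)
    have S: "snd s (n * (n * t + x) + y) = walks A n u v t x y" if "1 \<le> t" "t \<le> T" "x < n" "y < n" for t x y
      using I that T(3) unfolding I_def by presburger
    have G: "snd s (n * x + y) = of_bool (A x y)" if "x < n" "y < n" for x y
      using I that unfolding I_def holds_graph_def by blast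
    have "\<exists>R' M'. run ?p (Q, snd s) = (R', M') \<and> (\<forall>y. y \<noteq> 8 \<longrightarrow> y \<noteq> 9 \<longrightarrow> R' y = Q y) \<and>
      (\<forall>a. \<not> in_layer n (Suc T) a \<longrightarrow> M' a = snd s a) \<and>
      (\<forall>i<n. \<forall>j<n. M' (n * (n * Suc T + i) + j) = walks A n u v (Suc T) i j)"
    proof (rule run_fill[where R = Q and n = n, OF Q(1)])
      fix i j M' assume ij: "i < n" "j < n"
        and M': "\<And>a. \<not> in_layer n (Suc T) a \<Longrightarrow> M' a = snd s a"
      have a: "M' (n * i + j) = of_bool (A i j)"
        using M' graph_layer_disjoint[OF ij, of "Suc T"] G[OF ij] by auto
      have b: "M' (n * (n * T + w) + i) = walks A n u v T w i" if "w < n" for w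
        using M' layer_disjoint[OF that ij(1), of T "Suc T"] S[OF T(2) order_refl that ij(1)] by auto
      have "(\<Sum>w<n. if w \<noteq> j then M' (n * (n * T + w) + i) else 0)
          = (\<Sum>w<n. if w \<noteq> j then walks A n u v T w i else 0)"
        by (intro sum.cong) (use b in auto)
      moreover obtain T' where "T = Suc T'" using T(2) by (cases T) auto
      ultimately show "ev ?f (Q(8 := i, 9 := j)) M' = walks A n u v (Suc T) i j"
        using Q T(1) a by (simp add: adj_def times_n_def cell_def cong: if_cong)
    qed (use T in simp)
    then obtain R2 M2 where 2: "run ?p (Q, snd s) = (R2, M2)"
      "\<And>y. y \<noteq> 8 \<Longrightarrow> y \<noteq> 9 \<Longrightarrow> R2 y = Q y"
      "\<And>a. \<not> in_layer n (Suc T) a \<Longrightarrow> M2 a = snd s a"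
      "\<And>i j. i < n \<Longrightarrow> j < n \<Longrightarrow> M2 (n * (n * Suc T + i) + j) = walks A n u v (Suc T) i j" by blast
    have "holds_graph A n M2"
      unfolding holds_graph_def
      using 2(3) graph_layer_disjoint[of _ n _ "Suc T"] G by (metis nat.distinct(1))
    moreover have "M2 (n * (n * t + x) + y) = walks A n u v t x y"
      if "1 \<le> t" "t \<le> n - i + 1" "x < n" "y < n" for t x y
    proof (cases "t = Suc T")
      case True
      then show ?thesis using 2(4) that by blast
    next
      case False
      then have "t \<le> T" using that(2) T_def by simp
      then show ?thesis using 2(3)[OF layer_disjoint[OF that(3,4) False]] S that by simp
    qed
    moreover have "R2 11 = n - i" using 2(2) T(1) by (simp add: T_def)
    moreover have "R2 y = R y" if "y \<notin> {8, 9, 11, 12}" for y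
      using 2(2)[of y] that I unfolding I_def Q_def by auto
    ultimately show ?thesis
      unfolding I_def using 2(1) by (simp add: Q_def)
  qed
  define s1 where "s1 = (R1(11 := 1), M1)"
  have "I n s1"
  proof -
    have "t = 1" if "1 \<le> t" "t \<le> n - n + 1" for t using that by simp
    then show ?thesis unfolding I_def s1_def using 1 M1 by auto
  qed
  then have "I 0 (countdown (\<lambda>i s. run ?q ((fst s)(12 := i), snd s)) n s1)"
    by (rule countdown_invariant[of I]) (use step in blast)
  moreover have "run walk_tables (R, M) = countdown (\<lambda>i s. run ?q ((fst s)(12 := i), snd s)) n s1"
  proof -
    have "R1 0 = n" using 1(2) n by simp
    then show ?thesis using 1(1) by (simp add: walk_tables_def s1_def case_prod_unfold)
  qed
  ultimately have fin: "I 0 (run walk_tables (R, M))" by simp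
  obtain R' M' where RM: "run walk_tables (R, M) = (R', M')" by fastforce
  from fin[unfolded RM I_def] show ?thesis using RM by auto
qed

lemma ev_closing:
  assumes n: "R 0 = n" and uv: "R 6 = u" "R 7 = v" "u < n" "v < n" and M: "holds_graph A n M"
    and l: "\<And>i j k. ev l (R(8 := i, 10 := j, 35 := k)) M = L"
    and W: "\<And>x w. x < n \<Longrightarrow> w < n \<Longrightarrow> M (n * (n * L + w) + x) = walks A n u v L w x"
  shows "ev (closing l) R M = (\<Sum>x<n. if A x u \<and> x \<noteq> v then \<Sum>w<n. walks A n u v L w x else 0)"
proof -
  have "ev (closing l) R M = (\<Sum>x<n. if M (n * x + u) \<noteq> 0
      then if x \<noteq> v then \<Sum>w<n. M (n * (n * L + w) + x) else 0 else 0)"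
    using n uv by (simp add: closing_def adj_def cell_def times_n_def l cong: if_cong)
  also have "\<dots> = (\<Sum>x<n. if A x u \<and> x \<noteq> v then \<Sum>w<n. walks A n u v L w x else 0)"
  proof (intro sum.cong refl)
    fix x assume "x \<in> {..<n}"
    then have "x < n" by simp
    then have "M (n * x + u) = of_bool (A x u)" using M uv by (simp add: holds_graph_def)
    moreover have "(\<Sum>w<n. M (n * (n * L + w) + x)) = (\<Sum>w<n. walks A n u v L w x)"
      using W \<open>x < n\<close> by simp
    ultimately show "(if M (n * x + u) \<noteq> 0
      then if x \<noteq> v then \<Sum>w<n. M (n * (n * L + w) + x) else 0 else 0)
      = (if A x u \<and> x \<noteq> v then \<Sum>w<n. walks A n u v L w x else 0)" by simp
  qed
  finally show ?thesis .
qed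

text \<open>The bounds on \<open>m\<close> keep the layers \<open>m - 1\<close>, \<open>m\<close>
  and \<open>2 * m - 1\<close>, which are read here, within the tabulated range from 1 to
  \<open>n + 1\<close>.\<close>

lemma run_count_walks:
  assumes n: "R 0 = n" and m: "R 16 = m" "2 \<le> m" "2 * m \<le> n" and M: "holds_graph A n M"
    and z: "R 17 = 0" "R 18 = 0" "R 19 = 0"
  shows "\<exists>R' M'. run count_walks (R, M) = (R', M') \<and> holds_graph A n M' \<and>
    (\<forall>y. y \<notin> {6, 7, 8, 9, 11, 12, 17, 18, 19} \<longrightarrow> R' y = R y) \<and>
    R' 17 = closed_walks A n m \<and> R' 18 = closed_walks A n (m + 1) \<and>
    R' 19 = closed_walks A n (2 * m)"
proof -
  define c where "c L u v = (\<Sum>x<n. if A x u \<and> x \<noteq> v then \<Sum>w<n. walks A n u v L w x else 0)" for L u v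
  let ?p = "Sq walk_tables
     (Sq (Asg 17 (Plus (V 17) (closing (Minus (V 16) (N 1)))))
     (Sq (Asg 18 (Plus (V 18) (closing (V 16))))
         (Asg 19 (Plus (V 19) (closing (Minus (Plus (V 16) (V 16)) (N 1)))))))"
  define K where "K s \<longleftrightarrow> (\<forall>y. y \<notin> {6, 7, 8, 9, 11, 12, 17, 18, 19} \<longrightarrow> fst s y = R y) \<and> holds_graph A n (snd s)"
    for s
  define sm where "sm L i = (\<Sum>u\<in>{i..<n}. \<Sum>v<n. c L u v)" for L i
  define J where "J u j s \<longleftrightarrow> K s \<and> fst s 6 = u \<and>
      fst s 17 = sm (m - 1) (Suc u) + (\<Sum>v\<in>{j..<n}. c (m - 1) u v) \<and>
      fst s 18 = sm m (Suc u) + (\<Sum>v\<in>{j..<n}. c m u v) \<and>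
      fst s 19 = sm (2 * m - 1) (Suc u) + (\<Sum>v\<in>{j..<n}. c (2 * m - 1) u v)" for u j s
  define I where "I i s \<longleftrightarrow> K s \<and> fst s 17 = sm (m - 1) i \<and> fst s 18 = sm m i \<and>
      fst s 19 = sm (2 * m - 1) i" for i s
  define f where "f = (\<lambda>j s. run ?p ((fst s)(7 := j), snd s))"
  have step: "J u j (f j s)" if u: "u < n" and j: "j < n" and J: "J u (Suc j) s" for u j s
  proof -
    define Q where "Q = (fst s)(7 := j)"
    have Q: "Q 0 = n" "Q 6 = u" "Q 7 = j" "Q 16 = m" "holds_graph A n (snd s)"
      using J n m by (simp_all add: J_def K_def Q_def)
    from run_walk_tables[OF Q(1,2,3) u j Q(5)] obtain R1 M1 where
      1: "run walk_tables (Q, snd s) = (R1, M1)" "holds_graph A n M1"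
        "\<And>y. y \<notin> {8, 9, 11, 12} \<Longrightarrow> R1 y = Q y"
        "\<And>t x y. 1 \<le> t \<Longrightarrow> t \<le> n + 1 \<Longrightarrow> x < n \<Longrightarrow> y < n \<Longrightarrow>
           M1 (n * (n * t + x) + y) = walks A n u j t x y" by blast
    have cl: "ev (closing l) (R1(17 := a, 18 := b)) M1 = c L u j"
      if "\<And>i j k. ev l (R1(17 := a, 18 := b, 8 := i, 10 := j, 35 := k)) M1 = L" "1 \<le> L" "L \<le> n + 1" for l L a b
      unfolding c_def
      by (rule ev_closing[OF _ _ _ u j 1(2)]) (use 1(3,4) Q that in auto)
    have id: "R1 = R1(17 := R1 17, 18 := R1 18)" for R1 :: "nat \<Rightarrow> nat" by simp
    have c1: "ev (closing (Minus (V 16) (N 1))) R1 M1 = c (m - 1) u j"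
      by (subst id, rule cl) (use 1(3) Q m in auto)
    have c2: "ev (closing (V 16)) (R1(17 := a)) M1 = c m u j" for a
    proof -
      have "R1(17 := a) = R1(17 := a, 18 := R1 18)" by auto
      then show ?thesis using cl[of "V 16" a "R1 18" m] 1(3) Q m by simp
    qed
    have c3: "ev (closing (Minus (Plus (V 16) (V 16)) (N 1))) (R1(17 := a, 18 := b)) M1 = c (2 * m - 1) u j" for a b
      by (rule cl) (use 1(3) Q m in auto)
    have f: "f j s = (R1(17 := R1 17 + c (m - 1) u j, 18 := R1 18 + c m u j,
        19 := R1 19 + c (2 * m - 1) u j), M1)"
      unfolding f_def using 1(1) by (simp add: Q_def[symmetric] c1 c2 c3 del: One_nat_def)
    have R1: "R1 17 = fst s 17" "R1 18 = fst s 18" "R1 19 = fst s 19" "R1 6 = u"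
      using 1(3) Q by (simp_all add: Q_def)
    have K: "R1 y = R y" if "y \<notin> {6, 7, 8, 9, 11, 12, 17, 18, 19}" for y
      using 1(3)[of y] J that by (simp add: J_def K_def Q_def)
    have s: "(\<Sum>v\<in>{j..<n}. c L u v) = (\<Sum>v\<in>{Suc j..<n}. c L u v) + c L u j" for L
      using j by (simp add: sum.atLeast_Suc_lessThan)
    show ?thesis unfolding J_def K_def f using J R1 K 1(2) by (simp add: J_def s)
  qed
  have outer: "I i (countdown f (fst s 0) ((fst s)(6 := i), snd s))" if i: "i < n" and I: "I (Suc i) s" for i s
  proof -
    have "J i n ((fst s)(6 := i), snd s)"
      using I by (simp add: J_def I_def K_def)
    then have "J i 0 (countdown f n ((fst s)(6 := i), snd s))"
      by (rule countdown_invariant[of "J i"]) (use step[OF i] in blast)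
    moreover have "fst s 0 = n" using I n by (simp add: I_def K_def)
    moreover have "sm L i = sm L (Suc i) + (\<Sum>v\<in>{0..<n}. c L i v)" for L
      using i by (simp add: sm_def sum.atLeast_Suc_lessThan atLeast0LessThan)
    ultimately show ?thesis by (simp add: I_def J_def)
  qed
  have "I n (R, M)" using M z by (simp add: I_def K_def sm_def)
  then have "I 0 (countdown (\<lambda>i s. countdown f (fst s 0) ((fst s)(6 := i), snd s)) n (R, M))"
    by (rule countdown_invariant[of I]) (use outer in blast)
  moreover have "run count_walks (R, M) = countdown (\<lambda>i s. countdown f (fst s 0) ((fst s)(6 := i), snd s)) n (R, M)"
    using n by (simp add: count_walks_def run_For f_def del: run.simps)
  ultimately have fin: "I 0 (run count_walks (R, M))" by simp
  obtain R' M' where RM: "run count_walks (R, M) = (R', M')" by fastforce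
  have "sm (j - 1) 0 = closed_walks A n j" for j
    unfolding sm_def closed_walks_def c_def atLeast0LessThan ..
  from this[of m] this[of "m + 1"] this[of "2 * m"] fin[unfolded RM I_def K_def] show ?thesis
    using RM by auto
qed

section \<open>The estimator\<close>

notation Sq (infixr ";;" 60)

text \<open>The number of binary digits of \<open>a\<close>, capped at \<open>n\<close> because a
  loop has only \<open>n\<close> rounds.\<close>

definition bits :: "nat \<Rightarrow> nat \<Rightarrow> nat" where
  "bits n a = card {i. i < n \<and> 2 ^ i \<le> a}"

lemma run_bit_length:
  assumes n: "R 0 = n" and xy: "x \<notin> {12, 13, y}" "y \<notin> {0, 12, 13}"
  shows "\<exists>R'. run (bit_length x y) (R, M) = (R', M) \<and> (\<forall>z. z \<notin> {12, 13, y} \<longrightarrow> R' z = R z) \<and>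
    R' y = bits n (R x)"
proof -
  let ?q = "Asg y (Plus (V y) (Cond (less_expr (V x) (V 13)) (N 0) (N 1))) ;; Asg 13 (Plus (V 13) (V 13))"
  define I where "I i s \<longleftrightarrow> snd s = M \<and> (\<forall>z. z \<notin> {12, 13, y} \<longrightarrow> fst s z = R z) \<and>
    fst s 13 = 2 ^ (n - i) \<and> fst s y = card {k. k < n - i \<and> 2 ^ k \<le> R x}" for i s
  have "I i (run ?q ((fst s)(12 := i), snd s))" if i: "i < n" and I: "I (Suc i) s" for i s
  proof -
    have d: "n - i = Suc (n - Suc i)" using i by simp
    have "{k. k < n - i \<and> 2 ^ k \<le> R x} = {k. k < n - Suc i \<and> 2 ^ k \<le> R x} \<union>
        (if 2 ^ (n - Suc i) \<le> R x then {n - Suc i} else {})"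
      unfolding d by (auto simp: less_Suc_eq)
    then have "card {k. k < n - i \<and> 2 ^ k \<le> R x} = card {k. k < n - Suc i \<and> 2 ^ k \<le> R x} +
        (if 2 ^ (n - Suc i) \<le> R x then 1 else 0)"
      by (simp add: card_insert_if)
    moreover have "fst s x = R x" using I xy by (simp add: I_def)
    ultimately show ?thesis using I xy unfolding I_def by (auto simp: less_expr_def d)
  qed
  then have "I 0 (countdown (\<lambda>i s. run ?q ((fst s)(12 := i), snd s)) n (R(13 := 1, y := 0), M))"
    by (intro countdown_invariant[of I]) (use xy in \<open>auto simp: I_def\<close>)
  moreover have "run (bit_length x y) (R, M) =
      countdown (\<lambda>i s. run ?q ((fst s)(12 := i), snd s)) n (R(13 := 1, y := 0), M)"
    using n xy by (simp add: bit_length_def case_prod_unfold)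
  ultimately have "I 0 (run (bit_length x y) (R, M))" by simp
  then show ?thesis unfolding I_def bits_def
    by (intro exI[of _ "fst (run (bit_length x y) (R, M))"]) (auto simp: prod_eq_iff)
qed

definition degree_sum :: "(nat \<Rightarrow> nat \<Rightarrow> bool) \<Rightarrow> nat \<Rightarrow> nat" where
  "degree_sum A n = (\<Sum>u<n. \<Sum>v<n. of_bool (A u v))"

lemma ev_times_deg:
  assumes "R 0 = n" "holds_graph A n M" "\<And>i j. ev e (R(6 := i, 7 := j)) M = a"
  shows "ev (times_deg e) R M = degree_sum A n * a"
proof -
  have "ev (times_deg e) R M = (\<Sum>u<n. \<Sum>v<n. if M (n * u + v) \<noteq> 0 then a else 0)"
    using assms(1,3) by (simp add: times_deg_def adj_def times_n_def cong: if_cong)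
  also have "\<dots> = (\<Sum>u<n. \<Sum>v<n. of_bool (A u v) * a)"
    using assms(2) by (intro sum.cong refl) (auto simp: holds_graph_def)
  finally show ?thesis by (simp add: degree_sum_def sum_distrib_right)
qed

text \<open>A loop always has \<open>n\<close> rounds; letting only those act whose index is below
  the value of \<open>e\<close> gives that many multiplications, provided that the value is at most
  \<open>n\<close>.\<close>

definition mult_below :: "expr \<Rightarrow> (expr \<Rightarrow> expr) \<Rightarrow> nat \<Rightarrow> prog" where
  "mult_below e f x = Asg x (Cond (less_expr (V 12) e) (f (V x)) (V x))"

lemma ev_mult_below_times_n:
  assumes "R 0 = n" "R 12 = i" "ev e R M = m" "R x = n ^ (m - Suc i) * c" "x \<noteq> 35"
  shows "ev (Cond (less_expr (V 12) e) (times_n (V x)) (V x)) R M = n ^ (m - i) * c"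
proof -
  have "m - i = Suc (m - Suc i)" if "i < m" using that by simp
  then show ?thesis using assms by (auto simp: less_expr_def times_n_def)
qed

lemma ev_mult_below_times_deg:
  assumes "R 0 = n" "holds_graph A n M" "R 12 = i" "ev e R M = m"
    "R x = degree_sum A n ^ (m - Suc i)" "x \<noteq> 6" "x \<noteq> 7"
  shows "ev (Cond (less_expr (V 12) e) (times_deg (V x)) (V x)) R M = degree_sum A n ^ (m - i)"
proof -
  have "m - i = Suc (m - Suc i)" if "i < m" using that by simp
  moreover have "ev (times_deg (V x)) R M = degree_sum A n * R x"
    by (rule ev_times_deg) (use assms in auto)
  ultimately show ?thesis using assms by (auto simp: less_expr_def)
qed

text \<open>For a walk count in register \<open>z\<close>, the difference of the two results is a
  centred number times a power of \<open>n\<close>, so that no fractions arise.\<close>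

definition power_prog :: "expr \<Rightarrow> nat \<Rightarrow> nat \<Rightarrow> nat \<Rightarrow> prog" where
  "power_prog e z x y = Asg x (V z) ;; Asg y (N 1) ;;
     For 12 (mult_below e times_n x ;; mult_below e times_deg y)"

lemma run_power_prog:
  assumes n: "R 0 = n" and M: "holds_graph A n M"
    and e: "\<And>Q. (\<And>w. w \<notin> {12, x, y} \<Longrightarrow> Q w = R w) \<Longrightarrow> ev e Q M = m" and m: "m \<le> n"
    and xy: "x \<notin> {0, 12, 35, y}" "y \<notin> {0, 6, 7, 12}"
  shows "\<exists>R'. run (power_prog e z x y) (R, M) = (R', M) \<and> (\<forall>w. w \<notin> {12, x, y} \<longrightarrow> R' w = R w) \<and>
    R' x = n ^ m * R z \<and> R' y = degree_sum A n ^ m"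
proof -
  let ?q = "mult_below e times_n x ;; mult_below e times_deg y" and ?d = "degree_sum A n"
  \<comment> \<open>The exponent \<open>m - i\<close> is truncated: it is 0 at the start because
    \<open>m \<le> n\<close>, and stays 0 until the index falls below \<open>m\<close>.\<close>
  define I where "I i s \<longleftrightarrow> snd s = M \<and> (\<forall>w. w \<notin> {12, x, y} \<longrightarrow> fst s w = R w) \<and>
    fst s x = n ^ (m - i) * R z \<and> fst s y = ?d ^ (m - i)" for i s
  have "I i (run ?q ((fst s)(12 := i), snd s))" if i: "i < n" and I: "I (Suc i) s" for i s
  proof -
    obtain Q where s: "s = (Q, M)" using I by (cases s) (auto simp: I_def)
    have Q: "Q w = R w" if "w \<notin> {12, x, y}" for w using I that by (auto simp: I_def s)
    define Q1 where "Q1 = Q(12 := i)"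
    define Q2 where "Q2 = Q1(x := n ^ (m - i) * R z)"
    have e12: "ev e Q1 M = m" "ev e Q2 M = m"
      by (rule e; use Q in \<open>simp add: Q1_def Q2_def\<close>)+
    have "ev (Cond (less_expr (V 12) e) (times_n (V x)) (V x)) Q1 M = n ^ (m - i) * R z"
      by (rule ev_mult_below_times_n) (use I Q n xy e12 in \<open>auto simp: I_def s Q1_def\<close>)
    then have "run (mult_below e times_n x) (Q1, M) = (Q2, M)"
      by (simp add: mult_below_def Q2_def del: ev.simps)
    moreover have "ev (Cond (less_expr (V 12) e) (times_deg (V y)) (V y)) Q2 M = ?d ^ (m - i)"
      by (rule ev_mult_below_times_deg) (use I Q n xy e12 M in \<open>auto simp: I_def s Q1_def Q2_def\<close>)
    then have "run (mult_below e times_deg y) (Q2, M) = (Q2(y := ?d ^ (m - i)), M)"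
      by (simp add: mult_below_def del: ev.simps)
    ultimately have "run ?q ((fst s)(12 := i), snd s) = (Q2(y := ?d ^ (m - i)), M)"
      by (simp add: s Q1_def)
    then show ?thesis using Q xy by (auto simp: I_def Q2_def Q1_def)
  qed
  moreover define R1 where "R1 = R(x := R z, y := 1)"
  moreover have "I n (R1, M)" using m xy by (simp add: I_def R1_def)
  ultimately have "I 0 (countdown (\<lambda>i s. run ?q ((fst s)(12 := i), snd s)) n (R1, M))"
    by (intro countdown_invariant[of I]) auto
  moreover have "run (power_prog e z x y) (R, M) = countdown (\<lambda>i s. run ?q ((fst s)(12 := i), snd s)) n (R1, M)"
  proof -
    have "R1 0 = n" using n xy by (simp add: R1_def)
    then show ?thesis by (simp add: power_prog_def run_For R1_def del: run.simps(4))
  qed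
  ultimately have "I 0 (run (power_prog e z x y) (R, M))" by simp
  then show ?thesis unfolding I_def
    by (intro exI[of _ "fst (run (power_prog e z x y) (R, M))"]) (auto simp: prod_eq_iff)
qed

text \<open>Let \<open>y\<close> and \<open>y2\<close> be the centred numbers of lengths
  \<open>m\<close> and \<open>2 * m\<close>. Register 32 is the integer part \<open>w\<close> of
  \<open>y\<close>, found by counting the multiples of \<open>n ^ m\<close> up to register 28.
  Register 33 counts the \<open>i\<close> with \<open>i + 1/2 \<le> w * y / y2\<close>, which rounds
  this quotient. With \<open>v\<close> in register 28, \<open>n * v\<close> is the common
  denominator of the estimates \<open>D + K * sh\<close> and \<open>D - sh\<close> of
  \<open>a\<close> and \<open>b\<close>, where \<open>K\<close> is register 33 and \<open>sh\<close>
  the ratio of the centred numbers of lengths \<open>m + 1\<close> and \<open>m\<close>.\<close>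

definition final :: prog where
  "final = Asg 28 (Minus (V 22) (V 23)) ;; Asg 29 (Minus (V 24) (V 25)) ;;
     Asg 30 (Minus (V 25) (V 24)) ;; Asg 31 (Minus (V 26) (V 27)) ;;
     Asg 32 (Sum 6 (Cond (less_expr (V 28) (Sum 7 (Cond (less_expr (V 6) (V 7)) (N 0) (V 21)))) (N 0) (N 1))) ;;
     Asg 33 (Sum 6 (Cond (less_expr (Sum 7 (Cond (less_expr (V 7) (V 32)) (Plus (V 34) (V 34)) (N 0)))
         (Plus (V 31) (Sum 7 (Cond (less_expr (V 7) (V 6)) (Plus (V 31) (V 31)) (N 0))))) (N 0) (N 1))) ;;
     Asg 5 (Minus (Plus (times_deg (V 28)) (Sum 7 (Cond (less_expr (V 7) (V 33)) (V 29) (N 0))))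
         (Sum 7 (Cond (less_expr (V 7) (V 33)) (V 30) (N 0)))) ;;
     Asg 1 (times_n (V 28)) ;;
     Asg 2 (Minus (Plus (times_deg (V 28)) (V 30)) (V 29)) ;;
     Asg 3 (times_n (V 28)) ;; Asg 4 (Plus (V 33) (N 1))"

text \<open>
  Register 16 holds the length \<open>m\<close>; registers 17, 18, 19 hold the numbers of closed walks of lengths
  \<open>m\<close>, \<open>m + 1\<close>, \<open>2 * m\<close>; registers 28, 29 - 30, 31 hold the centred numbers, scaled by the
  corresponding power of \<open>n\<close>; register 33 holds the estimate of \<open>k - 1\<close>.
\<close>

definition main :: prog where
  "main = bit_length 0 14 ;; bit_length 14 15 ;; Asg 16 (Plus (V 15) (V 15)) ;; count_walks ;;
     Asg 20 (N 1) ;; power_prog (V 16) 20 21 23 ;; power_prog (V 16) 17 22 23 ;;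
     power_prog (Plus (V 16) (N 1)) 18 24 25 ;; power_prog (Plus (V 16) (V 16)) 19 26 27 ;;
     Asg 28 (Minus (V 22) (V 23)) ;; power_prog (V 16) 28 34 20 ;; final"

lemma wf_main: "wf_prog 40 main"
  by (simp add: main_def bit_length_def count_walks_def power_prog_def final_def walk_tables_def
    closing_def fill_def mult_below_def cell_def times_n_def times_deg_def adj_def less_expr_def neq_def)

text \<open>This is how the program multiplies \<open>c\<close> by \<open>w\<close>; the cap
  \<open>min w n\<close> disappears whenever \<open>w\<close> is itself a count of indices below
  \<open>n\<close>.\<close>

lemma sum_if_less:
  "(\<Sum>j<n. if j < w then c else 0) = min w n * (c::nat)"
proof -
  have "(\<Sum>j<n. if j < w then c else 0) = (\<Sum>j\<in>{..<n} \<inter> {j. j < w}. c)"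
    by (rule sum.inter_restrict[symmetric, where B = "{j. j < w}", simplified]) simp
  also have "{..<n} \<inter> {j. j < w} = {..<min w n}" by auto
  finally show ?thesis by simp
qed

lemma sum_if_le:
  assumes "i < n"
  shows "(\<Sum>j<n. if i < j then 0 else c) = Suc i * (c::nat)"
proof -
  have "(\<Sum>j<n. if i < j then 0 else c) = (\<Sum>j<n. if j < Suc i then c else 0)"
    by (intro sum.cong) auto
  then show ?thesis using assms by (simp add: sum_if_less)
qed

lemma sum_indicator_card:
  "(\<Sum>i<n. if P i then 0 else 1) = card {i. i < n \<and> \<not> P (i::nat)}"
proof -
  have "(\<Sum>i<n. if P i then 0 else 1) = (\<Sum>i<n. of_bool (\<not> P i) :: nat)"
    by (intro sum.cong) auto
  also have "\<dots> = card {i. i < n \<and> \<not> P i}"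
    by (subst sum_of_bool_eq) (auto intro: arg_cong[of _ _ card])
  finally show ?thesis .
qed


lemma run_final:
  assumes n: "R 0 = n" and M: "holds_graph A n M"
    and R: "R 21 = q" "R 22 - R 23 = v" "R 24 - R 25 = u" "R 25 - R 24 = u'" "R 26 - R 27 = v2" "R 34 = vq"
    and w: "w = card {i. i < n \<and> Suc i * q \<le> v}"
    and k: "k = card {i. i < n \<and> (2 * i + 1) * v2 \<le> 2 * w * vq}"
    and d: "d = degree_sum A n"
  shows "let R' = fst (run final (R, M)) in R' 5 = d * v + k * u - k * u' \<and> R' 1 = n * v \<and>
    R' 2 = d * v + u' - u \<and> R' 3 = n * v \<and> R' 4 = k + 1"
proof -
  have "w \<le> card {..<n}" "k \<le> card {..<n}" unfolding w k by (intro card_mono; auto)+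
  then have wk: "min w n = w" "min k n = k" by auto
  have td: "ev (times_deg (V 28)) R M = d * R 28" if "R 0 = n" for R
    unfolding d by (rule ev_times_deg) (use M that in auto)
  have ev_w: "ev (Sum 6 (Cond (less_expr (V 28) (Sum 7 (Cond (less_expr (V 6) (V 7)) (N 0) (V 21)))) (N 0) (N 1))) Q M = w"
    if "Q 0 = n" "Q 28 = v" "Q 21 = q" for Q
  proof -
    have "ev (Sum 6 (Cond (less_expr (V 28) (Sum 7 (Cond (less_expr (V 6) (V 7)) (N 0) (V 21)))) (N 0) (N 1))) Q M
        = (\<Sum>i<n. if v < (\<Sum>j<n. if i < j then 0 else q) then 0 else 1)"
      using that by (simp add: less_expr_def not_le cong: if_cong)
    also have "\<dots> = (\<Sum>i<n. if v < Suc i * q then 0 else 1)"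
      by (intro sum.cong refl) (simp add: sum_if_le)
    also have "\<dots> = w" unfolding sum_indicator_card w by (simp add: not_less)
    finally show ?thesis .
  qed
  have ev_k: "ev (Sum 6 (Cond (less_expr (Sum 7 (Cond (less_expr (V 7) (V 32)) (Plus (V 34) (V 34)) (N 0)))
         (Plus (V 31) (Sum 7 (Cond (less_expr (V 7) (V 6)) (Plus (V 31) (V 31)) (N 0))))) (N 0) (N 1))) Q M = k"
    if "Q 0 = n" "Q 32 = w" "Q 34 = vq" "Q 31 = v2" for Q
  proof -
    have "ev (Sum 6 (Cond (less_expr (Sum 7 (Cond (less_expr (V 7) (V 32)) (Plus (V 34) (V 34)) (N 0)))
         (Plus (V 31) (Sum 7 (Cond (less_expr (V 7) (V 6)) (Plus (V 31) (V 31)) (N 0))))) (N 0) (N 1))) Q M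
        = (\<Sum>i<n. if (\<Sum>j<n. if j < w then vq + vq else 0) < v2 + (\<Sum>j<n. if j < i then v2 + v2 else 0) then 0 else 1)"
      using that by (simp add: less_expr_def not_le cong: if_cong)
    also have "\<dots> = (\<Sum>i<n. if 2 * w * vq < (2 * i + 1) * v2 then 0 else 1)"
      by (intro sum.cong refl) (simp add: sum_if_less wk algebra_simps)
    also have "\<dots> = k" unfolding sum_indicator_card k by (simp add: not_less)
    finally show ?thesis .
  qed
  have ev_s: "ev (Sum 7 (Cond (less_expr (V 7) (V 33)) (V x) (N 0))) Q M = k * Q x"
    if "Q 0 = n" "Q 33 = k" "x \<noteq> 7" for Q x
  proof -
    have "ev (Sum 7 (Cond (less_expr (V 7) (V 33)) (V x) (N 0))) Q M = (\<Sum>j<n. if j < k then Q x else 0)"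
      using that by (simp add: less_expr_def not_le cong: if_cong)
    then show ?thesis by (simp add: sum_if_less wk)
  qed
  show ?thesis
    using n R
    by (simp add: final_def ev_w ev_k ev_s td times_n_def Let_def del: ev.simps(7) One_nat_def)
      (simp add: times_n_def)
qed

text \<open>\<open>u\<close> and \<open>u'\<close> are the positive and the negative part of the
  scaled centred number of length \<open>m + 1\<close>, whose sign is that of \<open>a - b\<close>
  and unknown to the program. For the even lengths \<open>m\<close> and \<open>2 * m\<close> a
  positive value is expected, and one truncated difference suffices.\<close>

lemma run_main:
  fixes n E
  defines "A \<equiv> \<lambda>u v. {u, v} \<in> E"
  assumes m: "m = 2 * bits n (bits n n)" "2 \<le> m" "2 * m \<le> n"
    and d: "d = degree_sum A n"
    and v: "v = n ^ m * closed_walks A n m - d ^ m"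
    and u: "u = n ^ (m + 1) * closed_walks A n (m + 1) - d ^ (m + 1)"
           "u' = d ^ (m + 1) - n ^ (m + 1) * closed_walks A n (m + 1)"
    and v2: "v2 = n ^ (2 * m) * closed_walks A n (2 * m) - d ^ (2 * m)"
    and w: "w = card {i. i < n \<and> Suc i * n ^ m \<le> v}"
    and k: "k = card {i. i < n \<and> (2 * i + 1) * v2 \<le> 2 * w * (n ^ m * v)}"
  shows "let R = fst (run main (graph_input n E)) in R 5 = d * v + k * u - k * u' \<and> R 1 = n * v \<and>
    R 2 = d * v + u' - u \<and> R 3 = n * v \<and> R 4 = k + 1"
proof -
  obtain R M where gi: "graph_input n E = (R, M)" by (cases "graph_input n E")
  have R: "R 0 = n" "\<And>x. x \<noteq> 0 \<Longrightarrow> R x = 0" using gi by (auto simp: graph_input_def)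
  have M: "holds_graph A n M"
    unfolding holds_graph_def
  proof (intro allI impI)
    fix i j assume ij: "i < n" "j < n"
    then have "n * i + j < n * n"
      using cell_bounds(2)[OF ij, of 0] by simp
    moreover have "(n * i + j) div n = i" "(n * i + j) mod n = j" using ij by simp_all
    ultimately show "M (n * i + j) = of_bool (A i j)"
      using gi by (auto simp: graph_input_def A_def)
  qed
  obtain R1 where 1: "run (bit_length 0 14) (R, M) = (R1, M)"
     "\<And>z. z \<notin> {12, 13, 14} \<Longrightarrow> R1 z = R z" "R1 14 = bits n n"
    using run_bit_length[of R n 0 14 M] R by auto
  obtain R2 where 2: "run (bit_length 14 15) (R1, M) = (R2, M)"
     "\<And>z. z \<notin> {12, 13, 15} \<Longrightarrow> R2 z = R1 z" "R2 15 = bits n (bits n n)"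
    using run_bit_length[of R1 n 14 15 M] R 1 by auto
  define R3 where "R3 = R2(16 := m)"
  have 3: "run (Asg 16 (Plus (V 15) (V 15))) (R2, M) = (R3, M)"
    using 2(3) m by (simp add: R3_def mult_2)
  have R3: "R3 0 = n" "R3 16 = m" "R3 17 = 0" "R3 18 = 0" "R3 19 = 0"
    using 1(2) 2(2) R by (simp_all add: R3_def)
  obtain R4 M4 where 4: "run count_walks (R3, M) = (R4, M4)" "holds_graph A n M4"
    "\<And>y. y \<notin> {6, 7, 8, 9, 11, 12, 17, 18, 19} \<Longrightarrow> R4 y = R3 y"
    "R4 17 = closed_walks A n m" "R4 18 = closed_walks A n (m + 1)" "R4 19 = closed_walks A n (2 * m)"
    using run_count_walks[OF R3(1,2) m(2,3) M R3(3-5)] by blast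
  have R4: "R4 0 = n" "R4 16 = m" using 4(3) R3 by simp_all
  define R5 where "R5 = R4(20 := 1)"
  have 5: "run (Asg 20 (N 1)) (R4, M4) = (R5, M4)" by (simp add: R5_def)
  have R5: "R5 0 = n" "R5 16 = m" "R5 20 = 1" "R5 17 = closed_walks A n m"
    "R5 18 = closed_walks A n (m + 1)" "R5 19 = closed_walks A n (2 * m)"
    using R4 4 by (simp_all add: R5_def)
  \<comment> \<open>Register 20 is 1, so register 21 becomes \<open>n ^ m\<close> itself, the unit
    against which \<open>v\<close> is measured.\<close>
  obtain Q1 where Q1: "run (power_prog (V 16) 20 21 23) (R5, M4) = (Q1, M4)"
    "\<And>w. w \<notin> {12, 21, 23} \<Longrightarrow> Q1 w = R5 w" "Q1 21 = n ^ m"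
    using run_power_prog[of R5 n A M4 21 23 "V 16" m 20] 4(2) R5 m by auto
  obtain Q2 where Q2: "run (power_prog (V 16) 17 22 23) (Q1, M4) = (Q2, M4)"
    "\<And>w. w \<notin> {12, 22, 23} \<Longrightarrow> Q2 w = Q1 w" "Q2 22 = n ^ m * R5 17" "Q2 23 = degree_sum A n ^ m"
    using run_power_prog[of Q1 n A M4 22 23 "V 16" m 17] 4(2) R5 Q1 m by auto
  obtain Q3 where Q3: "run (power_prog (Plus (V 16) (N 1)) 18 24 25) (Q2, M4) = (Q3, M4)"
    "\<And>w. w \<notin> {12, 24, 25} \<Longrightarrow> Q3 w = Q2 w" "Q3 24 = n ^ (m + 1) * R5 18" "Q3 25 = degree_sum A n ^ (m + 1)"
    using run_power_prog[of Q2 n A M4 24 25 "Plus (V 16) (N 1)" "m + 1" 18] 4(2) R5 Q1 Q2 m by auto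
  obtain Q4 where Q4: "run (power_prog (Plus (V 16) (V 16)) 19 26 27) (Q3, M4) = (Q4, M4)"
    "\<And>w. w \<notin> {12, 26, 27} \<Longrightarrow> Q4 w = Q3 w" "Q4 26 = n ^ (2 * m) * R5 19" "Q4 27 = degree_sum A n ^ (2 * m)"
    using run_power_prog[of Q3 n A M4 26 27 "Plus (V 16) (V 16)" "2 * m" 19] 4(2) R5 Q1 Q2 Q3 m
    by auto
  define R6 where "R6 = Q4(28 := v)"
  have 6: "run (Asg 28 (Minus (V 22) (V 23))) (Q4, M4) = (R6, M4)"
    using Q4(2) Q3(2) Q2 R5 by (simp add: R6_def v d)
  have R6: "R6 w = Q4 w" if "w \<noteq> 28" for w using that by (simp add: R6_def)
  have R6': "R6 0 = n" "R6 16 = m" "R6 28 = v"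
    using Q1(2) Q2(2) Q3(2) Q4(2) R5 by (simp_all add: R6_def)
  obtain R7 where 7: "run (power_prog (V 16) 28 34 20) (R6, M4) = (R7, M4)"
    "\<And>w. w \<notin> {12, 34, 20} \<Longrightarrow> R7 w = R6 w" "R7 34 = n ^ m * v"
    using run_power_prog[of R6 n A M4 34 20 "V 16" m 28] 4(2) R6' m by auto
  have R7: "R7 0 = n" "R7 21 = n ^ m" "R7 22 - R7 23 = v" "R7 24 - R7 25 = u" "R7 25 - R7 24 = u'"
    "R7 26 - R7 27 = v2"
    using 7(2) R6 R6' Q1(2,3) Q2(2-) Q3(2-) Q4(2-) R5 by (simp_all add: v u v2 d)
  have "run main (graph_input n E) = run final (R7, M4)"
    by (simp only: main_def gi run.simps(3) 1 2 3 4 5 Q1 Q2 Q3 Q4 6 7)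
  then show ?thesis
    using run_final[OF R7(1) 4(2) R7(2-6) 7(3) w k d] by simp
qed

definition estimator :: "nat \<Rightarrow> nat set set \<Rightarrow> real \<times> real \<times> real" where
  "estimator n E = (let R = fst (run main (graph_input n E)) in
     (real (R 5) / real (R 1), real (R 2) / real (R 3), real (R 4)))"

lemma polytime_estimator: "polytime_graph_estimator estimator"
  by (rule polytime_run[OF wf_main]) (simp_all add: estimator_def)

section \<open>Closed trails and cycles\<close>

definition tuples :: "nat \<Rightarrow> nat \<Rightarrow> nat list set" where
  "tuples n j = {xs. set xs \<subseteq> {..<n} \<and> length xs = j}"

lemma finite_tuples [simp]: "finite (tuples n j)"
  unfolding tuples_def by (rule finite_lists_length_eq) simp

lemma card_tuples: "card (tuples n j) = n ^ j"
  unfolding tuples_def by (subst card_lists_length_eq) auto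

lemma tuples_0 [simp]: "tuples n 0 = {[]}"
  by (auto simp: tuples_def)

lemma sum_tuples_Suc:
  "(\<Sum>xs\<in>tuples n (Suc j). f xs) = (\<Sum>x<n. \<Sum>xs\<in>tuples n j. f (x # xs))"
proof -
  have "(\<Sum>x<n. \<Sum>xs\<in>tuples n j. f (x # xs)) = (\<Sum>(x, xs)\<in>{..<n} \<times> tuples n j. f (x # xs))"
    by (rule sum.cartesian_product)
  also have "\<dots> = (\<Sum>xs\<in>tuples n (Suc j). f xs)"
    by (rule sum.reindex_bij_witness[where i = "\<lambda>xs. (hd xs, tl xs)" and j = "\<lambda>(x, xs). x # xs"])
      (auto simp: tuples_def length_Suc_conv)
  finally show ?thesis ..
qed

text \<open>Lists represent walks in reverse order: the starting vertex \<open>u\<close> is the last element.\<close>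

fun trail :: "(nat \<Rightarrow> nat \<Rightarrow> bool) \<Rightarrow> nat \<Rightarrow> nat \<Rightarrow> nat list \<Rightarrow> bool" where
  "trail A u v (y # x # w # zs) \<longleftrightarrow> A x y \<and> y \<noteq> u \<and> w \<noteq> y \<and> trail A u v (x # w # zs)"
| "trail A u v [y, x] \<longleftrightarrow> x = u \<and> y = v \<and> A u v"
| "trail A u v _ \<longleftrightarrow> False"

text \<open>As lists are reversed, \<open>last xs\<close> is the root,
  \<open>last (butlast xs)\<close> its successor, and \<open>hd xs\<close> the vertex from which the
  closing edge returns to the root.\<close>

definition closed_trail :: "(nat \<Rightarrow> nat \<Rightarrow> bool) \<Rightarrow> nat list \<Rightarrow> bool" where
  "closed_trail A xs \<longleftrightarrow> 3 \<le> length xs \<and> A (hd xs) (last xs) \<and> hd xs \<noteq> last (butlast xs) \<and>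
     trail A (last xs) (last (butlast xs)) xs"

lemma walks_eq_sum_trail:
  "walks A n u v (Suc t) x y = (\<Sum>zs\<in>tuples n t. of_bool (trail A u v (y # x # zs)))"
proof (induction t arbitrary: x y)
  case 0
  then show ?case by auto
next
  case (Suc t)
  have "walks A n u v (Suc (Suc t)) x y =
      (\<Sum>w<n. if A x y \<and> y \<noteq> u \<and> w \<noteq> y then walks A n u v (Suc t) w x else 0)"
    by (cases "A x y \<and> y \<noteq> u") (auto intro!: sum.cong simp del: walks.simps(2))
  also have "\<dots> = (\<Sum>w<n. \<Sum>zs\<in>tuples n t. of_bool (trail A u v (y # x # w # zs)))"
  proof (intro sum.cong refl)
    fix w
    show "(if A x y \<and> y \<noteq> u \<and> w \<noteq> y then walks A n u v (Suc t) w x else 0) =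
        (\<Sum>zs\<in>tuples n t. of_bool (trail A u v (y # x # w # zs)))"
      by (cases "A x y \<and> y \<noteq> u \<and> w \<noteq> y") (auto simp: Suc.IH)
  qed
  finally show ?case by (simp only: sum_tuples_Suc)
qed

lemma trail_last:
  "trail A u v xs \<Longrightarrow> last xs = u \<and> last (butlast xs) = v \<and> 2 \<le> length xs"
  by (induction A u v xs rule: trail.induct) auto

lemma closed_walks_eq_card:
  assumes "3 \<le> j"
  shows "closed_walks A n j = card {xs \<in> tuples n j. closed_trail A xs}"
proof -
  define i where "i = j - 3"
  have j: "j = Suc (Suc (Suc i))" using assms by (simp add: i_def)
  have "closed_walks A n j = (\<Sum>u<n. \<Sum>v<n. \<Sum>x<n. \<Sum>w<n. \<Sum>zs\<in>tuples n (Suc i).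
      of_bool (A x u \<and> x \<noteq> v \<and> trail A u v (x # w # zs)))"
    unfolding closed_walks_def j
    by (intro sum.cong refl) (auto simp: walks_eq_sum_trail intro!: sum.neutral sum.cong simp del: walks.simps trail.simps)
  also have "\<dots> = (\<Sum>u<n. \<Sum>v<n. \<Sum>xs\<in>tuples n j. of_bool (A (hd xs) u \<and> hd xs \<noteq> v \<and> trail A u v xs))"
    by (simp only: j sum_tuples_Suc list.sel)
  also have "\<dots> = (\<Sum>u<n. \<Sum>xs\<in>tuples n j. \<Sum>v<n. of_bool (A (hd xs) u \<and> hd xs \<noteq> v \<and> trail A u v xs))"
    by (intro sum.cong refl sum.swap)
  also have "\<dots> = (\<Sum>xs\<in>tuples n j. \<Sum>u<n. \<Sum>v<n. of_bool (A (hd xs) u \<and> hd xs \<noteq> v \<and> trail A u v xs))"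
    by (rule sum.swap)
  also have "\<dots> = (\<Sum>xs\<in>tuples n j. of_bool (closed_trail A xs))"
  proof (intro sum.cong refl)
    fix xs assume xs: "xs \<in> tuples n j"
    then have len: "3 \<le> length xs" and n: "set xs \<subseteq> {..<n}" using assms by (auto simp: tuples_def)
    let ?u = "last xs" and ?v = "last (butlast xs)"
    have "xs \<noteq> []" "butlast xs \<noteq> []" using len by (auto simp flip: length_greater_0_conv)
    then have uv: "?u < n" "?v < n"
      using subsetD[OF n last_in_set[of xs]] subsetD[OF n in_set_butlastD[OF last_in_set[of "butlast xs"]]]
      by simp_all
    \<comment> \<open>By \<open>trail_last\<close> the list determines \<open>u\<close> and
      \<open>v\<close>, so each of the two sums has at most one nonzero term.\<close>
    have single: "(\<Sum>v<n. of_bool (P v)) = (of_bool (P w) :: nat)"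
      if "w < n" "\<And>v. P v \<Longrightarrow> v = w" for P w
    proof -
      have "(\<Sum>v<n. of_bool (P v)) = (\<Sum>v\<in>{w}. of_bool (P v) :: nat)"
        by (rule sum.mono_neutral_right) (use that in auto)
      then show ?thesis by (simp del: sum_of_bool_eq)
    qed
    have "(\<Sum>v<n. of_bool (A (hd xs) u \<and> hd xs \<noteq> v \<and> trail A u v xs)) =
        (of_bool (A (hd xs) u \<and> hd xs \<noteq> ?v \<and> trail A u ?v xs) :: nat)" for u
      by (rule single) (use uv in \<open>auto dest: trail_last\<close>)
    moreover have "(\<Sum>u<n. of_bool (A (hd xs) u \<and> hd xs \<noteq> ?v \<and> trail A u ?v xs)) =
        (of_bool (A (hd xs) ?u \<and> hd xs \<noteq> ?v \<and> trail A ?u ?v xs) :: nat)"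
      by (rule single) (use uv in \<open>auto dest: trail_last\<close>)
    ultimately show "(\<Sum>u<n. \<Sum>v<n. of_bool (A (hd xs) u \<and> hd xs \<noteq> v \<and> trail A u v xs)) =
        (of_bool (closed_trail A xs) :: nat)"
      using len by (simp only: closed_trail_def simp_thms)
  qed
  also have "\<dots> = card {xs \<in> tuples n j. closed_trail A xs}"
    by (subst sum_of_bool_eq) (auto intro: arg_cong[of _ _ card])
  finally show ?thesis .
qed

section \<open>Edge sets of walks: edges against vertices\<close>

fun path_edges :: "nat list \<Rightarrow> nat set set" where
  "path_edges (x # y # zs) = insert {x, y} (path_edges (y # zs))"
| "path_edges _ = {}"

text \<open>A set, not a list: an edge traversed twice depends on a single coin and must count once
  in the powers of \<open>1 / n\<close>.\<close>

definition cycle_edges :: "nat list \<Rightarrow> nat set set" where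
  "cycle_edges xs = insert {hd xs, last xs} (path_edges xs)"

lemma finite_path_edges [simp]: "finite (path_edges xs)"
  by (induction xs rule: path_edges.induct) auto

lemma finite_cycle_edges [simp]: "finite (cycle_edges xs)"
  by (simp add: cycle_edges_def)

lemma path_edges_subset: "e \<in> path_edges xs \<Longrightarrow> e \<subseteq> set xs"
  by (induction xs rule: path_edges.induct) auto

lemma cycle_edges_subset: "xs \<noteq> [] \<Longrightarrow> e \<in> cycle_edges xs \<Longrightarrow> e \<subseteq> set xs"
  using path_edges_subset by (auto simp: cycle_edges_def)

text \<open>Separates the shape of a walk, expressed as a trail in the complete graph
  \<open>(\<noteq>)\<close>, from the presence of its edges; only the latter is random.\<close>

lemma trail_iff_edges:
  assumes "\<And>x y. A x y \<longleftrightarrow> {x, y} \<in> E" "\<And>x. \<not> A x x"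
  shows "trail A u v xs \<longleftrightarrow> trail (\<noteq>) u v xs \<and> path_edges xs \<subseteq> E"
proof (induction xs rule: path_edges.induct)
  case (1 y x zs)
  have [simp]: "A v u \<longleftrightarrow> A u v" "{x, y} \<in> E \<longleftrightarrow> A y x" "A x y \<longleftrightarrow> A y x" "{y, x} \<in> E \<longleftrightarrow> A y x"
    using assms(1) by (simp_all add: insert_commute)
  show ?case using 1 assms(2) by (cases zs) auto
qed auto

lemma closed_trail_iff_edges:
  assumes "\<And>x y. A x y \<longleftrightarrow> {x, y} \<in> E" "\<And>x. \<not> A x x"
  shows "closed_trail A xs \<longleftrightarrow> closed_trail (\<noteq>) xs \<and> cycle_edges xs \<subseteq> E"
proof -
  have "A x y \<longrightarrow> x \<noteq> y" for x y using assms(2) by blast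
  then show ?thesis
    unfolding closed_trail_def cycle_edges_def insert_subset trail_iff_edges[of A E, OF assms]
      assms(1)[symmetric] by blast
qed

text \<open>
  Every new vertex comes with a new edge, and so does the first return to an old vertex, as the walk
  does not backtrack.
\<close>

lemma trail_excess:
  "trail (\<noteq>) u v xs \<Longrightarrow> card (set xs) \<le> card (path_edges xs) + 1 \<and>
    (\<not> distinct xs \<longrightarrow> card (set xs) \<le> card (path_edges xs)) \<and> u \<notin> set (butlast xs)"
proof (induction "(\<noteq>) :: nat \<Rightarrow> nat \<Rightarrow> bool" u v xs rule: trail.induct)
  case (1 u v y x w zs)
  let ?S = "x # w # zs"
  from 1 have tr: "trail (\<noteq>) u v ?S" and y: "x \<noteq> y" "y \<noteq> u" "w \<noteq> y" by auto
  from 1(1)[OF tr] have IH: "card (set ?S) \<le> card (path_edges ?S) + 1"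
    "\<not> distinct ?S \<Longrightarrow> card (set ?S) \<le> card (path_edges ?S)" "u \<notin> set (butlast ?S)" by auto
  have ins: "card (path_edges (y # ?S)) = (if {y, x} \<in> path_edges ?S then card (path_edges ?S)
      else Suc (card (path_edges ?S)))"
    by (simp add: card_insert_if)
  show ?case
  proof (cases "y \<in> set ?S")
    case False
    then have "{y, x} \<notin> path_edges ?S" using path_edges_subset by blast
    moreover have "card (set (y # ?S)) = Suc (card (set ?S))"
      using False by (simp add: card_insert_if)
    ultimately show ?thesis using IH ins False y by auto
  next
    case True
    have c: "card (set (y # ?S)) = card (set ?S)" using True by (simp add: insert_absorb)
    show ?thesis
    proof (cases "distinct ?S")
      case True
      \<comment> \<open>\<open>x\<close> occurs only at the head of \<open>?S\<close>, so the only
        path edge at \<open>x\<close> is \<open>{x, w}\<close>, and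
        \<open>w \<noteq> y\<close>.\<close>
      have "{y, x} \<notin> path_edges ?S"
      proof
        assume "{y, x} \<in> path_edges ?S"
        then have "{y, x} = {x, w} \<or> {y, x} \<in> path_edges (w # zs)" by simp
        then show False
        proof
          assume "{y, x} = {x, w}"
          then show False using y by (auto simp: doubleton_eq_iff)
        next
          assume "{y, x} \<in> path_edges (w # zs)"
          then have "x \<in> set (w # zs)" using path_edges_subset by blast
          then show False using True by simp
        qed
      qed
      then show ?thesis using IH ins c y by auto
    next
      case False
      then show ?thesis using IH ins c y by auto
    qed
  qed
qed auto

lemma path_edges_last:
  "e \<in> path_edges xs \<Longrightarrow> last xs \<in> e \<Longrightarrow> last xs \<notin> set (butlast xs) \<Longrightarrow>
    e = {last (butlast xs), last xs}"
  by (induction xs rule: path_edges.induct) (auto split: if_splits)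

text \<open>The root is visited only once, so the first edge is the only path edge at it. The
  closing edge is a different one, hence new, and improves the bound of \<open>trail_excess\<close>
  by 1.\<close>

lemma closed_trail_excess:
  assumes "closed_trail (\<noteq>) xs" "\<not> distinct xs"
  shows "card (set xs) + 1 \<le> card (cycle_edges xs)"
proof -
  from assms(1) have len: "3 \<le> length xs" and h: "hd xs \<noteq> last xs" "hd xs \<noteq> last (butlast xs)"
    and tr: "trail (\<noteq>) (last xs) (last (butlast xs)) xs" by (auto simp: closed_trail_def)
  have "{hd xs, last xs} \<notin> path_edges xs"
    using path_edges_last[of "{hd xs, last xs}" xs] trail_excess[OF tr] h
    by (auto simp: doubleton_eq_iff)
  then show ?thesis using trail_excess[OF tr] assms(2) by (simp add: cycle_edges_def)
qed

lemma distinct_trail: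
  "distinct xs \<Longrightarrow> 2 \<le> length xs \<Longrightarrow> trail (\<noteq>) (last xs) (last (butlast xs)) xs"
proof (induction xs rule: path_edges.induct)
  case (1 x y zs)
  then show ?case by (cases zs) (auto split: if_splits)
qed auto

lemma distinct_closed_trail:
  assumes "distinct xs" "3 \<le> length xs"
  shows "closed_trail (\<noteq>) xs"
proof -
  obtain x y z zs where xs: "xs = x # y # z # zs"
    using assms(2) by (auto simp: numeral_3_eq_3 Suc_le_length_iff)
  have "last (z # zs) \<in> set (z # zs)" by (rule last_in_set) simp
  moreover have "last (butlast (y # z # zs)) \<in> set (y # z # zs)"
    by (rule in_set_butlastD[OF last_in_set]) simp
  ultimately have "x \<noteq> last xs" "x \<noteq> last (butlast xs)"
    using assms(1) unfolding xs by auto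
  then show ?thesis using assms distinct_trail[OF assms(1)]
    by (simp add: closed_trail_def xs)
qed

lemma path_edges_nth: "path_edges xs = {{xs ! i, xs ! Suc i} | i. Suc i < length xs}"
proof (induction xs rule: path_edges.induct)
  case (1 x y zs)
  have "{{(x # y # zs) ! i, (x # y # zs) ! Suc i} | i. Suc i < length (x # y # zs)} =
      insert {x, y} {{(y # zs) ! i, (y # zs) ! Suc i} | i. Suc i < length (y # zs)}" (is "?L = ?R")
  proof
    show "?L \<subseteq> ?R"
    proof
      fix e assume "e \<in> ?L"
      then obtain i where i: "Suc i < length (x # y # zs)" "e = {(x # y # zs) ! i, (x # y # zs) ! Suc i}"
        by blast
      then show "e \<in> ?R" by (cases i) auto
    qed
    show "?R \<subseteq> ?L"
    proof
      fix e assume "e \<in> ?R"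
      then consider "e = {x, y}" | i where "Suc i < length (y # zs)" "e = {(y # zs) ! i, (y # zs) ! Suc i}"
        by blast
      then show "e \<in> ?L"
      proof cases
        case 1
        then show ?thesis by (intro CollectI exI[of _ 0]) auto
      next
        case (2 i)
        then show ?thesis by (intro CollectI exI[of _ "Suc i"]) auto
      qed
    qed
  qed
  then show ?case using 1 by simp
qed auto

lemma cycle_edges_nth:
  assumes "xs \<noteq> []"
  shows "cycle_edges xs = (\<lambda>i. {xs ! i, xs ! (Suc i mod length xs)}) ` {..<length xs}"
proof -
  let ?j = "length xs" and ?e = "\<lambda>i. {xs ! i, xs ! (Suc i mod length xs)}"
  have "0 < ?j" using assms by simp
  then have "{..<?j} = insert (?j - 1) {i. Suc i < ?j}" by auto
  then have "?e ` {..<?j} = insert (?e (?j - 1)) (?e ` {i. Suc i < ?j})" by simp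
  moreover have "?e (?j - 1) = {hd xs, last xs}"
    using assms by (auto simp: hd_conv_nth last_conv_nth)
  moreover have "?e ` {i. Suc i < ?j} = path_edges xs"
    unfolding path_edges_nth by (auto simp: image_def)
  ultimately show ?thesis unfolding cycle_edges_def by simp
qed

text \<open>Two different indices with the same edge would each be the cyclic successor of the
  other, which is impossible with three or more vertices.\<close>

lemma cycle_edge_inj:
  assumes "distinct xs" "3 \<le> length xs"
  shows "inj_on (\<lambda>i. {xs ! i, xs ! (Suc i mod length xs)}) {..<length xs}"
proof (rule inj_onI)
  fix i k assume ik: "i \<in> {..<length xs}" "k \<in> {..<length xs}"
    and eq: "{xs ! i, xs ! (Suc i mod length xs)} = {xs ! k, xs ! (Suc k mod length xs)}"
  have m: "Suc i mod length xs < length xs" "Suc k mod length xs < length xs"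
    using assms by (auto intro!: mod_less_divisor)
  show "i = k"
  proof (rule ccontr)
    assume "i \<noteq> k"
    then have "i = Suc k mod length xs" "Suc i mod length xs = k"
      using eq ik m assms(1) by (auto simp: doubleton_eq_iff nth_eq_iff_index_eq)
    then show False using ik assms(2)
      by (auto simp: mod_Suc split: if_splits)
  qed
qed

lemma card_cycle_edges:
  assumes "distinct xs" "3 \<le> length xs"
  shows "card (cycle_edges xs) = length xs"
proof -
  have "xs \<noteq> []" using assms(2) by auto
  then show ?thesis using cycle_edges_nth[of xs] card_image[OF cycle_edge_inj[OF assms]] by simp
qed

text \<open>If no step entered \<open>S\<close>, walking round from \<open>b\<close> would never
  meet \<open>a\<close>; but \<open>a + (j - b)\<close> steps lead there.\<close>

lemma cyclic_exit:
  fixes j :: nat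
  assumes "a < j" "a \<in> S" "b < j" "b \<notin> S"
  shows "\<exists>i<j. i \<notin> S \<and> Suc i mod j \<in> S"
proof (rule ccontr)
  assume "\<not> ?thesis"
  then have step: "Suc i mod j \<notin> S" if "i < j" "i \<notin> S" for i using that by blast
  have "(b + t) mod j \<notin> S" for t
  proof (induction t)
    case 0
    then show ?case using assms by simp
  next
    case (Suc t)
    have "Suc ((b + t) mod j) mod j \<notin> S" by (rule step[OF _ Suc]) (use assms in simp)
    then show ?case by (simp add: mod_Suc_eq)
  qed
  from this[of "a + (j - b)"] show False using assms by (simp add: algebra_simps)
qed

text \<open>Let \<open>U\<close> be the set of vertices of \<open>ys\<close> that are not in
  \<open>xs\<close>. If it is empty, the two different sets of \<open>j\<close> edges live on
  \<open>j\<close> vertices, and their union has more than \<open>j\<close> edges. Otherwise one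
  edge of \<open>ys\<close> starts at each vertex of \<open>U\<close>, and one more enters
  \<open>U\<close> from outside, since the cycles share a vertex; none of these edges belongs to
  \<open>xs\<close>.\<close>

lemma two_cycles_excess:
  assumes xs: "distinct xs" "length xs = j" and ys: "distinct ys" "length ys = j" and j: "3 \<le> j"
    and common: "set xs \<inter> set ys \<noteq> {}" and ne: "cycle_edges xs \<noteq> cycle_edges ys"
  shows "card (set xs \<union> set ys) + 1 \<le> card (cycle_edges xs \<union> cycle_edges ys)"
proof -
  have nonempty: "xs \<noteq> []" "ys \<noteq> []" using xs ys j by auto
  have card: "card (cycle_edges xs) = j" "card (cycle_edges ys) = j" "card (set xs) = j"
    using card_cycle_edges xs ys j by (auto simp: distinct_card)
  define U where "U = set ys - set xs"
  have cU: "card (set xs \<union> set ys) = j + card U"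
    using card_Un_disjoint[of "set xs" U] card(3) by (simp add: U_def)
  show ?thesis
  proof (cases "U = {}")
    case True
    have "\<not> cycle_edges ys \<subseteq> cycle_edges xs"
      using card_subset_eq[of "cycle_edges xs" "cycle_edges ys"] card ne by auto
    then have "cycle_edges xs \<subset> cycle_edges xs \<union> cycle_edges ys" by auto
    then have "card (cycle_edges xs) < card (cycle_edges xs \<union> cycle_edges ys)"
      by (intro psubset_card_mono) auto
    then show ?thesis using cU True card by simp
  next
    case False
    let ?e = "\<lambda>i. {ys ! i, ys ! (Suc i mod length ys)}"
    define S where "S = {i. i < j \<and> ys ! i \<in> U}"
    define T where "T = {i. i < j \<and> (ys ! i \<in> U \<or> ys ! (Suc i mod j) \<in> U)}"
    have "(!) ys ` S = U"
    proof
      show "U \<subseteq> (!) ys ` S"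
      proof
        fix y assume y: "y \<in> U"
        then obtain i where "i < j" "y = ys ! i" by (auto simp: U_def in_set_conv_nth ys(2))
        then show "y \<in> (!) ys ` S" using y by (auto simp: S_def)
      qed
    qed (auto simp: S_def)
    moreover have "inj_on ((!) ys) S"
      unfolding S_def by (rule inj_on_nth[OF ys(1)]) (auto simp: ys(2))
    ultimately have "card S = card U" by (metis card_image)
    moreover have "card S < card T"
    proof (rule psubset_card_mono)
      obtain a where a: "a < j" "ys ! a \<in> U"
      proof -
        obtain y where "y \<in> U" "y \<in> set ys" using False by (auto simp: U_def)
        then show ?thesis using that by (auto simp: in_set_conv_nth ys(2))
      qed
      obtain b where b: "b < j" "ys ! b \<notin> U"
      proof -
        obtain y where "y \<notin> U" "y \<in> set ys" using common by (auto simp: U_def)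
        then show ?thesis using that by (auto simp: in_set_conv_nth ys(2))
      qed
      obtain i where "i < j" "i \<notin> S" "Suc i mod j \<in> S"
        using cyclic_exit[of a j S b] a b by (auto simp: S_def)
      then have "i \<in> T" "i \<notin> S" by (auto simp: S_def T_def)
      then show "S \<subset> T" by (auto simp: S_def T_def)
    qed (simp add: T_def)
    moreover have "card (?e ` T) = card T"
      by (rule card_image, rule inj_on_subset[OF cycle_edge_inj]) (use ys j in \<open>auto simp: T_def\<close>)
    moreover have "?e ` T \<inter> cycle_edges xs = {}"
      using cycle_edges_subset[OF nonempty(1)] by (auto simp: T_def U_def ys(2))
    then have "card (cycle_edges xs \<union> ?e ` T) = j + card (?e ` T)"
      by (subst card_Un_disjoint) (auto simp: card T_def)
    moreover have "cycle_edges xs \<union> ?e ` T \<subseteq> cycle_edges xs \<union> cycle_edges ys"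
      unfolding cycle_edges_nth[OF nonempty(2)] by (auto simp: T_def ys(2))
    then have "card (cycle_edges xs \<union> ?e ` T) \<le> card (cycle_edges xs \<union> cycle_edges ys)"
      by (intro card_mono) auto
    ultimately show ?thesis using cU by linarith
  qed
qed

text \<open>A cycle is determined by its edge set and its first two vertices, since every later vertex
  is the neighbour that is not the predecessor.\<close>

lemma card_same_cycle:
  assumes xs: "distinct xs" "length xs = j" and j: "3 \<le> j"
  shows "finite {ys. distinct ys \<and> length ys = j \<and> cycle_edges ys = cycle_edges xs}"
    "card {ys. distinct ys \<and> length ys = j \<and> cycle_edges ys = cycle_edges xs} \<le> 2 * j"
proof -
  define Y where "Y = {ys. distinct ys \<and> length ys = j \<and> cycle_edges ys = cycle_edges xs}"
  \<comment> \<open>The oriented edges of the cycle, of which there are at most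
    \<open>2 * j\<close>; the first two vertices of any \<open>ys\<close> in \<open>Y\<close> form
    one of them.\<close>
  define P where "P = {(x, y). {x, y} \<in> cycle_edges xs}"
  have sub0: "P \<subseteq> (\<Union>e\<in>cycle_edges xs. {(x, y). {x, y} = e})" by (auto simp: P_def)
  have two: "finite {(x, y). {x, y} = e} \<and> card {(x, y). {x, y} = e} \<le> 2" for e :: "nat set"
  proof (cases "\<exists>a b. e = {a, b}")
    case True
    then obtain a b where e: "e = {a, b}" by blast
    have sub: "{(x, y). {x, y} = e} \<subseteq> {(a, b), (b, a)}" unfolding e by (auto simp: doubleton_eq_iff)
    have "card {(a, b), (b, a)} \<le> 2" by (rule card_insert_le_m1) auto
    moreover have "card {(x, y). {x, y} = e} \<le> card {(a, b), (b, a)}"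
      by (rule card_mono[OF _ sub]) simp
    moreover have "finite {(x, y). {x, y} = e}" by (rule finite_subset[OF sub]) simp
    ultimately show ?thesis by linarith
  next
    case False
    then have "{(x, y). {x, y} = e} = {}" by auto
    then show ?thesis by simp
  qed
  have fin: "finite (\<Union>e\<in>cycle_edges xs. {(x, y). {x, y} = e})"
    by (rule finite_UN_I[OF finite_cycle_edges]) (use two in blast)
  have finP: "finite P" by (rule finite_subset[OF sub0 fin])
  have "card P \<le> card (\<Union>e\<in>cycle_edges xs. {(x, y). {x, y} = e})"
    by (rule card_mono[OF fin sub0])
  also have "\<dots> \<le> (\<Sum>e\<in>cycle_edges xs. card {(x, y). {x, y} = e})"
    by (rule card_UN_le) simp
  also have "\<dots> \<le> (\<Sum>e\<in>cycle_edges xs. 2)" by (intro sum_mono) (use two in blast)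
  also have "\<dots> = 2 * j" using card_cycle_edges[of xs] xs j by simp
  finally have P: "card P \<le> 2 * j" .
  have "(\<lambda>ys. (ys ! 0, ys ! 1)) ` Y \<subseteq> P"
  proof safe
    fix ys assume "ys \<in> Y"
    then have ys: "length ys = j" "cycle_edges ys = cycle_edges xs" by (auto simp: Y_def)
    have "{ys ! 0, ys ! (Suc 0 mod length ys)} \<in> cycle_edges ys"
      by (subst cycle_edges_nth) (use ys j in auto)
    then show "(ys ! 0, ys ! 1) \<in> P" using ys j by (simp add: P_def)
  qed
  moreover have "inj_on (\<lambda>ys. (ys ! 0, ys ! 1)) Y"
  proof (rule inj_onI)
    fix ys zs assume "ys \<in> Y" "zs \<in> Y" and "(ys ! 0, ys ! 1) = (zs ! 0, zs ! 1)"
    then have ys: "distinct ys" "length ys = j" and zs: "distinct zs" "length zs = j"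
      and E: "cycle_edges ys = cycle_edges zs" and 01: "ys ! 0 = zs ! 0" "ys ! 1 = zs ! 1"
      by (auto simp: Y_def)
    have ne: "ys \<noteq> []" "zs \<noteq> []" using ys zs j by auto
    have "ys ! i = zs ! i \<and> ys ! Suc i = zs ! Suc i" if "Suc i < j" for i
      using that
    proof (induction i)
      case 0
      then show ?case using 01 by simp
    next
      case (Suc i)
      then have IH: "ys ! i = zs ! i" "ys ! Suc i = zs ! Suc i" by auto
      have "{zs ! Suc i, zs ! (Suc (Suc i) mod length zs)} \<in> cycle_edges zs"
        unfolding cycle_edges_nth[OF ne(2)] by (rule imageI) (use Suc.prems zs in simp)
      then have "{ys ! Suc i, zs ! Suc (Suc i)} \<in> cycle_edges ys"
        using IH E Suc.prems zs by simp
      then obtain k where k: "k < j" "{ys ! Suc i, zs ! Suc (Suc i)} = {ys ! k, ys ! (Suc k mod j)}"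
        unfolding cycle_edges_nth[OF ne(1)] using ys by auto
      have kj: "Suc k mod j < j" using j by simp
      from k(2) consider "ys ! Suc i = ys ! k" "zs ! Suc (Suc i) = ys ! (Suc k mod j)"
        | "ys ! Suc i = ys ! (Suc k mod j)" "zs ! Suc (Suc i) = ys ! k"
        by (auto simp: doubleton_eq_iff)
      then show ?case
      proof cases
        case 1
        then have "k = Suc i" using k ys Suc.prems by (simp add: nth_eq_iff_index_eq)
        then show ?thesis using 1 IH Suc.prems by simp
      next
        \<comment> \<open>Here the edge would lead back to the predecessor, against the distinctness
          of \<open>zs\<close>.\<close>
        case 2
        then have "Suc k mod j = Suc i" using kj ys Suc.prems by (simp add: nth_eq_iff_index_eq)
        then have "k = i" using k Suc.prems by (auto simp: mod_Suc split: if_splits)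
        then have "zs ! Suc (Suc i) = zs ! i" using 2 IH by simp
        then show ?thesis using zs Suc.prems by (simp add: nth_eq_iff_index_eq)
      qed
    qed
    then have "ys ! i = zs ! i" if "i < j" for i
      using that j 01 by (cases i) auto
    then show "ys = zs" using ys zs by (intro nth_equalityI) auto
  qed
  ultimately have "finite Y" "card Y \<le> card P" using finP inj_on_finite card_inj_on_le by blast+
  then show "finite {ys. distinct ys \<and> length ys = j \<and> cycle_edges ys = cycle_edges xs}"
    "card {ys. distinct ys \<and> length ys = j \<and> cycle_edges ys = cycle_edges xs} \<le> 2 * j"
    using P unfolding Y_def by simp_all
qed

text \<open>
  In a sum over tuples, a factor \<open>1 / n\<close> per visited vertex cancels the choices of the vertices.  So
  configurations whose edges outnumber their vertices have total weight \<open>O(1 / n)\<close>.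
\<close>

lemma sum_inverse_card_tuples:
  assumes "0 < n" "finite S"
  shows "(\<Sum>xs\<in>tuples n j. 1 / real n ^ card (S \<union> set xs)) \<le> real (card S + j) ^ j / real n ^ card S"
  using assms(2)
proof (induction j arbitrary: S)
  case 0
  then show ?case by simp
next
  case (Suc j)
  let ?c = "card S" and ?n = "real n"
  have "(\<Sum>xs\<in>tuples n (Suc j). 1 / ?n ^ card (S \<union> set xs))
      = (\<Sum>x<n. \<Sum>xs\<in>tuples n j. 1 / ?n ^ card (insert x S \<union> set xs))"
    by (simp add: sum_tuples_Suc)
  also have "\<dots> \<le> (\<Sum>x<n. real (card (insert x S) + j) ^ j / ?n ^ card (insert x S))"
    by (intro sum_mono Suc.IH) (use Suc.prems in simp)
  also have "\<dots> \<le> (\<Sum>x<n. real (?c + Suc j) ^ j / ?n ^ card (insert x S))"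
    using Suc.prems
    by (intro sum_mono divide_right_mono power_mono) (auto simp: card_insert_if)
  also have "\<dots> = real (?c + Suc j) ^ j * (\<Sum>x<n. 1 / ?n ^ card (insert x S))"
    by (simp add: sum_distrib_left)
  also have "(\<Sum>x<n. 1 / ?n ^ card (insert x S)) \<le> real (?c + 1) / ?n ^ ?c"
  proof -
    \<comment> \<open>A vertex already in \<open>S\<close> brings no factor, but there are at most
      \<open>card S\<close> of these; a new one brings \<open>1 / n\<close> for at most
      \<open>n\<close> choices.\<close>
    have "(\<Sum>x<n. 1 / ?n ^ card (insert x S)) \<le> (\<Sum>x<n. of_bool (x \<in> S) / ?n ^ ?c + 1 / ?n ^ Suc ?c)"
      using Suc.prems assms(1) by (intro sum_mono) (auto simp: card_insert_if insert_absorb)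
    also have "\<dots> = (\<Sum>x<n. of_bool (x \<in> S)) / ?n ^ ?c + 1 / ?n ^ ?c"
      using assms(1) by (simp add: sum.distrib sum_divide_distrib del: sum_of_bool_eq)
    also have "(\<Sum>x<n. of_bool (x \<in> S)) = real (card ({..<n} \<inter> S))"
      by simp
    also have "\<dots> \<le> real ?c" using Suc.prems by (intro of_nat_mono card_mono) auto
    finally show ?thesis using assms(1) by (simp add: add_divide_distrib divide_right_mono)
  qed
  also have "real (?c + Suc j) ^ j * (real (?c + 1) / ?n ^ ?c) \<le>
      real (?c + Suc j) ^ j * (real (?c + Suc j) / ?n ^ ?c)"
    by (intro mult_left_mono divide_right_mono) auto
  finally show ?case by (simp add: mult_left_mono algebra_simps)
qed

section \<open>Expectations over finitely supported distributions\<close>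

abbreviation expect :: "'a pmf \<Rightarrow> ('a \<Rightarrow> real) \<Rightarrow> real" where
  "expect p f \<equiv> measure_pmf.expectation p f"

abbreviation prob :: "'a pmf \<Rightarrow> 'a set \<Rightarrow> real" where
  "prob p A \<equiv> measure_pmf.prob p A"

lemma expectation_bind_finite:
  fixes h :: "'b \<Rightarrow> real"
  assumes "finite (set_pmf p)" "\<And>x. x \<in> set_pmf p \<Longrightarrow> finite (set_pmf (f x))"
  shows "expect (bind_pmf p f) h =
    expect p (\<lambda>x. expect (f x) h)"
  by (subst pmf_expectation_bind[OF assms order_refl])
    (simp_all add: integral_measure_pmf[OF assms(1)])

lemma prob_eq_expectation:
  "prob p A = expect p (\<lambda>x. indicator A x)"
  by simp

section \<open>Edge probabilities\<close>

text \<open>Equality of communities is tested on the image of the edge, so that no order of the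
  endpoints has to be chosen.\<close>

definition edge_prob :: "nat \<Rightarrow> real \<Rightarrow> real \<Rightarrow> (nat \<Rightarrow> nat) \<Rightarrow> nat set \<Rightarrow> real" where
  "edge_prob n a b \<sigma> e = (if card (\<sigma> ` e) = 1 then a else b) / real n"

lemma set_pmf_of_set_lessThan [simp]: "0 < k \<Longrightarrow> set_pmf (pmf_of_set {..<k}) = {..<k :: nat}"
  by (rule set_pmf_of_set) auto

lemma finite_set_communities: "0 < k \<Longrightarrow> finite (set_pmf (communities n k))"
  unfolding communities_def
  by (subst set_Pi_pmf) (auto intro!: finite_PiE_dflt)

lemma finite_set_SBM: "0 < k \<Longrightarrow> finite (set_pmf (SBM n k a b))"
proof -
  have "finite {(u, v). u < v \<and> v < (n::nat)}"
    by (rule finite_subset[of _ "{..<n} \<times> {..<n}"]) auto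
  then have "finite (set_pmf (Pi_pmf {(u, v). u < v \<and> v < n} False p))" for p :: "nat \<times> nat \<Rightarrow> bool pmf"
    by (subst set_Pi_pmf) (auto intro!: finite_PiE_dflt)
  then show "0 < k \<Longrightarrow> finite (set_pmf (SBM n k a b))"
    unfolding SBM_def by (simp add: finite_set_communities)
qed

lemma simple_graph_SBM: "(\<sigma>, G) \<in> set_pmf (SBM n k a b) \<Longrightarrow> simple_graph n G"
  by (auto simp: SBM_def simple_graph_def)

text \<open>Given the communities, the coins are independent. The bounds \<open>a, b \<le> n\<close>
  keep the parameters of \<open>bernoulli_pmf\<close> in the unit interval, where nothing is
  truncated.\<close>

lemma prob_edges:
  assumes k: "0 < k" and ab: "0 \<le> a" "0 \<le> b" "a \<le> real n" "b \<le> real n"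
    and F: "simple_graph n F"
  shows "prob (SBM n k a b) {\<omega>. F \<subseteq> snd \<omega>} =
    expect (communities n k) (\<lambda>\<sigma>. \<Prod>e\<in>F. edge_prob n a b \<sigma> e)"
proof -
  define A where "A = {(u, v). u < v \<and> v < n}"
  define PF where "PF = {(u, v) \<in> A. {u, v} \<in> F}"
  have finA: "finite A"
    unfolding A_def by (rule finite_subset[of _ "{..<n} \<times> {..<n}"]) auto
  define c where "c \<sigma> = Pi_pmf A False (\<lambda>(u, v). bernoulli_pmf ((if \<sigma> u = \<sigma> v then a else b) / real n))"
    for \<sigma> :: "nat \<Rightarrow> nat"
  have S: "SBM n k a b = bind_pmf (communities n k) (\<lambda>\<sigma>.
       map_pmf (\<lambda>coin. (\<sigma>, {{u, v} | u v. u < v \<and> v < n \<and> coin (u, v)})) (c \<sigma>))"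
    unfolding SBM_def c_def A_def ..
  have fin_c: "finite (set_pmf (c \<sigma>))" for \<sigma>
    unfolding c_def by (subst set_Pi_pmf[OF finA]) (auto intro!: finite_PiE_dflt finA)
  have bij: "bij_betw (\<lambda>(u, v). {u, v}) PF F"
    unfolding bij_betw_def
  proof
    show "inj_on (\<lambda>(u, v). {u, v}) PF"
      by (auto simp: inj_on_def PF_def A_def doubleton_eq_iff)
    show "(\<lambda>(u, v). {u, v}) ` PF = F"
    proof
      show "F \<subseteq> (\<lambda>(u, v). {u, v}) ` PF"
      proof
        fix e assume e: "e \<in> F"
        then obtain u v where uv: "e = {u, v}" "u \<noteq> v" "u < n" "v < n"
          using F by (auto simp: simple_graph_def card_2_iff)
        show "e \<in> (\<lambda>(u, v). {u, v}) ` PF"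
        proof (cases "u < v")
          case True
          then show ?thesis using uv e by (intro image_eqI[of _ _ "(u, v)"]) (auto simp: PF_def A_def)
        next
          case False
          then show ?thesis using uv e
            by (intro image_eqI[of _ _ "(v, u)"]) (auto simp: PF_def A_def insert_commute)
        qed
      qed
    qed (auto simp: PF_def)
  qed
  have prob_c: "prob (c \<sigma>) {coin. F \<subseteq> {{u, v} | u v. u < v \<and> v < n \<and> coin (u, v)}}
      = (\<Prod>e\<in>F. edge_prob n a b \<sigma> e)" for \<sigma>
  proof -
    have "{coin. F \<subseteq> {{u, v} | u v. u < v \<and> v < n \<and> coin (u, v)}} = {coin. \<forall>p\<in>PF. coin p}"
    proof (intro Collect_cong iffI ballI subsetI)
      fix coin p assume "F \<subseteq> {{u, v} | u v. u < v \<and> v < n \<and> coin (u, v)}" "p \<in> PF"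
      then obtain u v u' v' where "p = (u, v)" "u < v" "{u, v} = {u', v'}" "u' < v'" "coin (u', v')"
        by (auto simp: PF_def A_def)
      then show "coin p" by (auto simp: doubleton_eq_iff)
    next
      fix coin e assume c: "\<forall>p\<in>PF. coin p" and "e \<in> F"
      then obtain p where "p \<in> PF" "e = (\<lambda>(u, v). {u, v}) p"
        using bij unfolding bij_betw_def by auto
      then show "e \<in> {{u, v} | u v. u < v \<and> v < n \<and> coin (u, v)}"
        using c by (auto simp: PF_def A_def)
    qed
    \<comment> \<open>As a product event: the coins outside \<open>PF\<close> are unrestricted and
      contribute the factor 1.\<close>
    also have "{coin. \<forall>p\<in>PF. coin p} = Pi A (\<lambda>p. if p \<in> PF then {True} else UNIV)"
      by (auto simp: PF_def Pi_def)
    also have "prob (c \<sigma>) \<dots> = (\<Prod>p\<in>A. prob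
        (case p of (u, v) \<Rightarrow> bernoulli_pmf ((if \<sigma> u = \<sigma> v then a else b) / real n))
        (if p \<in> PF then {True} else UNIV))"
      unfolding c_def by (rule measure_Pi_pmf_Pi[OF finA])
    also have "\<dots> = (\<Prod>p\<in>PF. edge_prob n a b \<sigma> (case p of (u, v) \<Rightarrow> {u, v}))"
    proof (rule prod.mono_neutral_cong_right[OF finA])
      show "PF \<subseteq> A" by (auto simp: PF_def)
      fix p assume p: "p \<in> PF"
      then obtain u v where uv: "p = (u, v)" "u < v" "v < n" by (auto simp: PF_def A_def)
      have "card (\<sigma> ` {u, v}) = 1 \<longleftrightarrow> \<sigma> u = \<sigma> v" by (auto simp: card_insert_if)
      then show "prob (case p of (u, v) \<Rightarrow> bernoulli_pmf ((if \<sigma> u = \<sigma> v then a else b) / real n))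
        (if p \<in> PF then {True} else UNIV) = edge_prob n a b \<sigma> (case p of (u, v) \<Rightarrow> {u, v})"
        using p uv ab by (auto simp: measure_pmf_single edge_prob_def)
    qed auto
    also have "\<dots> = (\<Prod>e\<in>F. edge_prob n a b \<sigma> e)"
      using prod.reindex_bij_betw[OF bij, of "edge_prob n a b \<sigma>"] by simp
    finally show ?thesis .
  qed
  have "prob (SBM n k a b) {\<omega>. F \<subseteq> snd \<omega>} =
    expect (SBM n k a b) (\<lambda>\<omega>. indicator {\<omega>. F \<subseteq> snd \<omega>} \<omega>)" by simp
  also have "\<dots> = expect (communities n k) (\<lambda>\<sigma>. expect
      (map_pmf (\<lambda>coin. (\<sigma>, {{u, v} | u v. u < v \<and> v < n \<and> coin (u, v)})) (c \<sigma>))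
      (\<lambda>\<omega>. indicator {\<omega>. F \<subseteq> snd \<omega>} \<omega>))"
    unfolding S
    by (rule expectation_bind_finite[OF finite_set_communities[OF k]]) (simp add: fin_c)
  also have "\<dots> = expect (communities n k) (\<lambda>\<sigma>. \<Prod>e\<in>F. edge_prob n a b \<sigma> e)"
  proof (rule arg_cong[where f = "expect (communities n k)"], rule ext)
    fix \<sigma>
    have "expect (map_pmf (\<lambda>coin. (\<sigma>, {{u, v} | u v. u < v \<and> v < n \<and> coin (u, v)})) (c \<sigma>))
        (\<lambda>\<omega>. indicator {\<omega>. F \<subseteq> snd \<omega>} \<omega> :: real) =
      prob (map_pmf (\<lambda>coin. (\<sigma>, {{u, v} | u v. u < v \<and> v < n \<and> coin (u, v)})) (c \<sigma>)) {\<omega>. F \<subseteq> snd \<omega>}"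
      by (rule prob_eq_expectation[symmetric])
    also have "\<dots> = prob (c \<sigma>) {coin. F \<subseteq> {{u, v} | u v. u < v \<and> v < n \<and> coin (u, v)}}"
      by (simp add: vimage_def)
    finally show "expect (map_pmf (\<lambda>coin. (\<sigma>, {{u, v} | u v. u < v \<and> v < n \<and> coin (u, v)})) (c \<sigma>))
        (\<lambda>\<omega>. indicator {\<omega>. F \<subseteq> snd \<omega>} \<omega>) = (\<Prod>e\<in>F. edge_prob n a b \<sigma> e)"
      using prob_c by simp
  qed
  finally show ?thesis .
qed

lemma prob_edges_le:
  assumes k: "0 < k" and ab: "0 \<le> a" "0 \<le> b" "a \<le> real n" "b \<le> real n" "a \<le> C" "b \<le> C"
    and F: "simple_graph n F"
  shows "prob (SBM n k a b) {\<omega>. F \<subseteq> snd \<omega>} \<le> (C / real n) ^ card F"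
proof -
  have "expect (communities n k) (\<lambda>\<sigma>. \<Prod>e\<in>F. edge_prob n a b \<sigma> e)
      \<le> expect (communities n k) (\<lambda>\<sigma>. (C / real n) ^ card F)"
  proof (rule integral_mono)
    fix \<sigma>
    have "(\<Prod>e\<in>F. edge_prob n a b \<sigma> e) \<le> (\<Prod>e\<in>F. C / real n)"
      by (rule prod_mono) (use ab in \<open>auto simp: edge_prob_def divide_right_mono\<close>)
    then show "(\<Prod>e\<in>F. edge_prob n a b \<sigma> e) \<le> (C / real n) ^ card F" by simp
  qed (auto intro!: integrable_measure_pmf_finite finite_set_communities k)
  then show ?thesis using prob_edges[OF k ab(1-4) F] by simp
qed

section \<open>Communities along a tuple of vertices\<close>

text \<open>Coordinates at distinct places are independent. Passing from the random function to the
  list of its values makes recursion along a walk possible.\<close>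

lemma map_Pi_pmf_replicate:
  assumes "finite A" "distinct xs" "set xs \<subseteq> A"
  shows "map_pmf (\<lambda>\<sigma>. map \<sigma> xs) (Pi_pmf A d (\<lambda>_. p)) = replicate_pmf (length xs) p"
  using assms
proof (induction xs arbitrary: A)
  case Nil
  then show ?case by (simp add: map_pmf_const)
next
  case (Cons x xs)
  have "Pi_pmf A d (\<lambda>_. p) = Pi_pmf (insert x (A - {x})) d (\<lambda>_. p)"
    using Cons.prems by (simp add: insert_absorb)
  also have "\<dots> = do {y \<leftarrow> p; f \<leftarrow> Pi_pmf (A - {x}) d (\<lambda>_. p); return_pmf (f(x := y))}"
    using Cons.prems by (intro Pi_pmf_insert') auto
  finally have "map_pmf (\<lambda>\<sigma>. map \<sigma> (x # xs)) (Pi_pmf A d (\<lambda>_. p)) =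
      do {y \<leftarrow> p; f \<leftarrow> Pi_pmf (A - {x}) d (\<lambda>_. p); return_pmf (map (f(x := y)) (x # xs))}"
    by (simp add: map_bind_pmf)
  also have "\<dots> = do {y \<leftarrow> p; f \<leftarrow> Pi_pmf (A - {x}) d (\<lambda>_. p); return_pmf (y # map f xs)}"
    using Cons.prems by (simp add: map_fun_upd)
  also have "\<dots> = do {y \<leftarrow> p; l \<leftarrow> map_pmf (\<lambda>\<sigma>. map \<sigma> xs) (Pi_pmf (A - {x}) d (\<lambda>_. p)); return_pmf (y # l)}"
    by (simp add: bind_map_pmf)
  also have "\<dots> = replicate_pmf (length (x # xs)) p"
    using Cons by (subst Cons.IH) auto
  finally show ?case .
qed

abbreviation colours :: "nat \<Rightarrow> nat \<Rightarrow> nat list pmf" where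
  "colours m k \<equiv> replicate_pmf m (pmf_of_set {..<k})"

lemma finite_set_colours: "0 < k \<Longrightarrow> finite (set_pmf (colours m k))"
  by (induction m) auto

lemma expectation_communities:
  fixes h :: "nat list \<Rightarrow> real"
  assumes "distinct xs" "set xs \<subseteq> {..<n}"
  shows "expect (communities n k) (\<lambda>\<sigma>. h (map \<sigma> xs)) =
    expect (colours (length xs) k) h"
  unfolding communities_def
  using map_Pi_pmf_replicate[OF _ assms, of 0 "pmf_of_set {..<k}", symmetric] by simp

lemma expectation_colours_Suc:
  fixes h :: "nat list \<Rightarrow> real"
  assumes "0 < k"
  shows "expect (colours (Suc m) k) h =
    (\<Sum>x<k. expect (colours m k) (\<lambda>l. h (x # l))) / real k"
proof -
  have ne: "{..<k} \<noteq> {}" using assms by auto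
  have "expect (colours (Suc m) k) h = expect (pmf_of_set {..<k})
      (\<lambda>x. expect (map_pmf ((#) x) (colours m k)) h)"
    unfolding replicate_pmf.simps map_pmf_def[symmetric]
    by (rule expectation_bind_finite) (use ne assms in \<open>auto simp: finite_set_colours\<close>)
  then show ?thesis using ne by (simp add: integral_pmf_of_set)
qed

lemma expectation_colours_append:
  fixes f g :: "nat list \<Rightarrow> real"
  assumes "0 < k"
  shows "expect (colours (i + j) k) (\<lambda>l. f (take i l) * g (drop i l)) =
    expect (colours i k) f * expect (colours j k) g"
proof (induction i arbitrary: f)
  case 0
  then show ?case by simp
next
  case (Suc i)
  have "expect (colours (Suc i + j) k) (\<lambda>l. f (take (Suc i) l) * g (drop (Suc i) l)) =
     (\<Sum>x<k. expect (colours (i + j) k) (\<lambda>l. f (x # take i l) * g (drop i l))) / real k"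
    using expectation_colours_Suc[OF assms, of "i + j"] by simp
  also have "\<dots> = (\<Sum>x<k. expect (colours i k) (\<lambda>l. f (x # l)) *
      expect (colours j k) g) / real k"
    using Suc.IH[of "\<lambda>l. f (x # l)" for x] by simp
  also have "\<dots> = expect (colours (Suc i) k) f * expect (colours j k) g"
    by (simp only: expectation_colours_Suc[OF assms] sum_distrib_right[symmetric]) simp
  finally show ?case .
qed

section \<open>The spectrum of the community matrix\<close>

definition affinity :: "real \<Rightarrow> real \<Rightarrow> nat \<Rightarrow> nat \<Rightarrow> real" where
  "affinity a b x y = (if x = y then a else b)"

fun path_weight :: "real \<Rightarrow> real \<Rightarrow> nat list \<Rightarrow> real" where
  "path_weight a b (x # y # zs) = affinity a b x y * path_weight a b (y # zs)"
| "path_weight a b _ = 1"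

definition cycle_weight :: "real \<Rightarrow> real \<Rightarrow> nat list \<Rightarrow> real" where
  "cycle_weight a b xs = path_weight a b xs * affinity a b (last xs) (hd xs)"

text \<open>The matrix \<open>affinity / k\<close> on the communities has this eigenvalue on
  constant vectors, and \<open>second_eigenvalue\<close>, with multiplicity \<open>k - 1\<close>, on
  the vectors of sum 0.\<close>

definition avg_degree :: "nat \<Rightarrow> real \<Rightarrow> real \<Rightarrow> real" where
  "avg_degree k a b = (a + (real k - 1) * b) / real k"

definition second_eigenvalue :: "nat \<Rightarrow> real \<Rightarrow> real \<Rightarrow> real" where
  "second_eigenvalue k a b = (a - b) / real k"

text \<open>The trace of the \<open>j\<close>-th power of \<open>affinity / k\<close>.\<close>

definition cycle_mean :: "nat \<Rightarrow> real \<Rightarrow> real \<Rightarrow> nat \<Rightarrow> real" where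
  "cycle_mean k a b j = avg_degree k a b ^ j + (real k - 1) * second_eigenvalue k a b ^ j"

lemma eigenvalue_identities:
  assumes "0 < k"
  shows "avg_degree k a b - second_eigenvalue k a b = b"
    "b + real k * second_eigenvalue k a b = a"
  using assms by (simp_all add: avg_degree_def second_eigenvalue_def field_simps)

lemma affinity_eq:
  assumes "0 < k"
  shows "affinity a b x y = b + real k * second_eigenvalue k a b * of_bool (x = y)"
  using eigenvalue_identities(2)[OF assms, where a = a and b = b] by (auto simp: affinity_def)

lemma sum_affinity:
  assumes "0 < k" "x < k"
  shows "(\<Sum>y<k. affinity a b x y * f y) = b * (\<Sum>y<k. f y) + real k * second_eigenvalue k a b * f x"
proof -
  let ?s = "second_eigenvalue k a b"
  have "(\<Sum>y<k. affinity a b x y * f y) = (\<Sum>y<k. b * f y + (if x = y then real k * ?s * f x else 0))"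
    by (intro sum.cong refl) (auto simp: affinity_eq[OF assms(1)] algebra_simps)
  then show ?thesis using assms(2) by (simp add: sum.distrib sum_distrib_left)
qed

text \<open>The right-hand side is \<open>k\<close> times the entry \<open>(x, z)\<close> of the
  power \<open>Suc m\<close> of \<open>affinity / k\<close>: averaging over the \<open>m\<close>
  intermediate communities supplies one factor \<open>1 / k\<close> fewer than there are
  steps.\<close>

lemma expectation_path_weight:
  assumes k: "0 < k" and "x < k" "z < k"
  shows "expect (colours m k)
      (\<lambda>l. path_weight a b (x # l) * affinity a b (last (x # l)) z) =
    avg_degree k a b ^ Suc m - second_eigenvalue k a b ^ Suc m +
    real k * second_eigenvalue k a b ^ Suc m * of_bool (x = z)"
  using assms(2)
proof (induction m arbitrary: x)
  case 0
  then show ?case using eigenvalue_identities[OF k, where a = a and b = b] by (auto simp: affinity_def)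
next
  case (Suc m)
  let ?d = "avg_degree k a b" and ?s = "second_eigenvalue k a b"
  define F where "F y = ?d ^ Suc m - ?s ^ Suc m + real k * ?s ^ Suc m * of_bool (y = z)" for y
  have "expect (colours (Suc m) k)
      (\<lambda>l. path_weight a b (x # l) * affinity a b (last (x # l)) z) =
    (\<Sum>y<k. affinity a b x y * expect (colours m k)
      (\<lambda>l. path_weight a b (y # l) * affinity a b (last (y # l)) z)) / real k"
  proof -
    have "last (x # y # l) = last (y # l)" for y :: nat and l by simp
    then show ?thesis
      by (simp add: expectation_colours_Suc[OF k] mult.assoc del: replicate_pmf.simps last.simps)
  qed
  also have "\<dots> = (\<Sum>y<k. affinity a b x y * F y) / real k"
    using Suc.IH by (intro arg_cong2[where f = "(/)"] sum.cong refl) (auto simp: F_def)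
  also have "\<dots> = (b * (\<Sum>y<k. F y)) / real k + ?s * F x"
    using k by (simp add: sum_affinity[OF k Suc.prems] add_divide_distrib)
  also have "(\<Sum>y<k. F y) = real k * ?d ^ Suc m"
  proof -
    have "(\<Sum>y<k. of_bool (y = z)) = (1::real)" using assms(3) by (simp add: Collect_conv_if)
    then have "(\<Sum>y<k. F y) = (\<Sum>y<k. ?d ^ Suc m - ?s ^ Suc m) + real k * ?s ^ Suc m * 1"
      unfolding F_def by (simp only: sum.distrib flip: sum_distrib_left)
    then show ?thesis by (simp add: algebra_simps)
  qed
  also have "b * (real k * ?d ^ Suc m) / real k = (?d - ?s) * ?d ^ Suc m"
    using k eigenvalue_identities(1)[OF k, where a = a and b = b] by simp
  finally show ?case by (simp add: F_def algebra_simps)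
qed

text \<open>Averaging over the starting community supplies the missing factor \<open>1 / k\<close>,
  and the diagonal entries add up to the trace.\<close>

lemma expectation_cycle_weight:
  assumes k: "0 < k" and j: "0 < j"
  shows "expect (colours j k) (cycle_weight a b) = cycle_mean k a b j"
proof -
  obtain m where m: "j = Suc m" using j by (cases j) auto
  have "expect (colours j k) (cycle_weight a b) =
    (\<Sum>x<k. expect (colours m k)
      (\<lambda>l. path_weight a b (x # l) * affinity a b (last (x # l)) x)) / real k"
    by (simp add: m expectation_colours_Suc[OF k] cycle_weight_def del: replicate_pmf.simps last.simps)
  also have "\<dots> = (\<Sum>x<k. cycle_mean k a b j) / real k"
    by (intro arg_cong2[where f = "(/)"] sum.cong refl)
      (simp add: expectation_path_weight[OF k] m cycle_mean_def algebra_simps del: last.simps)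
  finally show ?thesis using k by simp
qed


section \<open>Cycle and edge probabilities\<close>

lemma affinity_edge_prob: "edge_prob n a b \<sigma> {x, y} = affinity a b (\<sigma> x) (\<sigma> y) / real n"
  by (auto simp: edge_prob_def affinity_def card_insert_if)

text \<open>With distinct vertices no edge repeats, so a product over the set of edges can be taken
  along the list.\<close>

lemma prod_path_edges:
  assumes "distinct xs"
  shows "(\<Prod>e\<in>path_edges xs. edge_prob n a b \<sigma> e) =
    path_weight a b (map \<sigma> xs) / real n ^ (length xs - 1)"
  using assms
proof (induction xs rule: path_edges.induct)
  case (1 x y zs)
  have "{x, y} \<notin> path_edges (y # zs)"
    using path_edges_subset[of "{x, y}" "y # zs"] 1(2) by auto
  then show ?case using 1 by (simp add: affinity_edge_prob)
qed auto

lemma prod_cycle_edges: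
  assumes "distinct xs" "3 \<le> length xs"
  shows "(\<Prod>e\<in>cycle_edges xs. edge_prob n a b \<sigma> e) =
    cycle_weight a b (map \<sigma> xs) / real n ^ length xs"
proof -
  have ct: "closed_trail (\<noteq>) xs" using distinct_closed_trail[OF assms] .
  have tr: "trail (\<noteq>) (last xs) (last (butlast xs)) xs" using ct by (simp add: closed_trail_def)
  have new: "{hd xs, last xs} \<notin> path_edges xs"
    using path_edges_last[of "{hd xs, last xs}" xs] trail_excess[OF tr] ct
    by (auto simp: doubleton_eq_iff closed_trail_def)
  have ne: "xs \<noteq> []" using assms(2) by auto
  obtain m where m: "length xs = Suc m" using assms(2) by (cases "length xs") auto
  have "edge_prob n a b \<sigma> {hd xs, last xs} = affinity a b (last (map \<sigma> xs)) (hd (map \<sigma> xs)) / real n"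
    using ne by (simp add: affinity_edge_prob insert_commute[of "hd xs"] last_map hd_map)
  then show ?thesis
    using new by (simp add: cycle_edges_def prod_path_edges[OF assms(1)] cycle_weight_def m mult.commute)
qed

lemma cycle_edges_simple_graph:
  assumes "closed_trail (\<noteq>) xs" "xs \<in> tuples n j"
  shows "simple_graph n (cycle_edges xs)"
proof -
  have ne: "xs \<noteq> []" and h: "hd xs \<noteq> last xs" using assms by (auto simp: closed_trail_def)
  have "card e = 2" if "e \<in> path_edges xs" "trail (\<noteq>) u v xs" for e u v
    using that
  proof (induction xs rule: path_edges.induct)
    case (1 x y zs)
    then show ?case by (cases zs) (auto simp: card_2_iff)
  qed auto
  then have "card e = 2" if "e \<in> cycle_edges xs" for e
    using that h assms(1) by (auto simp: cycle_edges_def closed_trail_def)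
  moreover have "e \<subseteq> {..<n}" if "e \<in> cycle_edges xs" for e
    using cycle_edges_subset[OF ne that] assms(2) by (auto simp: tuples_def)
  ultimately show ?thesis by (simp add: simple_graph_def)
qed

text \<open>\<open>C / n\<close> bounds all edge probabilities; \<open>1 \<le> C\<close> makes the
  powers of \<open>C\<close> monotone in the exponent, and \<open>C \<le> n\<close> excludes
  truncated coins.\<close>

locale sbm =
  fixes n k :: nat and a b C :: real
  assumes k: "0 < k" and a: "0 \<le> a" "a \<le> C" and b: "0 \<le> b" "b \<le> C" and C: "1 \<le> C" "C \<le> real n"
begin

abbreviation M :: "((nat \<Rightarrow> nat) \<times> nat set set) pmf" where
  "M \<equiv> SBM n k a b"

abbreviation mean :: "(nat set set \<Rightarrow> real) \<Rightarrow> real" where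
  "mean f \<equiv> expect M (\<lambda>\<omega>. f (snd \<omega>))"

abbreviation present :: "nat set set \<Rightarrow> real" where
  "present F \<equiv> prob M {\<omega>. F \<subseteq> snd \<omega>}"

lemma bounds: "a \<le> real n" "b \<le> real n" "0 < real n" "0 < n"
  using a b C by auto

lemma integrable_SBM [simp]: "integrable (measure_pmf M) (f :: _ \<Rightarrow> real)"
  by (rule integrable_measure_pmf_finite[OF finite_set_SBM[OF k]])

lemma prob_tuple:
  assumes F: "simple_graph n F" and xs: "distinct xs" "set xs \<subseteq> {..<n}" "length xs = j"
    and w: "\<And>\<sigma>. (\<Prod>e\<in>F. edge_prob n a b \<sigma> e) = h (map \<sigma> xs) / Z"
  shows "present F = expect (colours j k) h / Z"
proof -
  have "present F = expect (communities n k) (\<lambda>\<sigma>. h (map \<sigma> xs) / Z)"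
    using prob_edges[OF k a(1) b(1) bounds(1,2) F] w by simp
  also have "\<dots> = expect (colours j k) (\<lambda>l. h l / Z)"
    using expectation_communities[OF xs(1,2), of k "\<lambda>l. h l / Z"] xs(3) by simp
  finally show ?thesis by simp
qed

text \<open>Disjoint vertex sets carry independent communities and share no coin, so such a pair
  contributes nothing to the variance.\<close>

lemma prob_disjoint_tuples:
  assumes F: "simple_graph n F" "\<Union>F \<subseteq> set xs" and G: "simple_graph n G" "\<Union>G \<subseteq> set ys"
    and xs: "distinct xs" "set xs \<subseteq> {..<n}" "length xs = j"
    and ys: "distinct ys" "set ys \<subseteq> {..<n}" "length ys = j"
    and disj: "set xs \<inter> set ys = {}"
    and w: "\<And>\<sigma>. (\<Prod>e\<in>F. edge_prob n a b \<sigma> e) = h (map \<sigma> xs) / Z"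
      "\<And>\<sigma>. (\<Prod>e\<in>G. edge_prob n a b \<sigma> e) = h (map \<sigma> ys) / Z"
  shows "present (F \<union> G) = (expect (colours j k) h / Z)\<^sup>2"
proof -
  have FG: "simple_graph n (F \<union> G)" using F G by (auto simp: simple_graph_def)
  have "F \<subseteq> Pow {..<n}" "G \<subseteq> Pow {..<n}" using F G by (auto simp: simple_graph_def)
  then have fin: "finite F" "finite G" by (auto intro: finite_subset)
  have "F \<inter> G = {}"
  proof (rule ccontr)
    assume "F \<inter> G \<noteq> {}"
    then obtain e where e: "e \<in> F" "e \<in> G" by blast
    then have "e \<subseteq> set xs \<inter> set ys" using F(2) G(2) by blast
    then have "e = {}" using disj by simp
    moreover have "card e = 2" using F(1) e by (auto simp: simple_graph_def)
    ultimately show False by simp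
  qed
  then have "(\<Prod>e\<in>F \<union> G. edge_prob n a b \<sigma> e) =
      h (take j (map \<sigma> (xs @ ys))) * h (drop j (map \<sigma> (xs @ ys))) / Z\<^sup>2" for \<sigma>
    using w xs(3) fin by (simp add: prod.union_disjoint power2_eq_square)
  then have "present (F \<union> G) = expect (colours (j + j) k) (\<lambda>l. h (take j l) * h (drop j l)) / Z\<^sup>2"
    by (intro prob_tuple[of _ "xs @ ys"]) (use FG xs ys disj in auto)
  then show ?thesis
    using expectation_colours_append[OF k, of j j h h] by (simp add: power2_eq_square)
qed

lemma prob_cycle:
  assumes "xs \<in> tuples n j" "distinct xs" "3 \<le> j"
  shows "present (cycle_edges xs) = cycle_mean k a b j / real n ^ j"
  using prob_tuple[of "cycle_edges xs" xs j "cycle_weight a b" "real n ^ j"]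
    cycle_edges_simple_graph[OF distinct_closed_trail, of xs n j] prod_cycle_edges[of xs n a b]
    expectation_cycle_weight[OF k, of j a b] assms
  by (auto simp: tuples_def)

lemma prob_disjoint_cycles:
  assumes xs: "xs \<in> tuples n j" "distinct xs" and ys: "ys \<in> tuples n j" "distinct ys"
    and j: "3 \<le> j" and disj: "set xs \<inter> set ys = {}"
  shows "present (cycle_edges xs \<union> cycle_edges ys) = (cycle_mean k a b j / real n ^ j)\<^sup>2"
proof -
  have len: "length xs = j" "set xs \<subseteq> {..<n}" "length ys = j" "set ys \<subseteq> {..<n}"
    using xs ys by (auto simp: tuples_def)
  have ne: "xs \<noteq> []" "ys \<noteq> []" using len j by auto
  have "present (cycle_edges xs \<union> cycle_edges ys) =
      (expect (colours j k) (cycle_weight a b) / real n ^ j)\<^sup>2"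
    by (rule prob_disjoint_tuples[where xs = xs and ys = ys])
      (use cycle_edges_simple_graph[OF distinct_closed_trail] prod_cycle_edges
        cycle_edges_subset ne xs ys len j disj in \<open>auto simp: Sup_le_iff\<close>)
  then show ?thesis using expectation_cycle_weight[OF k, of j a b] j by simp
qed

text \<open>The surplus edge yields the \<open>1 / n\<close> in front; \<open>1 / n ^ v\<close> is
  left to cancel the choice of \<open>v\<close> vertices.\<close>

lemma prob_excess_le:
  assumes F: "simple_graph n F" and v: "v + 1 \<le> card F" and e: "card F \<le> e"
  shows "present F \<le> C ^ e / real n * (1 / real n ^ v)"
proof -
  have "present F \<le> (C / real n) ^ card F"
    by (rule prob_edges_le[OF k a(1) b(1) bounds(1,2) a(2) b(2) F])
  also have "\<dots> = C ^ card F / real n ^ card F" by (simp add: power_divide)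
  also have "\<dots> \<le> C ^ e / real n ^ (v + 1)"
    using C v e bounds by (intro frac_le power_increasing) auto
  finally show ?thesis by (simp add: field_simps)
qed

section \<open>Moments of the cycle and tangle counts\<close>

definition cycles :: "nat \<Rightarrow> nat list set" where
  "cycles j = {xs \<in> tuples n j. distinct xs}"

definition tangles :: "nat \<Rightarrow> nat list set" where
  "tangles j = {xs \<in> tuples n j. closed_trail (\<noteq>) xs \<and> \<not> distinct xs}"

text \<open>Generic in the index set, so that one second-moment computation serves both cycles and
  edges.\<close>

definition count :: "('c \<Rightarrow> nat set set) \<Rightarrow> 'c set \<Rightarrow> nat set set \<Rightarrow> real" where
  "count F T G = real (card {x \<in> T. F x \<subseteq> G})"

lemma count_eq_sum: "finite T \<Longrightarrow> count F T G = (\<Sum>x\<in>T. indicator {G. F x \<subseteq> G} G)"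
  unfolding count_def indicator_def
  by (simp add: Int_def)

lemma expectation_count:
  assumes "finite T"
  shows "mean (count F T) =
    (\<Sum>x\<in>T. present (F x))"
proof -
  have "mean (count F T) =
      expect M (\<lambda>\<omega>. \<Sum>x\<in>T. indicator {\<omega>. F x \<subseteq> snd \<omega>} \<omega>)"
    by (simp add: count_eq_sum[OF assms] indicator_def)
  also have "\<dots> = (\<Sum>x\<in>T. expect M (\<lambda>\<omega>. indicator {\<omega>. F x \<subseteq> snd \<omega>} \<omega>))"
    by (rule Bochner_Integration.integral_sum) (rule integrable_SBM)
  finally show ?thesis by simp
qed

lemma expectation_count_square:
  assumes "finite T"
  shows "expect M (\<lambda>\<omega>. (count F T (snd \<omega>))\<^sup>2) =
    (\<Sum>x\<in>T. \<Sum>y\<in>T. present (F x \<union> F y))"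
proof -
  have "expect M (\<lambda>\<omega>. (count F T (snd \<omega>))\<^sup>2) =
      expect M (\<lambda>\<omega>. \<Sum>x\<in>T. \<Sum>y\<in>T. indicator {\<omega>. F x \<union> F y \<subseteq> snd \<omega>} \<omega>)"
  proof (rule arg_cong[where f = "expect M"], rule ext)
    fix \<omega> :: "(nat \<Rightarrow> nat) \<times> nat set set"
    show "(count F T (snd \<omega>))\<^sup>2 = (\<Sum>x\<in>T. \<Sum>y\<in>T. indicator {\<omega>. F x \<union> F y \<subseteq> snd \<omega>} \<omega>)"
      unfolding count_eq_sum[OF assms] power2_eq_square sum_product
      by (intro sum.cong refl) (auto simp: indicator_def)
  qed
  also have "\<dots> = (\<Sum>x\<in>T. expect M (\<lambda>\<omega>. \<Sum>y\<in>T. indicator {\<omega>. F x \<union> F y \<subseteq> snd \<omega>} \<omega>))"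
    by (rule Bochner_Integration.integral_sum) (rule integrable_SBM)
  also have "\<dots> = (\<Sum>x\<in>T. \<Sum>y\<in>T. expect M (\<lambda>\<omega>. indicator {\<omega>. F x \<union> F y \<subseteq> snd \<omega>} \<omega>))"
    by (intro sum.cong refl Bochner_Integration.integral_sum) (rule integrable_SBM)
  finally show ?thesis by simp
qed

text \<open>The second moment sums the probabilities of \<open>F x \<union> F y\<close> over all
  pairs. Subtracting the squared mean removes \<open>p\<^sup>2\<close> for each pair and leaves the
  covariances, which \<open>err\<close> bounds.\<close>

lemma variance_count_le:
  assumes T: "finite T" and p: "\<And>x. x \<in> T \<Longrightarrow> present (F x) = p"
    and pair: "\<And>x y. x \<in> T \<Longrightarrow> y \<in> T \<Longrightarrow> present (F x \<union> F y) \<le> p\<^sup>2 + err x y"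
  shows "expect M (\<lambda>\<omega>. (count F T (snd \<omega>) - mean (count F T))\<^sup>2) \<le> (\<Sum>x\<in>T. \<Sum>y\<in>T. err x y)"
proof -
  have m: "mean (count F T) = real (card T) * p" using T p by (simp add: expectation_count)
  have "expect M (\<lambda>\<omega>. (count F T (snd \<omega>))\<^sup>2) \<le> (\<Sum>x\<in>T. \<Sum>y\<in>T. p\<^sup>2 + err x y)"
    unfolding expectation_count_square[OF T] by (intro sum_mono pair)
  also have "\<dots> = (mean (count F T))\<^sup>2 + (\<Sum>x\<in>T. \<Sum>y\<in>T. err x y)"
    unfolding m by (simp add: sum.distrib power2_eq_square)
  finally show ?thesis
    using measure_pmf.variance_eq[of M "\<lambda>\<omega>. count F T (snd \<omega>)"] by simp
qed

lemma finite_cycles [simp]: "finite (cycles j)" "finite (tangles j)"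
  by (simp_all add: cycles_def tangles_def)

lemma cycles_graph: "xs \<in> cycles j \<Longrightarrow> 3 \<le> j \<Longrightarrow> simple_graph n (cycle_edges xs)"
  by (rule cycle_edges_simple_graph[OF distinct_closed_trail, where j = j]) (auto simp: cycles_def tuples_def)

lemma card_cycles_le: "card (cycles j) \<le> n ^ j"
  unfolding cycles_def card_tuples[symmetric] by (rule card_mono) auto

text \<open>A tuple with a repetition has fewer than \<open>j\<close> different entries, so its
  weight \<open>n ^ (j - 1) / n ^ card (set xs)\<close> is at least 1, and the weighted sum over all
  tuples bounds the number of these tuples.\<close>

lemma card_cycles_ge: "real n ^ j - real j ^ j * real n ^ j / real n \<le> real (card (cycles j))"
proof -
  let ?N = "tuples n j - cycles j"
  have "real (card ?N) = (\<Sum>xs\<in>?N. 1)" by simp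
  also have "\<dots> \<le> (\<Sum>xs\<in>?N. real n ^ j / real n * (1 / real n ^ card ({} \<union> set xs)))"
  proof (rule sum_mono)
    fix xs assume "xs \<in> ?N"
    then have "length xs = j" "\<not> distinct xs" by (auto simp: cycles_def tuples_def)
    then have "Suc (card (set xs)) \<le> j"
      by (metis Suc_leI card_distinct card_length le_neq_implies_less)
    then have "real n ^ Suc (card (set xs)) \<le> real n ^ j" using bounds by (intro power_increasing) auto
    then show "1 \<le> real n ^ j / real n * (1 / real n ^ card ({} \<union> set xs))"
      using bounds by (simp add: field_simps)
  qed
  also have "\<dots> \<le> (\<Sum>xs\<in>tuples n j. real n ^ j / real n * (1 / real n ^ card ({} \<union> set xs)))"
    by (rule sum_mono2) auto
  also have "\<dots> = real n ^ j / real n * (\<Sum>xs\<in>tuples n j. 1 / real n ^ card ({} \<union> set xs))"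
    by (rule sum_distrib_left[symmetric])
  also have "\<dots> \<le> real n ^ j / real n * (real (card ({}::nat set) + j) ^ j / real n ^ card ({}::nat set))"
    by (intro mult_left_mono sum_inverse_card_tuples) (use bounds in auto)
  finally have "real (card ?N) \<le> real j ^ j * real n ^ j / real n" by (simp add: mult.commute)
  moreover have "card ?N = n ^ j - card (cycles j)"
    by (subst card_Diff_subset) (auto simp: cycles_def card_tuples)
  ultimately show ?thesis using card_cycles_le[of j] by (simp add: of_nat_diff)
qed

text \<open>Two applications of \<open>sum_inverse_card_tuples\<close>, the inner one with the
  vertices of \<open>xs\<close> as those already visited.\<close>

lemma sum_pairs_le:
  "(\<Sum>xs\<in>tuples n j. \<Sum>ys\<in>tuples n j. 1 / real n ^ card (set xs \<union> set ys)) \<le> real (2 * j) ^ (2 * j)"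
proof -
  have "(\<Sum>xs\<in>tuples n j. \<Sum>ys\<in>tuples n j. 1 / real n ^ card (set xs \<union> set ys))
      \<le> (\<Sum>xs\<in>tuples n j. real (2 * j) ^ j * (1 / real n ^ card ({} \<union> set xs)))"
  proof (rule sum_mono)
    fix xs assume "xs \<in> tuples n j"
    then have "card (set xs) \<le> j" using card_length[of xs] by (simp add: tuples_def)
    have "(\<Sum>ys\<in>tuples n j. 1 / real n ^ card (set xs \<union> set ys)) \<le>
        real (card (set xs) + j) ^ j / real n ^ card (set xs)"
      by (rule sum_inverse_card_tuples) (use bounds in auto)
    also have "\<dots> \<le> real (2 * j) ^ j / real n ^ card (set xs)"
      using \<open>card (set xs) \<le> j\<close> by (intro divide_right_mono power_mono) auto
    finally show "(\<Sum>ys\<in>tuples n j. 1 / real n ^ card (set xs \<union> set ys)) \<le>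
        real (2 * j) ^ j * (1 / real n ^ card ({} \<union> set xs))" by simp
  qed
  also have "\<dots> = real (2 * j) ^ j * (\<Sum>xs\<in>tuples n j. 1 / real n ^ card ({} \<union> set xs))"
    by (rule sum_distrib_left[symmetric])
  also have "\<dots> \<le> real (2 * j) ^ j * (real (card ({}::nat set) + j) ^ j / real n ^ card ({}::nat set))"
    by (intro mult_left_mono sum_inverse_card_tuples) (use bounds in auto)
  also have "real (card ({}::nat set) + j) ^ j / real n ^ card ({}::nat set) = real j ^ j" by simp
  also have "real (2 * j) ^ j * real j ^ j \<le> real (2 * j) ^ j * real (2 * j) ^ j"
    by (intro mult_left_mono power_mono) auto
  also have "\<dots> = real (2 * j) ^ (2 * j)"
    unfolding power_add[symmetric] mult_2[symmetric] ..
  finally show ?thesis .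
qed

lemma sum_pairs_subset_le:
  assumes "T \<subseteq> tuples n j"
  shows "(\<Sum>xs\<in>T. \<Sum>ys\<in>T. 1 / real n ^ card (set xs \<union> set ys)) \<le> real (2 * j) ^ (2 * j)"
proof -
  have "(\<Sum>xs\<in>T. \<Sum>ys\<in>T. 1 / real n ^ card (set xs \<union> set ys)) \<le>
      (\<Sum>xs\<in>T. \<Sum>ys\<in>tuples n j. 1 / real n ^ card (set xs \<union> set ys))"
    using assms by (intro sum_mono sum_mono2) auto
  also have "\<dots> \<le> (\<Sum>xs\<in>tuples n j. \<Sum>ys\<in>tuples n j. 1 / real n ^ card (set xs \<union> set ys))"
    using assms by (intro sum_mono2) (auto intro!: sum_nonneg)
  finally show ?thesis using sum_pairs_le[of j] by linarith
qed

lemma expectation_cycles: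
  assumes "3 \<le> j"
  shows "mean (count cycle_edges (cycles j)) =
    real (card (cycles j)) * (cycle_mean k a b j / real n ^ j)"
  using prob_cycle[of _ j] assms by (simp add: expectation_count) (simp add: cycles_def)

text \<open>Pairs with the same edges are the same cycle with another root or orientation, at most
  \<open>2 * j\<close> for each \<open>xs\<close>; they give the main term. Vertex-disjoint pairs
  give nothing, and all other pairs have a surplus edge, hence the factor
  \<open>1 / n\<close>.\<close>

lemma variance_cycles:
  assumes j: "3 \<le> j"
  defines "m \<equiv> mean (count cycle_edges (cycles j))"
  shows "expect M (\<lambda>\<omega>. (count cycle_edges (cycles j) (snd \<omega>) - m)\<^sup>2) \<le>
    2 * real j * m + C ^ (2 * j) / real n * real (2 * j) ^ (2 * j)"
proof -
  define p where "p = cycle_mean k a b j / real n ^ j"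
  define same where "same xs = {ys \<in> cycles j. cycle_edges ys = cycle_edges xs}" for xs
  have m: "m = real (card (cycles j)) * p" unfolding m_def p_def by (rule expectation_cycles[OF j])
  have pc: "present (cycle_edges xs) = p" if "xs \<in> cycles j" for xs
    using prob_cycle[of xs j] that j by (auto simp: cycles_def p_def)
  have pair: "present (cycle_edges xs \<union> cycle_edges ys) \<le>
      p\<^sup>2 + (of_bool (ys \<in> same xs) * p + C ^ (2 * j) / real n * (1 / real n ^ card (set xs \<union> set ys)))"
    if xs: "xs \<in> cycles j" and ys: "ys \<in> cycles j" for xs ys
  proof -
    have p: "0 \<le> p" using pc[OF xs] measure_nonneg by metis
    have err: "0 \<le> C ^ (2 * j) / real n * (1 / real n ^ card (set xs \<union> set ys))" using C by simp
    consider "cycle_edges ys = cycle_edges xs" | "set xs \<inter> set ys = {}"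
      | "cycle_edges ys \<noteq> cycle_edges xs" "set xs \<inter> set ys \<noteq> {}" by blast
    then show ?thesis
    proof cases
      case 1
      then have "ys \<in> same xs" using ys by (simp add: same_def)
      then show ?thesis using 1 pc[OF xs] err by simp
    next
      case 2
      then have "present (cycle_edges xs \<union> cycle_edges ys) = p\<^sup>2"
        using prob_disjoint_cycles[of xs j ys] xs ys j by (auto simp: cycles_def p_def)
      then show ?thesis using err p by simp
    next
      case 3
      have "present (cycle_edges xs \<union> cycle_edges ys) \<le>
          C ^ (2 * j) / real n * (1 / real n ^ card (set xs \<union> set ys))"
      proof (rule prob_excess_le)
        show "simple_graph n (cycle_edges xs \<union> cycle_edges ys)"
          using cycles_graph[OF xs j] cycles_graph[OF ys j] by (auto simp: simple_graph_def)
        show "card (set xs \<union> set ys) + 1 \<le> card (cycle_edges xs \<union> cycle_edges ys)"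
          by (rule two_cycles_excess[of _ j]) (use xs ys j 3 in \<open>auto simp: cycles_def tuples_def\<close>)
        have "card (cycle_edges xs) = j" "card (cycle_edges ys) = j"
          using card_cycle_edges xs ys j by (auto simp: cycles_def tuples_def)
        then show "card (cycle_edges xs \<union> cycle_edges ys) \<le> 2 * j"
          using card_Un_le[of "cycle_edges xs" "cycle_edges ys"] by simp
      qed
      then show ?thesis using p by (simp add: add_increasing)
    qed
  qed
  have same: "(\<Sum>ys\<in>cycles j. of_bool (ys \<in> same xs) * p) \<le> 2 * real j * p" if "xs \<in> cycles j" for xs
  proof -
    have p: "0 \<le> p" using pc[OF that] measure_nonneg by metis
    have "card (same xs) \<le> card {ys. distinct ys \<and> length ys = j \<and> cycle_edges ys = cycle_edges xs}"
      by (rule card_mono[OF card_same_cycle(1)]) (use that j in \<open>auto simp: same_def cycles_def tuples_def\<close>)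
    also have "\<dots> \<le> 2 * j" by (rule card_same_cycle(2)) (use that j in \<open>auto simp: cycles_def tuples_def\<close>)
    finally have "real (card (same xs)) \<le> 2 * real j" by linarith
    moreover have "(\<Sum>ys\<in>cycles j. of_bool (ys \<in> same xs) * p) = real (card (same xs)) * p"
    proof -
      have "cycles j \<inter> same xs = same xs" by (auto simp: same_def)
      then show ?thesis by (subst sum_distrib_right[symmetric]) simp
    qed
    ultimately show ?thesis using p by (simp only: mult_right_mono)
  qed
  have "expect M (\<lambda>\<omega>. (count cycle_edges (cycles j) (snd \<omega>) - m)\<^sup>2) \<le>
      (\<Sum>xs\<in>cycles j. \<Sum>ys\<in>cycles j. of_bool (ys \<in> same xs) * p +
        C ^ (2 * j) / real n * (1 / real n ^ card (set xs \<union> set ys)))"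
    unfolding m_def by (rule variance_count_le[OF finite_cycles(1) pc pair])
  also have "\<dots> = (\<Sum>xs\<in>cycles j. \<Sum>ys\<in>cycles j. of_bool (ys \<in> same xs) * p) +
      C ^ (2 * j) / real n * (\<Sum>xs\<in>cycles j. \<Sum>ys\<in>cycles j. 1 / real n ^ card (set xs \<union> set ys))"
    by (simp only: sum.distrib sum_distrib_left)
  also have "\<dots> \<le> 2 * real j * m + C ^ (2 * j) / real n * real (2 * j) ^ (2 * j)"
  proof (intro add_mono mult_left_mono sum_pairs_subset_le)
    have "(\<Sum>xs\<in>cycles j. \<Sum>ys\<in>cycles j. of_bool (ys \<in> same xs) * p) \<le> (\<Sum>xs\<in>cycles j. 2 * real j * p)"
      by (intro sum_mono same)
    then show "(\<Sum>xs\<in>cycles j. \<Sum>ys\<in>cycles j. of_bool (ys \<in> same xs) * p) \<le> 2 * real j * m"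
      by (simp add: m algebra_simps)
  qed (use C in \<open>auto simp: cycles_def\<close>)
  finally show ?thesis .
qed

lemma expectation_tangles:
  "mean (count cycle_edges (tangles j)) \<le>
    C ^ j / real n * real j ^ j"
proof -
  have "mean (count cycle_edges (tangles j)) \<le>
      (\<Sum>xs\<in>tangles j. C ^ j / real n * (1 / real n ^ card ({} \<union> set xs)))"
    unfolding expectation_count[OF finite_cycles(2)]
  proof (rule sum_mono)
    fix xs assume xs: "xs \<in> tangles j"
    then have len: "length xs = j" and ct: "closed_trail (\<noteq>) xs" by (auto simp: tangles_def tuples_def)
    have "card (path_edges xs) \<le> length xs - 1"
      by (induction xs rule: path_edges.induct) (auto intro: card_insert_le_m1)
    then have "card (cycle_edges xs) \<le> j"
      using len ct by (auto simp: cycle_edges_def closed_trail_def intro!: card_insert_le_m1)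
    then show "present (cycle_edges xs) \<le>
        C ^ j / real n * (1 / real n ^ card ({} \<union> set xs))"
      using closed_trail_excess[OF ct] cycle_edges_simple_graph[OF ct, of n j] xs
      by (intro prob_excess_le) (simp_all add: tangles_def)
  qed
  also have "\<dots> \<le> (\<Sum>xs\<in>tuples n j. C ^ j / real n * (1 / real n ^ card ({} \<union> set xs)))"
    by (rule sum_mono2) (use C in \<open>auto simp: tangles_def\<close>)
  also have "\<dots> = C ^ j / real n * (\<Sum>xs\<in>tuples n j. 1 / real n ^ card ({} \<union> set xs))"
    by (rule sum_distrib_left[symmetric])
  also have "\<dots> \<le> C ^ j / real n * (real (card ({}::nat set) + j) ^ j / real n ^ card ({}::nat set))"
    by (intro mult_left_mono sum_inverse_card_tuples) (use bounds C in auto)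
  finally show ?thesis by simp
qed


section \<open>Edges as tuples of length 2, and the average degree\<close>

definition pairs :: "nat list set" where
  "pairs = {xs \<in> tuples n 2. distinct xs}"

definition edge :: "nat list \<Rightarrow> nat set set" where
  "edge xs = {set xs}"

lemma finite_pairs [simp]: "finite pairs"
  by (simp add: pairs_def)

lemma edge_graph: "xs \<in> pairs \<Longrightarrow> simple_graph n (edge xs)"
  by (auto simp: pairs_def tuples_def edge_def simple_graph_def distinct_card)

lemma pairsE:
  assumes "xs \<in> pairs"
  obtains x y where "xs = [x, y]" "x \<noteq> y" "x < n" "y < n"
  using assms by (auto simp: pairs_def tuples_def numeral_2_eq_2 length_Suc_conv)

lemma edge_weight: "xs \<in> pairs \<Longrightarrow>
    (\<Prod>e\<in>edge xs. edge_prob n a b \<sigma> e) = path_weight a b (map \<sigma> xs) / real n"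
  by (erule pairsE) (simp add: edge_def affinity_edge_prob)

lemma expectation_pair_weight:
  "expect (colours 2 k) (path_weight a b) = avg_degree k a b"
proof -
  have row: "(\<Sum>y<k. affinity a b x y) = real k * avg_degree k a b" if "x < k" for x
    using sum_affinity[OF k that, of a b "\<lambda>_. 1"] k
      eigenvalue_identities(1)[OF k, where a = a and b = b] by (simp add: algebra_simps)
  have "expect (colours 2 k) (path_weight a b) =
      (\<Sum>x<k. (\<Sum>y<k. affinity a b x y) / real k) / real k"
    unfolding numeral_2_eq_2 by (simp only: expectation_colours_Suc[OF k]) simp
  also have "\<dots> = (\<Sum>x<k. avg_degree k a b) / real k"
    using row k by (intro arg_cong2[where f = "(/)"] sum.cong refl) simp
  finally show ?thesis using k by simp
qed

lemma pairs_tuples: "xs \<in> pairs \<Longrightarrow> distinct xs \<and> set xs \<subseteq> {..<n} \<and> length xs = 2"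
  by (auto simp: tuples_def pairs_def)

lemma prob_pair: "xs \<in> pairs \<Longrightarrow> present (edge xs) = avg_degree k a b / real n"
  using prob_tuple[OF edge_graph _ _ _ edge_weight] pairs_tuples expectation_pair_weight by simp

lemma prob_disjoint_pairs:
  assumes xs: "xs \<in> pairs" and ys: "ys \<in> pairs" and disj: "set xs \<inter> set ys = {}"
  shows "present (edge xs \<union> edge ys) = (avg_degree k a b / real n)\<^sup>2"
  unfolding expectation_pair_weight[symmetric]
  by (rule prob_disjoint_tuples[where xs = xs and ys = ys])
    (use edge_graph edge_weight pairs_tuples[OF xs] pairs_tuples[OF ys] xs ys disj in \<open>auto simp: edge_def\<close>)

lemma card_pairs: "card pairs = n * (n - 1)"
proof -
  have "pairs = (\<Union>x<n. (\<lambda>y. [x, y]) ` ({..<n} - {x}))"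
    by (auto simp: pairs_def tuples_def numeral_2_eq_2 length_Suc_conv)
  also have "card \<dots> = (\<Sum>x<n. card ((\<lambda>y. [x, y]) ` ({..<n} - {x})))"
    by (rule card_UN_disjoint) auto
  also have "\<dots> = (\<Sum>x<n. n - 1)"
    by (intro sum.cong refl) (subst card_image, auto simp: inj_on_def)
  finally show ?thesis by simp
qed

lemma expectation_pairs:
  "mean (count edge pairs) = (real n - 1) * avg_degree k a b"
  using bounds by (simp add: expectation_count prob_pair card_pairs of_nat_diff)

text \<open>Two pairs with a common vertex have at most one vertex more than edges, which costs a
  factor \<open>n\<close>; the squared mean is of order \<open>n\<^sup>2\<close>, so concentration
  remains. The constant is \<open>(2 * 2) ^ (2 * 2)\<close> from
  \<open>sum_pairs_subset_le\<close>.\<close>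

lemma variance_pairs:
  defines "m \<equiv> mean (count edge pairs)"
  shows "expect M (\<lambda>\<omega>. (count edge pairs (snd \<omega>) - m)\<^sup>2) \<le> 256 * C\<^sup>2 * real n"
proof -
  define p where "p = avg_degree k a b / real n"
  have pair: "present (edge xs \<union> edge ys) \<le>
      p\<^sup>2 + C\<^sup>2 * real n * (1 / real n ^ card (set xs \<union> set ys))"
    if xs: "xs \<in> pairs" and ys: "ys \<in> pairs" for xs ys
  proof (cases "set xs \<inter> set ys = {}")
    case True
    then show ?thesis using prob_disjoint_pairs[OF xs ys] by (simp add: p_def)
  next
    case False
    have sg: "simple_graph n (edge xs \<union> edge ys)"
      using edge_graph[OF xs] edge_graph[OF ys] by (auto simp: simple_graph_def)
    have c: "card (set xs \<union> set ys) \<le> card (edge xs \<union> edge ys) + 1 \<and> card (edge xs \<union> edge ys) \<le> 2"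
    proof (cases "set xs = set ys")
      case True
      have "card (set ys) = 2" using edge_graph[OF ys] by (auto simp: simple_graph_def edge_def)
      then show ?thesis using True by (simp add: edge_def)
    next
      case ne: False
      have "card (set xs) = 2" "card (set ys) = 2"
        using edge_graph[OF xs] edge_graph[OF ys] by (auto simp: simple_graph_def edge_def)
      then have "card (set xs \<union> set ys) + card (set xs \<inter> set ys) = 4"
        using card_Un_Int[of "set xs" "set ys"] by simp
      moreover have "card (set xs \<inter> set ys) \<noteq> 0" using False by simp
      ultimately have "card (set xs \<union> set ys) \<le> 3" by linarith
      then show ?thesis using ne by (simp add: edge_def)
    qed
    let ?e = "card (edge xs \<union> edge ys)"
    have "present (edge xs \<union> edge ys) \<le> (C / real n) ^ ?e"
      by (rule prob_edges_le[OF k a(1) b(1) bounds(1,2) a(2) b(2) sg])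
    also have "\<dots> = C ^ ?e * real n / real n ^ (?e + 1)" using bounds by (simp add: power_divide)
    also have "\<dots> \<le> C ^ 2 * real n / real n ^ card (set xs \<union> set ys)"
      using C c bounds by (intro frac_le mult_right_mono power_increasing) auto
    finally show ?thesis by (simp add: add_increasing)
  qed
  have "expect M (\<lambda>\<omega>. (count edge pairs (snd \<omega>) - m)\<^sup>2) \<le>
      (\<Sum>xs\<in>pairs. \<Sum>ys\<in>pairs. C\<^sup>2 * real n * (1 / real n ^ card (set xs \<union> set ys)))"
    unfolding m_def by (rule variance_count_le[OF finite_pairs _ pair]) (simp add: prob_pair p_def)
  also have "\<dots> = C\<^sup>2 * real n * (\<Sum>xs\<in>pairs. \<Sum>ys\<in>pairs. 1 / real n ^ card (set xs \<union> set ys))"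
    by (simp only: sum_distrib_left)
  also have "\<dots> \<le> C\<^sup>2 * real n * 256"
    using sum_pairs_subset_le[of pairs 2] C by (intro mult_left_mono) (auto simp: pairs_def)
  finally show ?thesis by simp
qed

lemma degree_sum_eq_count:
  assumes "simple_graph n G"
  shows "real (degree_sum (\<lambda>u v. {u, v} \<in> G) n) = count edge pairs G"
proof -
  have "count edge pairs G = (\<Sum>xs\<in>pairs. of_bool (set xs \<in> G))"
    by (simp add: count_def edge_def Int_def)
  also have "\<dots> = (\<Sum>xs\<in>tuples n 2. of_bool (set xs \<in> G))"
  proof (rule sum.mono_neutral_left)
    show "\<forall>xs\<in>tuples n 2 - pairs. of_bool (set xs \<in> G) = (0::real)"
    proof
      fix xs assume "xs \<in> tuples n 2 - pairs"
      then have "card (set xs) \<noteq> 2" using card_distinct[of xs] by (auto simp: pairs_def tuples_def)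
      then show "of_bool (set xs \<in> G) = (0::real)" using assms by (auto simp: simple_graph_def)
    qed
  qed (auto simp: pairs_def)
  also have "\<dots> = (\<Sum>u<n. \<Sum>v<n. of_bool ({u, v} \<in> G))"
    by (simp add: numeral_2_eq_2 sum_tuples_Suc del: sum_of_bool_eq)
  also have "\<dots> = real (degree_sum (\<lambda>u v. {u, v} \<in> G) n)"
    by (simp add: degree_sum_def del: sum_of_bool_eq)
  finally show ?thesis ..
qed

lemma closed_walks_eq_count:
  assumes "simple_graph n G" "3 \<le> j"
  shows "real (closed_walks (\<lambda>u v. {u, v} \<in> G) n j) =
    count cycle_edges (cycles j) G + count cycle_edges (tangles j) G"
proof -
  have "{x, x} \<notin> G" for x using assms(1) by (force simp: simple_graph_def)
  then have ct: "closed_trail (\<lambda>u v. {u, v} \<in> G) xs \<longleftrightarrow> closed_trail (\<noteq>) xs \<and> cycle_edges xs \<subseteq> G" for xs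
    by (intro closed_trail_iff_edges) auto
  have "{xs \<in> tuples n j. closed_trail (\<lambda>u v. {u, v} \<in> G) xs} =
      {xs \<in> cycles j. cycle_edges xs \<subseteq> G} \<union> {xs \<in> tangles j. cycle_edges xs \<subseteq> G}"
    using assms(2) distinct_closed_trail unfolding ct by (auto simp: cycles_def tangles_def tuples_def)
  moreover have "{xs \<in> cycles j. cycle_edges xs \<subseteq> G} \<inter> {xs \<in> tangles j. cycle_edges xs \<subseteq> G} = {}"
    by (auto simp: cycles_def tangles_def)
  ultimately show ?thesis
    by (simp add: closed_walks_eq_card[OF assms(2)] count_def card_Un_disjoint)
qed

end

section \<open>Concentration of the centred walk counts\<close>

text \<open>The exponents counted by \<open>bits\<close> form an initial segment, so there are
  \<open>c\<close> of them as soon as \<open>c - 1\<close> is one.\<close>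

lemma bits_ge_iff:
  assumes "1 \<le> c"
  shows "c \<le> bits n x \<longleftrightarrow> c \<le> n \<and> 2 ^ (c - 1) \<le> x"
proof
  assume c: "c \<le> n \<and> 2 ^ (c - 1) \<le> x"
  have "{..<c} \<subseteq> {i. i < n \<and> 2 ^ i \<le> x}"
  proof
    fix i assume "i \<in> {..<c}"
    then have "(2::nat) ^ i \<le> 2 ^ (c - 1)" by (intro power_increasing) auto
    then have "2 ^ i \<le> x" using c by (meson le_trans)
    then show "i \<in> {i. i < n \<and> 2 ^ i \<le> x}" using c \<open>i \<in> {..<c}\<close> by auto
  qed
  from card_mono[OF _ this] show "c \<le> bits n x" by (simp add: bits_def)
next
  assume c: "c \<le> bits n x"
  have "bits n x \<le> card {..<n}" unfolding bits_def by (rule card_mono) auto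
  moreover have "2 ^ (c - 1) \<le> x"
  proof (rule ccontr)
    assume x: "\<not> 2 ^ (c - 1) \<le> x"
    have "i < c - 1" if "2 ^ i \<le> x" for i
    proof (rule ccontr)
      assume "\<not> i < c - 1"
      then have "(2::nat) ^ (c - 1) \<le> 2 ^ i" by (intro power_increasing) auto
      then show False using that x le_trans by blast
    qed
    then have "bits n x \<le> card {..<c - 1}" unfolding bits_def by (intro card_mono) auto
    then show False using c assms by simp
  qed
  ultimately show "c \<le> n \<and> 2 ^ (c - 1) \<le> x" using c by simp
qed

text \<open>About the binary logarithm of the binary logarithm of \<open>n\<close>; the length
  \<open>m\<close> of the program is \<open>2 * level n\<close>.\<close>

definition level :: "nat \<Rightarrow> nat" where
  "level n = bits n (bits n n)"

lemma level_at_top: "filterlim level at_top sequentially"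
  unfolding filterlim_at_top
proof
  fix z :: nat
  define c where "c = max z 1"
  \<comment> \<open>Two uses of \<open>bits_ge_iff\<close>: the outer \<open>bits\<close> asks for
    \<open>2 ^ (c - 1)\<close> digits of \<open>n\<close>, whence the double exponential. The other
    two bounds take care of the caps at \<open>n\<close>.\<close>
  have "c \<le> level n" if "max c (max (2 ^ (c - 1)) (2 ^ (2 ^ (c - 1) - 1))) \<le> n" for n
  proof -
    have "2 ^ (c - 1) \<le> bits n n" using that by (subst bits_ge_iff) auto
    then show ?thesis unfolding level_def using that by (subst bits_ge_iff) (auto simp: c_def)
  qed
  then have "z \<le> level n" if "max c (max (2 ^ (c - 1)) (2 ^ (2 ^ (c - 1) - 1))) \<le> n" for n
    using that unfolding c_def by (meson max.boundedE)
  then show "\<forall>\<^sub>F n in sequentially. z \<le> level n"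
    unfolding eventually_sequentially by blast
qed

lemma level_upper:
  assumes "1 \<le> level n"
  shows "2 powr (2 powr (real (level n) - 1) - 1) \<le> real n"
proof -
  define r where "r = level n"
  have "2 ^ (r - 1) \<le> bits n n"
    using bits_ge_iff[of r n "bits n n"] assms by (simp add: r_def level_def)
  then have "2 ^ (2 ^ (r - 1) - 1) \<le> n"
    using bits_ge_iff[of "2 ^ (r - 1)" n n] by simp
  then have "(2::real) ^ (2 ^ (r - 1) - 1) \<le> real n"
    by (metis of_nat_le_iff of_nat_numeral of_nat_power)
  moreover have "2 powr (real r - 1) - 1 = real (2 ^ (r - 1) - 1)"
  proof -
    have "real r - 1 = real (r - 1)" using assms by (simp add: r_def)
    then have "2 powr (real r - 1) = 2 ^ (r - 1)" by (simp only: powr_realpow zero_less_numeral)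
    moreover have "real (2 ^ (r - 1) - 1) = 2 ^ (r - 1) - 1" by (subst of_nat_diff) simp_all
    ultimately show ?thesis by simp
  qed
  ultimately show ?thesis
    unfolding r_def[symmetric] by (simp only: powr_realpow zero_less_numeral)
qed

text \<open>An upper bound, up to constants, for all error terms that vanish because the walks are short.\<close>

definition slack :: "real \<Rightarrow> nat \<Rightarrow> real" where
  "slack C n = (8 * C * real (level n)) ^ (8 * level n + 1) / real n powr (1 / 4)"

text \<open>In terms of \<open>r = level n\<close> the numerator is the exponential of a multiple of
  \<open>r log r\<close>, whereas by \<open>level_upper\<close> the denominator grows doubly
  exponentially in \<open>r\<close>.\<close>

lemma slack_tendsto_0:
  assumes C: "1 \<le> C"
  shows "slack C \<longlonglongrightarrow> 0"
proof -
  define g where "g = (\<lambda>r::real. (8 * C * r) powr (8 * r + 1) / (2 powr (2 powr (r - 1) - 1)) powr (1/4))"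
  have "(g \<longlongrightarrow> 0) at_top" unfolding g_def using C by real_asymp
  then have "(\<lambda>n. g (real (level n))) \<longlonglongrightarrow> 0"
    by (rule filterlim_compose) (rule filterlim_compose[OF filterlim_real_sequentially level_at_top])
  moreover have "\<forall>\<^sub>F n in sequentially. 1 \<le> level n"
    using level_at_top unfolding filterlim_at_top by blast
  then have "\<forall>\<^sub>F n in sequentially. slack C n \<le> g (real (level n))"
  proof eventually_elim
    case (elim n)
    define r where "r = real (level n)"
    have r: "1 \<le> r" using elim by (simp add: r_def)
    have "8 * C * r > 0" using C r by simp
    then have "(8 * C * r) ^ (8 * level n + 1) = (8 * C * r) powr (8 * r + 1)"
      by (subst powr_realpow[symmetric]) (auto simp: r_def add.commute)
    moreover have "(2 powr (2 powr (r - 1) - 1)) powr (1/4) \<le> real n powr (1/4)"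
      using level_upper[OF elim] by (intro powr_mono2) (auto simp: r_def)
    moreover have "0 < real n"
    proof -
      have "0 < 2 powr (2 powr (real (level n) - 1) - 1)" by simp
      then show ?thesis using level_upper[OF elim] by linarith
    qed
    ultimately show ?case unfolding slack_def g_def r_def[symmetric]
      by (auto intro!: divide_left_mono)
  qed
  moreover have "\<forall>\<^sub>F n in sequentially. 0 \<le> slack C n"
    using C by (intro always_eventually) (simp add: slack_def)
  ultimately show ?thesis
    by (intro tendsto_sandwich[of "\<lambda>_. 0" "slack C" sequentially "\<lambda>n. g (real (level n))" 0]) auto
qed

definition degree_estimate :: "nat \<Rightarrow> nat set set \<Rightarrow> real" where
  "degree_estimate n G = real (degree_sum (\<lambda>u v. {u, v} \<in> G) n) / real n"

definition centred_walks :: "nat \<Rightarrow> nat set set \<Rightarrow> nat \<Rightarrow> real" where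
  "centred_walks n G j = real (closed_walks (\<lambda>u v. {u, v} \<in> G) n j) - degree_estimate n G ^ j"

context sbm
begin

abbreviation d :: real where "d \<equiv> avg_degree k a b"
abbreviation s :: real where "s \<equiv> second_eigenvalue k a b"

lemma markov_square:
  fixes f :: "_ \<Rightarrow> real"
  assumes "0 < \<epsilon>"
  shows "prob M {\<omega>. \<epsilon> \<le> \<bar>f \<omega>\<bar>} \<le> expect M (\<lambda>\<omega>. (f \<omega>)\<^sup>2) / \<epsilon>\<^sup>2"
proof -
  have "prob M {\<omega>\<in>space (measure_pmf M). (f \<omega>)\<^sup>2 \<ge> \<epsilon>\<^sup>2} \<le> expect M (\<lambda>\<omega>. (f \<omega>)\<^sup>2) / \<epsilon>\<^sup>2"
    by (rule integral_Markov_inequality_measure[where A = UNIV]) (use assms in auto)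
  moreover have "{\<omega>. \<epsilon> \<le> \<bar>f \<omega>\<bar>} \<subseteq> {\<omega>. (f \<omega>)\<^sup>2 \<ge> \<epsilon>\<^sup>2}"
    using assms by (auto simp: abs_le_square_iff[symmetric])
  then have "prob M {\<omega>. \<epsilon> \<le> \<bar>f \<omega>\<bar>} \<le> prob M {\<omega>. (f \<omega>)\<^sup>2 \<ge> \<epsilon>\<^sup>2}"
    by (intro measure_pmf.finite_measure_mono) auto
  ultimately show ?thesis by simp
qed

text \<open>Only \<open>n * (n - 1)\<close> ordered pairs are counted, so the mean of the estimate
  is \<open>d - d / n\<close>; this explains the shift of the threshold. The rest is Chebyshev's
  inequality.\<close>

lemma prob_degree_estimate:
  assumes "0 < \<eta>" and d: "0 \<le> d"
  shows "prob M {\<omega>. \<eta> + d / real n \<le> \<bar>degree_estimate n (snd \<omega>) - d\<bar>} \<le>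
    256 * C\<^sup>2 / (\<eta>\<^sup>2 * real n)"
proof -
  let ?m = "mean (count edge pairs)"
  have "prob M {\<omega>. \<eta> + d / real n \<le> \<bar>degree_estimate n (snd \<omega>) - d\<bar>} =
      prob M ({\<omega>. \<eta> + d / real n \<le> \<bar>degree_estimate n (snd \<omega>) - d\<bar>} \<inter> set_pmf M)"
    by (rule measure_Int_set_pmf[symmetric])
  also have "\<dots> \<le> prob M {\<omega>. \<eta> * real n \<le> \<bar>count edge pairs (snd \<omega>) - ?m\<bar>}"
  proof (rule measure_pmf.finite_measure_mono)
    show "{\<omega>. \<eta> + d / real n \<le> \<bar>degree_estimate n (snd \<omega>) - d\<bar>} \<inter> set_pmf M \<subseteq>
        {\<omega>. \<eta> * real n \<le> \<bar>count edge pairs (snd \<omega>) - ?m\<bar>}"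
    proof clarify
      fix \<sigma> G assume "(\<sigma>, G) \<in> set_pmf M"
        and h: "\<eta> + d / real n \<le> \<bar>degree_estimate n (snd (\<sigma>, G)) - d\<bar>"
      then have sg: "simple_graph n G" using simple_graph_SBM by blast
      have "count edge pairs G - ?m = real n * (degree_estimate n G - d) + d"
        using degree_sum_eq_count[OF sg] bounds by (simp add: expectation_pairs degree_estimate_def algebra_simps)
      then have "\<bar>count edge pairs G - ?m\<bar> \<ge> real n * \<bar>degree_estimate n G - d\<bar> - d"
      proof -
        have "\<bar>real n * (degree_estimate n G - d)\<bar> = real n * \<bar>degree_estimate n G - d\<bar>"
          by (simp add: abs_mult)
        then show ?thesis using d \<open>count edge pairs G - ?m = _\<close> by linarith
      qed
      moreover have "real n * \<bar>degree_estimate n G - d\<bar> \<ge> real n * (\<eta> + d / real n)"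
        using h bounds by (intro mult_left_mono) auto
      ultimately show "\<eta> * real n \<le> \<bar>count edge pairs (snd (\<sigma>, G)) - ?m\<bar>"
        using bounds by (simp add: algebra_simps)
    qed
  qed simp
  also have "\<dots> \<le> expect M (\<lambda>\<omega>. (count edge pairs (snd \<omega>) - ?m)\<^sup>2) / (\<eta> * real n)\<^sup>2"
    by (rule markov_square) (use assms bounds in auto)
  also have "\<dots> \<le> 256 * C\<^sup>2 * real n / (\<eta> * real n)\<^sup>2"
    by (intro divide_right_mono variance_pairs) auto
  also have "\<dots> = 256 * C\<^sup>2 / (\<eta>\<^sup>2 * real n)"
    using assms bounds by (simp add: power2_eq_square field_simps)
  finally show ?thesis .
qed

lemma abs_diff_power_le:
  fixes x y R :: real
  assumes "\<bar>x\<bar> \<le> R" "\<bar>y\<bar> \<le> R" "1 \<le> R"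
  shows "\<bar>x ^ j - y ^ j\<bar> \<le> real j * R ^ j * \<bar>x - y\<bar>"
proof (induction j)
  case (Suc j)
  have "x ^ Suc j - y ^ Suc j = x * (x ^ j - y ^ j) + (x - y) * y ^ j" by (simp add: algebra_simps)
  then have "\<bar>x ^ Suc j - y ^ Suc j\<bar> \<le> \<bar>x\<bar> * \<bar>x ^ j - y ^ j\<bar> + \<bar>x - y\<bar> * \<bar>y\<bar> ^ j"
    by (metis abs_mult abs_triangle_ineq power_abs)
  also have "\<dots> \<le> R * (real j * R ^ j * \<bar>x - y\<bar>) + \<bar>x - y\<bar> * R ^ Suc j"
  proof (intro add_mono mult_mono Suc.IH assms(1))
    have "\<bar>y\<bar> ^ j \<le> R ^ j" using assms by (intro power_mono) auto
    also have "\<dots> \<le> R ^ Suc j" using assms by (intro power_increasing) auto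
    finally show "\<bar>y\<bar> ^ j \<le> R ^ Suc j" .
  qed (use assms in auto)
  finally show ?case by (simp add: algebra_simps)
qed simp

end

text \<open>\<open>C_large\<close> leaves room for the estimated degree: within distance 1 of
  \<open>d\<close> it is still bounded by \<open>C\<close>, so that its powers can be compared with
  those of \<open>d\<close>.\<close>

locale sbm_above = sbm +
  assumes k2: "2 \<le> k" and snr: "avg_degree k a b < (second_eigenvalue k a b)\<^sup>2"
    and C_large: "avg_degree k a b + 1 \<le> C"
begin

lemma s_le_d: "\<bar>s\<bar> \<le> d"
proof -
  have "\<bar>a - b\<bar> \<le> a + (real k - 1) * b"
  proof -
    have "1 * b \<le> (real k - 1) * b" using k2 b by (intro mult_right_mono) auto
    then show ?thesis using a(1) b(1) by linarith
  qed
  then show ?thesis using k by (simp add: avg_degree_def second_eigenvalue_def divide_right_mono)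
qed

text \<open>\<open>d < s\<^sup>2 \<le> d\<^sup>2\<close>, by
  \<open>\<bar>s\<bar> \<le> d\<close>.\<close>

lemma d_gt_1: "1 < d"
proof -
  have "d \<noteq> 0" using s_le_d snr by auto
  then have "0 < d" using s_le_d by linarith
  moreover have "s\<^sup>2 \<le> d\<^sup>2" using s_le_d by (metis abs_ge_zero power2_abs power_mono)
  then have "d < d * d" using snr by (simp add: power2_eq_square)
  ultimately show ?thesis by (metis mult_less_cancel_left_pos mult.right_neutral)
qed

lemma s_gt_1: "1 < \<bar>s\<bar>"
proof -
  have "1 < \<bar>s\<bar>\<^sup>2" using snr d_gt_1 by simp
  then show ?thesis by (metis abs_ge_zero linorder_not_le power2_abs power_le_one)
qed

lemma cycle_mean_abs: "\<bar>cycle_mean k a b j\<bar> \<le> real k * d ^ j"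
proof -
  have "\<bar>cycle_mean k a b j\<bar> \<le> \<bar>d ^ j\<bar> + \<bar>(real k - 1) * s ^ j\<bar>"
    unfolding cycle_mean_def by (rule abs_triangle_ineq)
  also have "\<dots> = d ^ j + (real k - 1) * \<bar>s\<bar> ^ j"
    using d_gt_1 k2 by (simp add: abs_mult power_abs)
  also have "\<dots> \<le> d ^ j + (real k - 1) * d ^ j"
    using s_le_d k2 by (intro add_mono mult_left_mono power_mono) auto
  finally show ?thesis by (simp add: algebra_simps)
qed

text \<open>The mean is \<open>cycle_mean\<close> times the fraction \<open>f\<close> of tuples
  without repetition, and \<open>card_cycles_ge\<close> keeps \<open>f\<close> close to 1.\<close>

lemma expectation_cycles_close:
  assumes "3 \<le> j"
  shows "\<bar>mean (count cycle_edges (cycles j)) - cycle_mean k a b j\<bar>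
      \<le> real k * d ^ j * (real j ^ j / real n)"
    "mean (count cycle_edges (cycles j)) \<le> real k * d ^ j"
proof -
  define f where "f = real (card (cycles j)) / real n ^ j"
  have nj: "0 < real n ^ j" using bounds by simp
  have f1: "f \<le> 1" "0 \<le> f"
    using card_cycles_le[of j] nj by (simp_all add: f_def flip: of_nat_power)
  have "(real n ^ j - real j ^ j * real n ^ j / real n) / real n ^ j \<le> f"
    unfolding f_def using card_cycles_ge by (intro divide_right_mono) auto
  moreover have "(real n ^ j - real j ^ j * real n ^ j / real n) / real n ^ j = 1 - real j ^ j / real n"
    using bounds by (simp add: field_simps)
  ultimately have f2: "1 - real j ^ j / real n \<le> f" by simp
  have E: "mean (count cycle_edges (cycles j)) = f * cycle_mean k a b j"
    using expectation_cycles[OF assms] by (simp add: f_def)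
  have "f * cycle_mean k a b j - cycle_mean k a b j = (f - 1) * cycle_mean k a b j"
    by (simp add: algebra_simps)
  then have "\<bar>f * cycle_mean k a b j - cycle_mean k a b j\<bar> = \<bar>1 - f\<bar> * \<bar>cycle_mean k a b j\<bar>"
    by (simp add: abs_mult abs_minus_commute)
  also have "\<dots> \<le> (real j ^ j / real n) * (real k * d ^ j)"
    using f1 f2 d_gt_1 by (intro mult_mono cycle_mean_abs) auto
  finally show "\<bar>mean (count cycle_edges (cycles j)) - cycle_mean k a b j\<bar>
      \<le> real k * d ^ j * (real j ^ j / real n)" unfolding E by (simp add: mult.commute)
  have "f * cycle_mean k a b j \<le> \<bar>f\<bar> * \<bar>cycle_mean k a b j\<bar>" by (metis abs_ge_self abs_mult)
  also have "\<dots> \<le> 1 * (real k * d ^ j)" using f1 by (intro mult_mono cycle_mean_abs) auto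
  finally show "mean (count cycle_edges (cycles j)) \<le> real k * d ^ j"
    unfolding E by simp
qed

text \<open>The deterministic part: the error splits into the fluctuation of the cycle count, the
  bias of its mean, and the difference of the \<open>j\<close>-th powers of estimated and true
  degree. As \<open>\<bar>s\<bar> ^ j \<ge> 1\<close>, dividing by it does not increase the last
  two.\<close>

lemma centred_walks_close:
  assumes G: "simple_graph n G" and j: "3 \<le> j"
    and I: "\<bar>count cycle_edges (cycles j) G -
        mean (count cycle_edges (cycles j))\<bar> < \<delta> * \<bar>s\<bar> ^ j"
    and J: "count cycle_edges (tangles j) G < 1"
    and D: "\<bar>degree_estimate n G - d\<bar> < \<eta>'" "\<eta>' \<le> 1"
  shows "\<bar>centred_walks n G j / s ^ j - (real k - 1)\<bar> \<le>
    \<delta> + real k * d ^ j * (real j ^ j / real n) + real j * C ^ j * \<eta>'"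
proof -
  let ?EI = "mean (count cycle_edges (cycles j))"
  define e1 where "e1 = real k * d ^ j * (real j ^ j / real n)"
  define e2 where "e2 = real j * C ^ j * \<eta>'"
  have sj: "1 \<le> \<bar>s\<bar> ^ j" using s_gt_1 by (simp add: one_le_power)
  have e: "0 \<le> e1" "0 \<le> e2" using d_gt_1 C D by (auto simp: e1_def e2_def)
  \<comment> \<open>A count is a natural number, so below 1 it vanishes.\<close>
  have "count cycle_edges (tangles j) G = 0" using J by (simp add: count_def)
  then have X: "real (closed_walks (\<lambda>u v. {u, v} \<in> G) n j) = count cycle_edges (cycles j) G"
    using closed_walks_eq_count[OF G j] by simp
  have "\<bar>degree_estimate n G ^ j - d ^ j\<bar> \<le> real j * C ^ j * \<bar>degree_estimate n G - d\<bar>"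
    by (rule abs_diff_power_le) (use D C_large d_gt_1 C in auto)
  also have "\<dots> \<le> e2" unfolding e2_def using D C by (intro mult_left_mono) auto
  finally have p: "\<bar>degree_estimate n G ^ j - d ^ j\<bar> \<le> e2" .
  have "centred_walks n G j - (real k - 1) * s ^ j = (count cycle_edges (cycles j) G - ?EI) +
      (?EI - cycle_mean k a b j) - (degree_estimate n G ^ j - d ^ j)"
    by (simp add: centred_walks_def X cycle_mean_def)
  then have "\<bar>centred_walks n G j - (real k - 1) * s ^ j\<bar> \<le> \<delta> * \<bar>s\<bar> ^ j + e1 + e2"
    using I p expectation_cycles_close(1)[OF j] unfolding e1_def by linarith
  also have "\<dots> \<le> \<delta> * \<bar>s\<bar> ^ j + e1 * \<bar>s\<bar> ^ j + e2 * \<bar>s\<bar> ^ j"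
    using sj e by (intro add_mono) (auto simp: mult_le_cancel_left1)
  finally have "\<bar>centred_walks n G j - (real k - 1) * s ^ j\<bar> \<le> (\<delta> + e1 + e2) * \<bar>s\<bar> ^ j"
    by (simp add: algebra_simps)
  moreover have "s ^ j \<noteq> 0" using s_gt_1 by auto
  then have "centred_walks n G j / s ^ j - (real k - 1) = (centred_walks n G j - (real k - 1) * s ^ j) / s ^ j"
    by (simp add: field_simps)
  moreover have "0 < \<bar>s\<bar> ^ j" using sj by linarith
  ultimately have "\<bar>centred_walks n G j / s ^ j - (real k - 1)\<bar> \<le> \<delta> + e1 + e2"
    by (simp only: abs_divide power_abs pos_divide_le_eq)
  then show ?thesis unfolding e1_def e2_def .
qed

lemma prob_centred_walks:
  assumes j: "3 \<le> j" and \<delta>: "0 < \<delta>" and \<eta>: "0 < \<eta>" "\<eta> + d / real n \<le> 1"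
  shows "prob M {\<omega>. \<delta> + real k * d ^ j * (real j ^ j / real n) +
      real j * C ^ j * (\<eta> + d / real n) < \<bar>centred_walks n (snd \<omega>) j / s ^ j - (real k - 1)\<bar>} \<le>
    (2 * real j * (real k * d ^ j) + C ^ (2 * j) / real n * real (2 * j) ^ (2 * j)) / (\<delta> * \<bar>s\<bar> ^ j)\<^sup>2 +
    C ^ j / real n * real j ^ j + 256 * C\<^sup>2 / (\<eta>\<^sup>2 * real n)"
    (is "prob M ?B \<le> ?p1 + ?p2 + ?p3")
proof -
  let ?EI = "mean (count cycle_edges (cycles j))"
  define B1 where "B1 = {\<omega>::(nat \<Rightarrow> nat) \<times> nat set set. \<delta> * \<bar>s\<bar> ^ j \<le> \<bar>count cycle_edges (cycles j) (snd \<omega>) - ?EI\<bar>}"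
  define B2 where "B2 = {\<omega>::(nat \<Rightarrow> nat) \<times> nat set set. 1 \<le> count cycle_edges (tangles j) (snd \<omega>)}"
  define B3 where "B3 = {\<omega>::(nat \<Rightarrow> nat) \<times> nat set set. \<eta> + d / real n \<le> \<bar>degree_estimate n (snd \<omega>) - d\<bar>}"
  have pos: "0 < \<delta> * \<bar>s\<bar> ^ j" using \<delta> s_gt_1 by simp
  \<comment> \<open>Restricting to the support makes the graph simple, as
    \<open>centred_walks_close\<close> demands.\<close>
  have "prob M ?B = prob M (?B \<inter> set_pmf M)"
    by (rule measure_Int_set_pmf[symmetric])
  also have "\<dots> \<le> prob M (B1 \<union> B2 \<union> B3)"
  proof (rule measure_pmf.finite_measure_mono)
    show "?B \<inter> set_pmf M \<subseteq> B1 \<union> B2 \<union> B3"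
    proof clarify
      fix \<sigma> G assume M: "(\<sigma>, G) \<in> set_pmf M" and n3: "(\<sigma>, G) \<notin> B3" "(\<sigma>, G) \<notin> B2"
        and B: "\<delta> + real k * d ^ j * (real j ^ j / real n) +
      real j * C ^ j * (\<eta> + d / real n) < \<bar>centred_walks n (snd (\<sigma>, G)) j / s ^ j - (real k - 1)\<bar>"
      show "(\<sigma>, G) \<in> B1"
      proof (rule ccontr)
        assume "(\<sigma>, G) \<notin> B1"
        then have "\<bar>centred_walks n G j / s ^ j - (real k - 1)\<bar> \<le>
          \<delta> + real k * d ^ j * (real j ^ j / real n) + real j * C ^ j * (\<eta> + d / real n)"
          using n3 M \<eta> j by (intro centred_walks_close simple_graph_SBM) (auto simp: B1_def B2_def B3_def)
        then show False using B by simp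
      qed
    qed
  qed simp
  also have "\<dots> \<le> prob M B1 + prob M B2 + prob M B3"
    using measure_Un_le[of "B1 \<union> B2" "measure_pmf M" B3] measure_Un_le[of B1 "measure_pmf M" B2] by simp
  also have "\<dots> \<le> ?p1 + ?p2 + ?p3"
  proof (intro add_mono)
    have "prob M B1 \<le>
        expect M (\<lambda>\<omega>. (count cycle_edges (cycles j) (snd \<omega>) - ?EI)\<^sup>2) / (\<delta> * \<bar>s\<bar> ^ j)\<^sup>2"
      unfolding B1_def by (rule markov_square[OF pos])
    also have "\<dots> \<le> (2 * real j * ?EI + C ^ (2 * j) / real n * real (2 * j) ^ (2 * j)) / (\<delta> * \<bar>s\<bar> ^ j)\<^sup>2"
      by (intro divide_right_mono variance_cycles j) auto
    also have "\<dots> \<le> ?p1"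
      by (intro divide_right_mono add_mono mult_left_mono expectation_cycles_close(2) j) auto
    finally show "prob M B1 \<le> ?p1" .
    have "prob M {\<omega> \<in> space (measure_pmf M). 1 \<le> count cycle_edges (tangles j) (snd \<omega>)} \<le>
        mean (count cycle_edges (tangles j)) / 1"
      by (rule integral_Markov_inequality_measure[where A = UNIV]) (auto simp: count_def)
    then show "prob M B2 \<le> ?p2" using expectation_tangles[of j] by (simp add: B2_def)
    show "prob M B3 \<le> ?p3"
      unfolding B3_def by (rule prob_degree_estimate) (use \<eta> d_gt_1 in auto)
  qed
  finally show ?thesis .
qed

end

lemma prob_tendsto_0:
  assumes "\<forall>\<^sub>F n in sequentially. prob (p n) (A n) \<le> B n" "B \<longlonglongrightarrow> 0"
  shows "(\<lambda>n. prob (p n) (A n)) \<longlonglongrightarrow> 0"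
  by (rule Lim_null_comparison[OF _ assms(2)]) (use assms(1) in simp)

text \<open>With \<open>R = 8 * C * level n\<close>, the base \<open>C * (2 * j)\<close> is at most
  \<open>R\<close> because \<open>j \<le> 4 * level n\<close>; so the products of powers are all
  bounded by \<open>R ^ (8 * level n + 1)\<close>.\<close>

lemma slack_bounds:
  fixes C x :: real
  assumes C: "1 \<le> C" "C \<le> real n" and r: "1 \<le> level n" and j: "j \<le> 4 * level n" and x: "0 \<le> x" "x \<le> C"
  shows "C ^ (2 * j) * real (2 * j) ^ (2 * j) \<le> slack C n * real n powr (1 / 4)"
    and "x ^ j * real j ^ j \<le> slack C n * real n powr (1 / 4)"
    and "real j * C ^ j \<le> slack C n * real n powr (1 / 4)"
    and "real n powr (1 / 4) \<le> real n"
    and "C ^ j \<le> slack C n * real n powr (1 / 4)"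
proof -
  define R where "R = 8 * C * real (level n)"
  have n: "1 \<le> real n" using C by linarith
  have R: "1 \<le> R" using mult_mono[of 1 "8 * C" 1 "real (level n)"] C r by (simp add: R_def)
  have S: "slack C n * real n powr (1 / 4) = R ^ (8 * level n + 1)"
    using n by (simp add: slack_def R_def)
  have jR: "C * real (2 * j) \<le> R"
  proof -
    have "real (2 * j) \<le> 8 * real (level n)" using j by simp
    then have "C * real (2 * j) \<le> C * (8 * real (level n))" using C by (intro mult_left_mono) auto
    then show ?thesis by (simp add: R_def)
  qed
  have "C ^ (2 * j) * real (2 * j) ^ (2 * j) = (C * real (2 * j)) ^ (2 * j)"
    by (rule power_mult_distrib[symmetric])
  also have "\<dots> \<le> R ^ (2 * j)" using jR C by (intro power_mono) auto
  also have "\<dots> \<le> R ^ (8 * level n + 1)" using R j by (intro power_increasing) auto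
  finally show "C ^ (2 * j) * real (2 * j) ^ (2 * j) \<le> slack C n * real n powr (1 / 4)" using S by simp
  have "x ^ j * real j ^ j = (x * real j) ^ j" by (rule power_mult_distrib[symmetric])
  also have "\<dots> \<le> R ^ j"
  proof (rule power_mono)
    have "x * real j \<le> C * real (2 * j)" using x C by (intro mult_mono) auto
    then show "x * real j \<le> R" using jR by linarith
  qed (use x in auto)
  also have "\<dots> \<le> R ^ (8 * level n + 1)" using R j by (intro power_increasing) auto
  finally show "x ^ j * real j ^ j \<le> slack C n * real n powr (1 / 4)" using S by simp
  have "real j \<le> C * real (2 * j)" using mult_mono[of 1 C "real j" "real (2 * j)"] C by simp
  then have "real j \<le> R" using jR by linarith
  moreover have CR: "C \<le> R"
  proof -
    have "C * 1 \<le> C * (8 * real (level n))" using C r by (intro mult_left_mono) auto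
    then show ?thesis by (simp add: R_def)
  qed
  ultimately have "real j * C ^ j \<le> R * R ^ j" using C R by (intro mult_mono power_mono) auto
  also have "\<dots> = R ^ (j + 1)" by simp
  also have "\<dots> \<le> R ^ (8 * level n + 1)" using R j by (intro power_increasing) auto
  finally show "real j * C ^ j \<le> slack C n * real n powr (1 / 4)" using S by simp
  have "real n powr (1 / 4) \<le> real n powr 1" using n by (intro powr_mono) auto
  then show "real n powr (1 / 4) \<le> real n" using n by simp
  have "C ^ j \<le> R ^ j" using CR C by (intro power_mono) auto
  also have "\<dots> \<le> R ^ (8 * level n + 1)" using R j by (intro power_increasing) auto
  finally show "C ^ j \<le> slack C n * real n powr (1 / 4)" using S by simp
qed

text \<open>Normalised by \<open>s ^ (2 * j)\<close>, the main term of the variance becomes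
  \<open>j * (d / s\<^sup>2) ^ j\<close>, the one term whose decay comes from
  \<open>d < s\<^sup>2\<close>. All others are absorbed by \<open>slack\<close> or are an explicit
  power of \<open>n\<close>.\<close>

lemma (in sbm_above) prob_centred_walks_slack:
  assumes r: "3 \<le> level n" and j: "level n \<le> j" "j \<le> 4 * level n" and \<delta>: "0 < \<delta>"
    and n: "1 + d \<le> real n powr (1 / 4)"
    and small: "(real k + 1 + d) * slack C n \<le> \<delta>"
  shows "prob M {\<omega>. 2 * \<delta> < \<bar>centred_walks n (snd \<omega>) j / s ^ j - (real k - 1)\<bar>} \<le>
    (2 * real k * (real j * (d / s\<^sup>2) ^ j) + slack C n) / \<delta>\<^sup>2 + slack C n + 256 * C\<^sup>2 / real n powr (1 / 2)"
proof -
  define N where "N = real n powr (1 / 4)"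
  define \<eta> where "\<eta> = 1 / N"
  have N: "0 < N" "1 \<le> N" "1 + d \<le> N" using n d_gt_1 bounds by (auto simp: N_def)
  have j3: "3 \<le> j" using r j by simp
  have dC: "0 \<le> d" "d \<le> C" using d_gt_1 C_large by auto
  have C1: "0 \<le> C" "C \<le> C" using C by auto
  have sl: "C ^ (2 * j) * real (2 * j) ^ (2 * j) \<le> slack C n * N"
    "d ^ j * real j ^ j \<le> slack C n * N" "C ^ j * real j ^ j \<le> slack C n * N"
    "real j * C ^ j \<le> slack C n * N" "N \<le> real n"
    unfolding N_def
    using slack_bounds[OF C(1,2) _ j(2), of d] slack_bounds[OF C(1,2) _ j(2) C1] r dC by auto
  have over_n: "x / real n \<le> slack C n" if "x \<le> slack C n * N" "0 \<le> x" for x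
  proof -
    have "x / real n \<le> x / N" using that sl(5) N by (intro divide_left_mono) auto
    also have "\<dots> \<le> slack C n" using that N by (simp add: pos_divide_le_eq)
    finally show ?thesis .
  qed
  have \<eta>1: "\<eta> + d / real n \<le> (1 + d) / N"
  proof -
    have "d / real n \<le> d / N" using sl(5) N dC by (intro divide_left_mono) auto
    then show ?thesis by (simp add: \<eta>_def add_divide_distrib)
  qed
  have \<eta>2: "(1 + d) / N \<le> 1" using N by simp
  have "0 < \<eta>" using N by (simp add: \<eta>_def)
  moreover have "\<eta> + d / real n \<le> 1" using \<eta>1 \<eta>2 by linarith
  ultimately have \<eta>: "0 < \<eta>" "\<eta> + d / real n \<le> 1" .
  have thr: "\<delta> + real k * d ^ j * (real j ^ j / real n) + real j * C ^ j * (\<eta> + d / real n) \<le> 2 * \<delta>"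
  proof -
    have "real k * d ^ j * (real j ^ j / real n) = real k * (d ^ j * real j ^ j / real n)" by simp
    also have "\<dots> \<le> real k * slack C n" using dC by (intro mult_left_mono over_n sl(2)) auto
    finally have 1: "real k * d ^ j * (real j ^ j / real n) \<le> real k * slack C n" .
    have "real j * C ^ j * (\<eta> + d / real n) \<le> real j * C ^ j * ((1 + d) / N)"
      using \<eta>1 C1 by (intro mult_left_mono) auto
    also have "\<dots> = (1 + d) * (real j * C ^ j / N)" by simp
    also have "\<dots> \<le> (1 + d) * slack C n"
      using sl(4) N dC by (intro mult_left_mono) (auto simp: pos_divide_le_eq)
    finally show ?thesis using 1 small by (simp add: algebra_simps)
  qed
  have "prob M {\<omega>. 2 * \<delta> < \<bar>centred_walks n (snd \<omega>) j / s ^ j - (real k - 1)\<bar>} \<le>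
    prob M {\<omega>. \<delta> + real k * d ^ j * (real j ^ j / real n) +
      real j * C ^ j * (\<eta> + d / real n) < \<bar>centred_walks n (snd \<omega>) j / s ^ j - (real k - 1)\<bar>}"
    by (rule measure_pmf.finite_measure_mono) (use thr in auto)
  also have "\<dots> \<le> (2 * real j * (real k * d ^ j) + C ^ (2 * j) / real n * real (2 * j) ^ (2 * j)) / (\<delta> * \<bar>s\<bar> ^ j)\<^sup>2 +
    C ^ j / real n * real j ^ j + 256 * C\<^sup>2 / (\<eta>\<^sup>2 * real n)"
    by (rule prob_centred_walks[OF j3 \<delta> \<eta>])
  also have "\<dots> \<le> (2 * real k * (real j * (d / s\<^sup>2) ^ j) + slack C n) / \<delta>\<^sup>2 + slack C n + 256 * C\<^sup>2 / real n powr (1 / 2)"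
  proof (intro add_mono)
    have S: "(\<delta> * \<bar>s\<bar> ^ j)\<^sup>2 = (s\<^sup>2) ^ j * \<delta>\<^sup>2"
    proof -
      have "(\<bar>s\<bar> ^ j)\<^sup>2 = (\<bar>s\<bar>\<^sup>2) ^ j" by (simp only: power_mult[symmetric] mult.commute)
      then show ?thesis by (simp add: power_mult_distrib)
    qed
    have s2: "1 \<le> (s\<^sup>2) ^ j" by (rule one_le_power) (use snr d_gt_1 in linarith)
    have "2 * real j * (real k * d ^ j) / (s\<^sup>2) ^ j = 2 * real k * (real j * (d / s\<^sup>2) ^ j)"
      by (simp add: power_divide)
    moreover have "C ^ (2 * j) / real n * real (2 * j) ^ (2 * j) / (s\<^sup>2) ^ j \<le> slack C n"
    proof -
      have "C ^ (2 * j) / real n * real (2 * j) ^ (2 * j) / (s\<^sup>2) ^ j \<le>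
          C ^ (2 * j) / real n * real (2 * j) ^ (2 * j) / 1"
        using s2 C1 by (intro divide_left_mono) auto
      also have "\<dots> = C ^ (2 * j) * real (2 * j) ^ (2 * j) / real n" by simp
      also have "\<dots> \<le> slack C n" using C1 by (intro over_n sl(1)) auto
      finally show ?thesis .
    qed
    ultimately have "(2 * real j * (real k * d ^ j) + C ^ (2 * j) / real n * real (2 * j) ^ (2 * j)) / (s\<^sup>2) ^ j \<le>
        2 * real k * (real j * (d / s\<^sup>2) ^ j) + slack C n"
      by (simp add: add_divide_distrib)
    then show "(2 * real j * (real k * d ^ j) + C ^ (2 * j) / real n * real (2 * j) ^ (2 * j)) / (\<delta> * \<bar>s\<bar> ^ j)\<^sup>2
        \<le> (2 * real k * (real j * (d / s\<^sup>2) ^ j) + slack C n) / \<delta>\<^sup>2"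
      unfolding S divide_divide_eq_left[symmetric] by (rule divide_right_mono) simp
    have "C ^ j / real n * real j ^ j = C ^ j * real j ^ j / real n" by simp
    also have "\<dots> \<le> slack C n" using C1 by (intro over_n sl(3)) auto
    finally show "C ^ j / real n * real j ^ j \<le> slack C n" .
    have "N\<^sup>2 = real n powr (1 / 2)" by (simp add: N_def power2_eq_square flip: powr_add)
    moreover have "real n powr (1 / 2) * real n powr (1 / 2) = real n"
      using bounds by (simp flip: powr_add)
    ultimately have "\<eta>\<^sup>2 * real n = real n powr (1 / 2)"
      using N by (simp add: \<eta>_def power_divide divide_eq_eq)
    then show "256 * C\<^sup>2 / (\<eta>\<^sup>2 * real n) \<le> 256 * C\<^sup>2 / real n powr (1 / 2)" by simp
  qed
  finally show ?thesis .
qed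

section \<open>Limits for fixed parameters above the threshold\<close>

locale sbm_snr =
  fixes k :: nat and a b :: real
  assumes k: "2 \<le> k" and ab: "0 \<le> a" "0 \<le> b" and SNR: "1 < SNR k a b"
begin

abbreviation deg :: real where "deg \<equiv> avg_degree k a b"
abbreviation eig :: real where "eig \<equiv> second_eigenvalue k a b"
text \<open>One constant for all requirements: it is at least 1, \<open>a\<close> and
  \<open>b\<close>, and by \<open>d_le_C\<close> at least \<open>deg + 1\<close>.\<close>

abbreviation C :: real where "C \<equiv> a + b + 2"

lemma d_less_s2: "deg < eig\<^sup>2"
proof -
  let ?q = "a + (real k - 1) * b"
  have q: "0 \<le> ?q" using k ab by simp
  \<comment> \<open>Division by 0 gives 0, so a vanishing denominator would contradict
    \<open>1 < SNR k a b\<close>.\<close>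
  have "?q \<noteq> 0" using SNR by (auto simp: SNR_def)
  then have q: "0 < ?q" using q by linarith
  have "real k * ?q < (a - b)\<^sup>2"
    using SNR q k by (simp add: SNR_def pos_less_divide_eq)
  then have "real k * ?q / (real k)\<^sup>2 < (a - b)\<^sup>2 / (real k)\<^sup>2"
    using k by (intro divide_strict_right_mono) auto
  moreover have "real k * ?q / (real k)\<^sup>2 = deg" using k by (simp add: avg_degree_def power2_eq_square)
  moreover have "(a - b)\<^sup>2 / (real k)\<^sup>2 = eig\<^sup>2" by (simp add: second_eigenvalue_def power_divide)
  ultimately show ?thesis by simp
qed

lemma d_le_C: "deg + 1 \<le> C"
proof -
  have "a + (real k - 1) * b \<le> real k * (a + b)"
  proof -
    have "1 * a \<le> real k * a" using k ab by (intro mult_right_mono) auto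
    then show ?thesis using ab by (simp add: algebra_simps)
  qed
  then have "deg \<le> a + b" using k by (simp add: avg_degree_def pos_divide_le_eq mult.commute)
  then show ?thesis by simp
qed

lemma sbm_above: "C \<le> real n \<Longrightarrow> sbm_above n k a b C"
  using k ab d_less_s2 d_le_C by unfold_locales auto

lemma d_gt_1: "1 < deg" and s_gt_1: "1 < \<bar>eig\<bar>" and s_le_d: "\<bar>eig\<bar> \<le> deg"
proof -
  \<comment> \<open>The claims do not mention \<open>n\<close>, so they may be taken from
    \<open>sbm_above\<close> for any one sufficiently large \<open>n\<close>.\<close>
  obtain n where "C \<le> real n" using real_arch_simple by blast
  then interpret sbm_above n k a b C by (rule sbm_above)
  show "1 < deg" "1 < \<bar>eig\<bar>" "\<bar>eig\<bar> \<le> deg" by (rule d_gt_1 s_gt_1 s_le_d)+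
qed

lemma eventually_large:
  "\<forall>\<^sub>F n in sequentially. C \<le> real n \<and> z \<le> real n powr (1 / 4) \<and> w \<le> level n"
proof (intro eventually_conj)
  show "\<forall>\<^sub>F n in sequentially. C \<le> real n"
    using filterlim_real_sequentially unfolding filterlim_at_top by blast
  have "filterlim (\<lambda>n. real n powr (1 / 4)) at_top sequentially" by real_asymp
  then show "\<forall>\<^sub>F n in sequentially. z \<le> real n powr (1 / 4)" unfolding filterlim_at_top by blast
  show "\<forall>\<^sub>F n in sequentially. w \<le> level n"
    using level_at_top unfolding filterlim_at_top by blast
qed

lemma eventually_slack:
  assumes "0 < e"
  shows "\<forall>\<^sub>F n in sequentially. z * slack C n \<le> e"
proof -
  have "(\<lambda>n. z * slack C n) \<longlonglongrightarrow> z * 0"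
    using ab by (intro tendsto_mult tendsto_const slack_tendsto_0) simp
  then have "(\<lambda>n. z * slack C n) \<longlonglongrightarrow> 0" by simp
  then have "\<forall>\<^sub>F n in sequentially. z * slack C n < e" using assms by (rule order_tendstoD(2))
  then show ?thesis by (rule eventually_mono) simp
qed

text \<open>\<open>J\<close> gives the walk length in terms of the level and will be
  \<open>2 * r\<close>, \<open>2 * r + 1\<close> and \<open>2 * (2 * r)\<close>; the middle one
  stays below \<open>4 * r\<close> only for \<open>1 \<le> r\<close>.\<close>

lemma centred_walks_tendsto:
  assumes J: "\<And>r. r \<le> J r" "\<And>r. 1 \<le> r \<Longrightarrow> J r \<le> 4 * r" and \<delta>: "0 < \<delta>"
  shows "(\<lambda>n. prob (SBM n k a b)
    {\<omega>. \<delta> < \<bar>centred_walks n (snd \<omega>) (J (level n)) / eig ^ J (level n) - (real k - 1)\<bar>}) \<longlonglongrightarrow> 0"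
proof -
  define e where "e = \<delta> / 2"
  have e: "0 < e" "\<delta> = 2 * e" using \<delta> by (auto simp: e_def)
  define B where "B n = (2 * real k * (real (J (level n)) * (deg / eig\<^sup>2) ^ J (level n)) + slack C n) / e\<^sup>2 + slack C n +
    256 * C\<^sup>2 / real n powr (1 / 2)" for n
  have "\<forall>\<^sub>F n in sequentially. prob (SBM n k a b)
    {\<omega>. \<delta> < \<bar>centred_walks n (snd \<omega>) (J (level n)) / eig ^ J (level n) - (real k - 1)\<bar>} \<le> B n"
    using eventually_large[of "1 + deg" 3] eventually_slack[OF e(1), of "real k + 1 + deg"]
  proof eventually_elim
    case (elim n)
    then interpret sbm_above n k a b C by (intro sbm_above) auto
    show ?case unfolding e(2) B_def
      by (rule prob_centred_walks_slack) (use elim J e in auto)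
  qed
  moreover have "B \<longlonglongrightarrow> 0"
  proof -
    have J_top: "filterlim (\<lambda>n. J (level n)) at_top sequentially"
      using filterlim_at_top_mono[OF level_at_top, of "\<lambda>n. J (level n)"] J(1) by simp
    have "0 < eig\<^sup>2" using d_less_s2 d_gt_1 by linarith
    then have "\<bar>deg / eig\<^sup>2\<bar> < 1" using d_less_s2 d_gt_1 by simp
    then have "(\<lambda>j. real j * (deg / eig\<^sup>2) ^ j) \<longlonglongrightarrow> 0" by (intro powser_times_n_limit_0) simp
    then have 1: "(\<lambda>n. real (J (level n)) * (deg / eig\<^sup>2) ^ J (level n)) \<longlonglongrightarrow> 0"
      by (rule filterlim_compose[OF _ J_top])
    have 2: "slack C \<longlonglongrightarrow> 0" using ab by (intro slack_tendsto_0) simp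
    have 3: "(\<lambda>n. 256 * C\<^sup>2 / real n powr (1 / 2)) \<longlonglongrightarrow> 0" by real_asymp
    have "B \<longlonglongrightarrow> (2 * real k * 0 + 0) / e\<^sup>2 + 0 + 0"
      unfolding B_def using e by (intro tendsto_intros 1 2 3) auto
    then show ?thesis by simp
  qed
  ultimately show ?thesis by (rule prob_tendsto_0)
qed

lemma degree_estimate_tendsto:
  assumes \<delta>: "0 < \<delta>"
  shows "(\<lambda>n. prob (SBM n k a b) {\<omega>. \<delta> < \<bar>degree_estimate n (snd \<omega>) - deg\<bar>}) \<longlonglongrightarrow> 0"
proof -
  define e where "e = \<delta> / 2"
  have e: "0 < e" "\<delta> = 2 * e" using \<delta> by (auto simp: e_def)
  have "(\<lambda>n. deg / real n) \<longlonglongrightarrow> 0" by real_asymp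
  then have "\<forall>\<^sub>F n in sequentially. deg / real n < e" using e by (intro order_tendstoD(2))
  then have "\<forall>\<^sub>F n in sequentially. prob (SBM n k a b) {\<omega>. \<delta> < \<bar>degree_estimate n (snd \<omega>) - deg\<bar>}
      \<le> 256 * C\<^sup>2 / (e\<^sup>2 * real n)"
    using eventually_large[of 0 0]
  proof eventually_elim
    case (elim n)
    then interpret sbm_above n k a b C by (intro sbm_above) auto
    have "prob (SBM n k a b) {\<omega>. \<delta> < \<bar>degree_estimate n (snd \<omega>) - deg\<bar>} \<le>
        prob M {\<omega>. e + deg / real n \<le> \<bar>degree_estimate n (snd \<omega>) - deg\<bar>}"
      by (rule measure_pmf.finite_measure_mono) (use elim e in auto)
    also have "\<dots> \<le> 256 * C\<^sup>2 / (e\<^sup>2 * real n)"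
      by (rule prob_degree_estimate) (use e d_gt_1 in auto)
    finally show ?case .
  qed
  moreover have "(\<lambda>n. 256 * C\<^sup>2 / (e\<^sup>2 * real n)) \<longlonglongrightarrow> 0" using e by real_asymp
  ultimately show ?thesis by (rule prob_tendsto_0)
qed

end

section \<open>Convergence of the estimator\<close>

text \<open>The program finds integer parts by counting; with only \<open>n\<close> candidates this
  is correct as long as \<open>y \<le> n\<close>.\<close>

lemma card_scaled_floor:
  assumes "0 \<le> y" "y \<le> real n"
  shows "card {i. i < n \<and> real (Suc i) \<le> y} = nat \<lfloor>y\<rfloor>"
proof -
  have "{i. i < n \<and> real (Suc i) \<le> y} = {..<nat \<lfloor>y\<rfloor>}"
  proof (intro set_eqI iffI)
    fix i assume "i \<in> {i. i < n \<and> real (Suc i) \<le> y}"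
    then show "i \<in> {..<nat \<lfloor>y\<rfloor>}" by (simp add: less_eq_Suc_le le_nat_floor)
  next
    fix i assume i: "i \<in> {..<nat \<lfloor>y\<rfloor>}"
    then have "Suc i \<le> nat \<lfloor>y\<rfloor>" by simp
    then have "real (Suc i) \<le> y" using assms(1) by linarith
    then show "i \<in> {i. i < n \<and> real (Suc i) \<le> y}" using assms by auto
  qed
  then show ?thesis by simp
qed

lemma real_diff_max: "real (p - q) = max 0 (real p - real q)"
  by (cases "q \<le> p") (auto simp: of_nat_diff max_def)

text \<open>Truncated subtraction replaces an estimate by its maximum with 0, which cannot move it
  away from a nonnegative parameter.\<close>

lemma max_0_diff_le: "0 \<le> (c::real) \<Longrightarrow> \<bar>max 0 x - c\<bar> \<le> \<bar>x - c\<bar>"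
  by (auto simp: max_def)

lemma power_centred_walks:
  assumes "0 < n"
  shows "real n ^ j * centred_walks n G j =
    real (n ^ j * closed_walks (\<lambda>u v. {u, v} \<in> G) n j) - real (degree_sum (\<lambda>u v. {u, v} \<in> G) n ^ j)"
  using assms by (simp add: centred_walks_def degree_estimate_def power_divide algebra_simps)

lemma abs_ratio_le:
  fixes x y c :: real
  assumes "\<bar>x - c\<bar> \<le> \<delta>" "\<bar>y - c\<bar> \<le> \<delta>" "1 \<le> c" "\<delta> \<le> 1 / 2"
  shows "\<bar>x / y - 1\<bar> \<le> 4 * \<delta>"
proof -
  have y: "1 / 2 \<le> y" using assms by linarith
  have "\<bar>x / y - 1\<bar> = \<bar>x - y\<bar> / y" using y by (simp add: abs_if field_simps)
  also have "\<dots> \<le> 2 * \<delta> / (1 / 2)" using y assms by (intro frac_le) linarith+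
  finally show ?thesis by simp
qed

context sbm_snr
begin

text \<open>The deterministic part: the normalised centred numbers \<open>p\<close>,
  \<open>q\<close>, \<open>z\<close> are all near \<open>\<kappa> = k - 1\<close>. Then
  \<open>sh = eig * (q / p)\<close> is near \<open>eig\<close>, and the rounded quotient equals
  \<open>k - 1\<close>, so that the third component has no error at all.\<close>

lemma estimator_close:
  assumes r: "1 \<le> level n" and m: "m = 2 * level n" "2 * m \<le> n"
    and \<alpha>: "\<bar>centred_walks n G m / eig ^ m - (real k - 1)\<bar> \<le> \<delta>"
    and \<beta>: "\<bar>centred_walks n G (m + 1) / eig ^ (m + 1) - (real k - 1)\<bar> \<le> \<delta>"
    and \<gamma>: "\<bar>centred_walks n G (2 * m) / eig ^ (2 * m) - (real k - 1)\<bar> \<le> \<delta>"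
    and x: "\<bar>degree_estimate n G - deg\<bar> \<le> \<delta>"
    and \<delta>: "0 < \<delta>" "\<delta> * (40 * (real k - 1)) \<le> 1" and small: "1 / eig ^ m \<le> \<delta>"
    and n: "real k * deg ^ m \<le> real n" "k \<le> n"
  shows "dist (estimator n G) (a, b, real k) \<le> \<delta> * (2 + 4 * \<bar>eig\<bar> * real k)"
proof -
  define \<kappa> where "\<kappa> = real k - 1"
  have \<kappa>: "1 \<le> \<kappa>" using k by (simp add: \<kappa>_def)
  have "\<delta> * 40 \<le> \<delta> * (40 * \<kappa>)" using \<delta> \<kappa> by (intro mult_left_mono) auto
  moreover have "\<delta> * (40 * \<kappa>) \<le> 1" using \<delta>(2) by (simp add: \<kappa>_def)
  ultimately have d40: "\<delta> \<le> 1 / 40" "\<delta> * \<kappa> \<le> 1 / 40" by simp_all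
  have n0: "0 < n" using n(2) k by simp
  let ?A = "\<lambda>u v. {u, v} \<in> G"
  define D where "D = degree_sum ?A n"
  define y where "y = centred_walks n G m"
  define y' where "y' = centred_walks n G (m + 1)"
  define y2 where "y2 = centred_walks n G (2 * m)"
  have m2: "2 \<le> m" using r m by simp
  have even: "even m" using m by simp
  have e0: "eig \<noteq> 0" using s_gt_1 by auto
  \<comment> \<open>The length is even, so this holds for either sign of \<open>eig\<close>.\<close>
  have em: "0 < eig ^ m" using even e0 by (simp add: zero_less_power_eq)
  have em2: "0 < eig ^ (2 * m)" using e0 by (simp add: zero_less_power_eq)
  define p where "p = y / eig ^ m"
  define q where "q = y' / eig ^ (m + 1)"
  define z where "z = y2 / eig ^ (2 * m)"
  have pqz: "\<bar>p - \<kappa>\<bar> \<le> \<delta>" "\<bar>q - \<kappa>\<bar> \<le> \<delta>" "\<bar>z - \<kappa>\<bar> \<le> \<delta>"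
    using \<alpha> \<beta> \<gamma> by (simp_all add: p_def q_def z_def y_def y'_def y2_def \<kappa>_def)
  have pz0: "0 < p" "0 < z" using pqz \<kappa> d40 by linarith+
  have y: "y = p * eig ^ m" "y' = q * eig ^ (m + 1)" "y2 = z * eig ^ (2 * m)"
    using e0 by (simp_all add: p_def q_def z_def)
  have y0: "0 < y" "0 < y2" using pz0 em em2 by (simp_all add: y)
  \<comment> \<open>The program caps the integer part of \<open>y\<close> at \<open>n\<close>; this
    bound keeps the cap from acting.\<close>
  have yn: "y \<le> real n"
  proof -
    have "eig ^ m = \<bar>eig\<bar> ^ m" using even by (simp add: power_even_abs)
    also have "\<dots> \<le> deg ^ m" using s_le_d by (intro power_mono) auto
    finally have "y \<le> real k * deg ^ m"
      unfolding y using pqz(1) d40 em pz0 by (intro mult_mono) (auto simp: \<kappa>_def)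
    then show ?thesis using n(1) by linarith
  qed
  define v where "v = n ^ m * closed_walks ?A n m - D ^ m"
  define u where "u = n ^ (m + 1) * closed_walks ?A n (m + 1) - D ^ (m + 1)"
  define u' where "u' = D ^ (m + 1) - n ^ (m + 1) * closed_walks ?A n (m + 1)"
  define v2 where "v2 = n ^ (2 * m) * closed_walks ?A n (2 * m) - D ^ (2 * m)"
  define w where "w = card {i. i < n \<and> Suc i * n ^ m \<le> v}"
  define K where "K = card {i. i < n \<and> (2 * i + 1) * v2 \<le> 2 * w * (n ^ m * v)}"
  note pow = power_centred_walks[OF n0, of _ G, folded D_def]
  have nm: "0 < real n ^ m" using n0 by simp
  have v: "real v = real n ^ m * y"
    unfolding v_def real_diff_max pow[symmetric] using y0 nm by (simp add: y_def)
  have v2: "real v2 = real n ^ (2 * m) * y2"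
    unfolding v2_def real_diff_max pow[symmetric] using y0 n0 by (simp add: y2_def)
  have uu: "real u - real u' = real n ^ (m + 1) * y'"
    unfolding u_def u'_def real_diff_max y'_def pow by (auto simp: max_def)
  have "Suc i * n ^ m \<le> v \<longleftrightarrow> real (Suc i) \<le> y" for i
  proof -
    have "Suc i * n ^ m \<le> v \<longleftrightarrow> real (Suc i) * real n ^ m \<le> y * real n ^ m"
      unfolding of_nat_le_iff[where 'a = real, symmetric] by (simp add: v algebra_simps)
    then show ?thesis using nm by simp
  qed
  then have w: "real w = real_of_int \<lfloor>y\<rfloor>"
    unfolding w_def using card_scaled_floor[of y n] y0 yn by simp
  define \<rho> where "\<rho> = real w * y / y2"
  have \<rho>: "\<bar>\<rho> - \<kappa>\<bar> < 1 / 2"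
  proof -
    define t where "t = real w / eig ^ m"
    have "\<bar>real w - y\<bar> \<le> 1" unfolding w by linarith
    then have "\<bar>real w - y\<bar> / eig ^ m \<le> 1 / eig ^ m" using em by (intro divide_right_mono) auto
    moreover have "\<bar>real w - y\<bar> / eig ^ m = \<bar>t - p\<bar>"
      using em unfolding t_def p_def by (simp add: abs_divide flip: diff_divide_distrib)
    ultimately have t: "\<bar>t - \<kappa>\<bar> \<le> 2 * \<delta>" using small pqz(1) by linarith
    have \<rho>: "\<rho> = t * (p / z)"
      using e0 by (simp add: \<rho>_def t_def y mult_2 power_add)
    have pz: "\<bar>p / z - 1\<bar> \<le> 4 * \<delta>" by (rule abs_ratio_le[OF pqz(1,3) \<kappa>]) (use d40 in simp)
    have "\<rho> - \<kappa> = (t - \<kappa>) * (p / z) + \<kappa> * (p / z - 1)" 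
      unfolding \<rho> by (simp add: algebra_simps diff_divide_distrib)
    then have "\<bar>\<rho> - \<kappa>\<bar> \<le> \<bar>t - \<kappa>\<bar> * \<bar>p / z\<bar> + \<bar>\<kappa>\<bar> * \<bar>p / z - 1\<bar>"
      by (metis abs_mult abs_triangle_ineq)
    also have "\<dots> \<le> 2 * \<delta> * 2 + \<kappa> * (4 * \<delta>)"
      using t pz d40 \<kappa> \<delta> by (intro add_mono mult_mono) (auto simp del: times_divide_eq_right)
    also have "\<dots> < 1 / 2" using d40 by (simp add: mult.commute)
    finally show ?thesis .
  qed
  have K_iff: "(2 * i + 1) * v2 \<le> 2 * w * (n ^ m * v) \<longleftrightarrow> i < k - 1" for i
  proof -
    have "(2 * i + 1) * v2 \<le> 2 * w * (n ^ m * v) \<longleftrightarrow>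
        real n ^ (2 * m) * ((2 * real i + 1) * y2) \<le> real n ^ (2 * m) * (2 * (real w * y))"
    proof -
      have sq: "real n ^ (2 * m) = real n ^ m * real n ^ m" by (simp only: mult_2 power_add)
      show ?thesis
        unfolding of_nat_le_iff[where 'a = real, symmetric] of_nat_mult of_nat_power v v2 sq
        by (simp add: algebra_simps)
    qed
    also have "\<dots> \<longleftrightarrow> (2 * real i + 1) * y2 \<le> 2 * (real w * y)" using n0 by simp
    also have "\<dots> \<longleftrightarrow> 2 * real i + 1 \<le> 2 * \<rho>" using y0 by (simp add: \<rho>_def pos_le_divide_eq)
    also have "\<dots> \<longleftrightarrow> i < k - 1"
    proof
      assume "2 * real i + 1 \<le> 2 * \<rho>"
      then have "real i < real k - 1" using \<rho> unfolding \<kappa>_def by linarith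
      then show "i < k - 1" by linarith
    next
      assume "i < k - 1"
      then have "real i + 1 \<le> real k - 1" by linarith
      then show "2 * real i + 1 \<le> 2 * \<rho>" using \<rho> unfolding \<kappa>_def by linarith
    qed
    finally show ?thesis .
  qed
  have "{i. i < n \<and> (2 * i + 1) * v2 \<le> 2 * w * (n ^ m * v)} = {..<k - 1}"
    unfolding K_iff using n(2) by (intro set_eqI) (simp only: mem_Collect_eq lessThan_iff, linarith)
  then have K: "K = k - 1" unfolding K_def by simp
  then have K': "real K = \<kappa>" using k by (simp add: \<kappa>_def of_nat_diff)
  define sh where "sh = y' / y"
  have nv: "real (n * v) = real n * (real n ^ m * y)" by (simp add: v)
  have nv0: "0 < real n * (real n ^ m * y)" using n0 y0 by simp
  have main: "fst (run main (graph_input n G)) 5 = D * v + K * u - K * u'"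
    "fst (run main (graph_input n G)) 1 = n * v" "fst (run main (graph_input n G)) 2 = D * v + u' - u"
    "fst (run main (graph_input n G)) 3 = n * v" "fst (run main (graph_input n G)) 4 = K + 1"
    using run_main[OF m(1)[unfolded level_def] m2 m(2) D_def v_def u_def u'_def v2_def w_def K_def]
    by (simp_all only: Let_def)
  have "estimator n G = (real (D * v + K * u - K * u') / real (n * v),
      real (D * v + u' - u) / real (n * v), real k)"
    unfolding estimator_def Let_def main using K k by simp
  moreover have "real (D * v + K * u - K * u') / real (n * v) = max 0 (degree_estimate n G + \<kappa> * sh)"
  proof -
    have "real (D * v + K * u - K * u') / real (n * v) =
        max 0 (real D * real v + \<kappa> * (real u - real u')) / real (n * v)"
      unfolding real_diff_max by (simp add: K' algebra_simps)
    also have "\<dots> = max 0 ((real D * real v + \<kappa> * (real u - real u')) / real (n * v))"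
      using nv nv0 by (simp add: max_divide_distrib_right)
    also have "(real D * real v + \<kappa> * (real u - real u')) / real (n * v) = degree_estimate n G + \<kappa> * sh"
      unfolding uu nv v using n0 y0 by (simp add: degree_estimate_def D_def sh_def field_simps)
    finally show ?thesis .
  qed
  moreover have "real (D * v + u' - u) / real (n * v) = max 0 (degree_estimate n G - sh)"
  proof -
    have "real (D * v + u' - u) / real (n * v) =
        max 0 (real D * real v - (real u - real u')) / real (n * v)"
      unfolding real_diff_max by (simp add: algebra_simps)
    also have "\<dots> = max 0 ((real D * real v - (real u - real u')) / real (n * v))"
      using nv nv0 by (simp add: max_divide_distrib_right)
    also have "(real D * real v - (real u - real u')) / real (n * v) = degree_estimate n G - sh"
      unfolding uu nv v using n0 y0 by (simp add: degree_estimate_def D_def sh_def field_simps)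
    finally show ?thesis .
  qed
  ultimately have est: "estimator n G = (max 0 (degree_estimate n G + \<kappa> * sh),
      max 0 (degree_estimate n G - sh), real k)" by simp
  have sh: "\<bar>sh - eig\<bar> \<le> 4 * \<delta> * \<bar>eig\<bar>"
  proof -
    have "sh = eig * (q / p)" using e0 by (simp add: sh_def y)
    then have "sh - eig = eig * (q / p - 1)" by (simp add: algebra_simps)
    then have "\<bar>sh - eig\<bar> = \<bar>eig\<bar> * \<bar>q / p - 1\<bar>" by (simp add: abs_mult)
    also have "\<dots> \<le> \<bar>eig\<bar> * (4 * \<delta>)"
      by (intro mult_left_mono abs_ratio_le[OF pqz(2,1) \<kappa>]) (use d40 in auto)
    finally show ?thesis by (simp add: mult_ac)
  qed
  have ids: "deg + \<kappa> * eig = a" "deg - eig = b"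
    using eigenvalue_identities[where k = k and a = a and b = b] k by (auto simp: \<kappa>_def algebra_simps)
  have A: "\<bar>max 0 (degree_estimate n G + \<kappa> * sh) - a\<bar> \<le> \<delta> + \<kappa> * (4 * \<delta> * \<bar>eig\<bar>)"
  proof -
    have "degree_estimate n G + \<kappa> * sh - a = (degree_estimate n G - deg) + \<kappa> * (sh - eig)"
      using ids(1) unfolding right_diff_distrib by linarith
    then have "\<bar>degree_estimate n G + \<kappa> * sh - a\<bar> \<le> \<bar>degree_estimate n G - deg\<bar> + \<bar>\<kappa>\<bar> * \<bar>sh - eig\<bar>"
      by (metis abs_mult abs_triangle_ineq)
    also have "\<dots> \<le> \<delta> + \<kappa> * (4 * \<delta> * \<bar>eig\<bar>)" using x sh \<kappa> by (intro add_mono mult_mono) auto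
    finally show ?thesis using max_0_diff_le[OF ab(1)] by (rule order_trans[rotated])
  qed
  have B: "\<bar>max 0 (degree_estimate n G - sh) - b\<bar> \<le> \<delta> + 4 * \<delta> * \<bar>eig\<bar>"
  proof -
    have "\<bar>degree_estimate n G - sh - b\<bar> \<le> \<bar>degree_estimate n G - deg\<bar> + \<bar>sh - eig\<bar>"
      using ids(2) by linarith
    also have "\<dots> \<le> \<delta> + 4 * \<delta> * \<bar>eig\<bar>" using x sh by linarith
    finally show ?thesis using max_0_diff_le[OF ab(2)] by (rule order_trans[rotated])
  qed
  have "dist (estimator n G) (a, b, real k) \<le>
      \<bar>max 0 (degree_estimate n G + \<kappa> * sh) - a\<bar> + \<bar>max 0 (degree_estimate n G - sh) - b\<bar>"
    unfolding est dist_Pair_Pair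
    by (rule order_trans[OF sqrt_sum_squares_le_sum_abs]) (simp add: dist_real_def)
  also have "\<dots> \<le> \<delta> * (2 + 4 * \<bar>eig\<bar> * real k)"
    using A B by (simp add: \<kappa>_def algebra_simps)
  finally show ?thesis .
qed

lemma estimator_converges:
  "converges_in_prob (\<lambda>n. SBM n k a b) (\<lambda>n (\<sigma>, G). estimator n G) (a, b, real k)"
  unfolding converges_in_prob_def
proof (intro allI impI)
  fix \<epsilon> :: real assume \<epsilon>: "0 < \<epsilon>"
  define Z where "Z = 2 + 4 * \<bar>eig\<bar> * real k"
  have Z: "0 < Z" unfolding Z_def by (intro add_pos_nonneg) auto
  define \<delta> where "\<delta> = min (1 / (40 * (real k - 1))) (\<epsilon> / Z)"
  have k1: "0 < real k - 1" using k by simp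
  have \<delta>: "0 < \<delta>" using k1 \<epsilon> Z by (simp add: \<delta>_def)
  have "\<delta> * (40 * (real k - 1)) \<le> 1 / (40 * (real k - 1)) * (40 * (real k - 1))"
    using k1 by (intro mult_right_mono) (auto simp: \<delta>_def)
  then have \<delta>1: "\<delta> * (40 * (real k - 1)) \<le> 1" using k1 by simp
  have "\<delta> * Z \<le> \<epsilon> / Z * Z" using Z by (intro mult_right_mono) (auto simp: \<delta>_def)
  then have \<delta>2: "\<delta> * Z \<le> \<epsilon>" using Z by simp
  define P where "P J n = prob (SBM n k a b)
    {\<omega>. \<delta> < \<bar>centred_walks n (snd \<omega>) (J (level n)) / eig ^ J (level n) - (real k - 1)\<bar>}" for J :: "nat \<Rightarrow> nat" and n
  define Q where "Q n = prob (SBM n k a b) {\<omega>. \<delta> < \<bar>degree_estimate n (snd \<omega>) - deg\<bar>}" for n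
  define B where "B n = P (\<lambda>r. 2 * r) n + P (\<lambda>r. 2 * r + 1) n + P (\<lambda>r. 2 * (2 * r)) n + Q n" for n
  have "P (\<lambda>r. 2 * r) \<longlonglongrightarrow> 0" "P (\<lambda>r. 2 * r + 1) \<longlonglongrightarrow> 0" "P (\<lambda>r. 2 * (2 * r)) \<longlonglongrightarrow> 0"
    unfolding P_def by (rule centred_walks_tendsto; use \<delta> in simp)+
  moreover have "Q \<longlonglongrightarrow> 0" unfolding Q_def by (rule degree_estimate_tendsto[OF \<delta>])
  ultimately have "B \<longlonglongrightarrow> 0 + 0 + 0 + 0" unfolding B_def by (intro tendsto_add)
  then have "B \<longlonglongrightarrow> 0" by simp
  moreover have "\<forall>\<^sub>F n in sequentially. 1 / eig ^ (2 * level n) \<le> \<delta>"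
  proof -
    have "1 < eig\<^sup>2" using d_less_s2 d_gt_1 by linarith
    then have "(\<lambda>r. (1 / eig\<^sup>2) ^ r) \<longlonglongrightarrow> 0" 
      by (intro LIMSEQ_realpow_zero) (simp_all add: divide_less_eq_1 del: power2_less_1_iff)
    then have "(\<lambda>n. (1 / eig\<^sup>2) ^ level n) \<longlonglongrightarrow> 0" by (rule filterlim_compose[OF _ level_at_top])
    then have "\<forall>\<^sub>F n in sequentially. (1 / eig\<^sup>2) ^ level n < \<delta>" using \<delta> by (rule order_tendstoD(2))
    then show ?thesis by eventually_elim (simp add: power_divide power_mult)
  qed
  then have "\<forall>\<^sub>F n in sequentially. prob (SBM n k a b)
      {\<omega>. dist (case \<omega> of (\<sigma>, G) \<Rightarrow> estimator n G) (a, b, real k) > \<epsilon>} \<le> B n"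
    using eventually_large[of 0 1] eventually_slack[OF zero_less_one, of "real k"]
      eventually_slack[OF zero_less_one, of 1]
      eventually_ge_at_top[of k]
  proof eventually_elim
    case (elim n)
    define r where "r = level n"
    define N where "N = real n powr (1 / 4)"
    have r: "1 \<le> r" "1 \<le> C" "C \<le> real n" using elim ab by (auto simp: r_def)
    have N: "0 \<le> N" "N \<le> real n" unfolding N_def
      using slack_bounds(4)[OF r(2,3) r(1)[unfolded r_def], of 0 0] ab by auto
    have 1: "2 * (2 * r) \<le> n"
    proof -
      have "real (4 * r) * 1 \<le> real (4 * r) * C ^ (4 * r)"
        using r by (intro mult_left_mono one_le_power) auto
      also have "\<dots> \<le> slack C n * N" unfolding N_def
        by (rule slack_bounds(3)[where x = 0]) (use r in \<open>auto simp: r_def\<close>)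
      also have "\<dots> \<le> 1 * N" using elim N by (intro mult_right_mono) auto
      finally show ?thesis using N by linarith
    qed
    have 2: "real k * deg ^ (2 * r) \<le> real n"
    proof -
      have "deg ^ (2 * r) \<le> C ^ (2 * r)" using d_le_C d_gt_1 by (intro power_mono) auto
      also have "\<dots> \<le> slack C n * N" unfolding N_def
        by (rule slack_bounds(5)[where x = 0]) (use r in \<open>auto simp: r_def\<close>)
      finally have "real k * deg ^ (2 * r) \<le> real k * (slack C n * N)" by (intro mult_left_mono) auto
      also have "\<dots> = real k * slack C n * N" by simp
      also have "\<dots> \<le> 1 * N" using elim N by (intro mult_right_mono) auto
      finally show ?thesis using N by linarith
    qed
    define E where "E j = {\<omega> :: (nat \<Rightarrow> nat) \<times> nat set set. \<delta> < \<bar>centred_walks n (snd \<omega>) j / eig ^ j - (real k - 1)\<bar>}" for j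
    define F where "F = {\<omega> :: (nat \<Rightarrow> nat) \<times> nat set set. \<delta> < \<bar>degree_estimate n (snd \<omega>) - deg\<bar>}"
    have "{\<omega>. dist (case \<omega> of (\<sigma>, G) \<Rightarrow> estimator n G) (a, b, real k) > \<epsilon>} \<subseteq>
        E (2 * r) \<union> E (2 * r + 1) \<union> E (2 * (2 * r)) \<union> F"
    proof
      fix \<omega> :: "(nat \<Rightarrow> nat) \<times> nat set set"
      assume far: "\<omega> \<in> {\<omega>. dist (case \<omega> of (\<sigma>, G) \<Rightarrow> estimator n G) (a, b, real k) > \<epsilon>}"
      show "\<omega> \<in> E (2 * r) \<union> E (2 * r + 1) \<union> E (2 * (2 * r)) \<union> F"
      proof (rule ccontr)
        assume "\<not> ?thesis"
        then have "dist (estimator n (snd \<omega>)) (a, b, real k) \<le> \<delta> * Z"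
          unfolding Z_def
          by (intro estimator_close[where m = "2 * r"])
            (use elim r 1 2 \<delta> \<delta>1 in \<open>auto simp: E_def F_def r_def\<close>)
        then show False using far \<delta>2 by (auto split: prod.splits)
      qed
    qed
    then have "prob (SBM n k a b)
        {\<omega>. dist (case \<omega> of (\<sigma>, G) \<Rightarrow> estimator n G) (a, b, real k) > \<epsilon>} \<le>
      prob (SBM n k a b) (E (2 * r) \<union> E (2 * r + 1) \<union> E (2 * (2 * r)) \<union> F)"
      by (rule measure_pmf.finite_measure_mono) simp
    also have "\<dots> \<le> prob (SBM n k a b) (E (2 * r)) + prob (SBM n k a b) (E (2 * r + 1)) +
        prob (SBM n k a b) (E (2 * (2 * r))) + prob (SBM n k a b) F"
      by (intro order_trans[OF measure_Un_le] add_right_mono) auto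
    also have "\<dots> = B n" by (simp add: B_def P_def Q_def E_def F_def r_def)
    finally show ?case .
  qed
  ultimately show "(\<lambda>n. prob (SBM n k a b)
      {\<omega>. dist (case \<omega> of (\<sigma>, G) \<Rightarrow> estimator n G) (a, b, real k) > \<epsilon>}) \<longlonglongrightarrow> 0"
    by (intro prob_tendsto_0)
qed

end

theorem lemma2:
  shows "\<exists>est :: nat \<Rightarrow> nat set set \<Rightarrow> real \<times> real \<times> real.
    polytime_graph_estimator est \<and>
    (\<forall>(k :: nat) (a :: real) (b :: real).
       k \<ge> 2 \<longrightarrow> a \<ge> 0 \<longrightarrow> b \<ge> 0 \<longrightarrow> SNR k a b > 1 \<longrightarrow>
       converges_in_prob (\<lambda>n. SBM n k a b) (\<lambda>n (\<sigma>, G). est n G) (a, b, real k))"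
proof (intro exI conjI allI impI)
  show "polytime_graph_estimator estimator" by (rule polytime_estimator)
  fix k :: nat and a b :: real
  assume "k \<ge> 2" "a \<ge> 0" "b \<ge> 0" "SNR k a b > 1"
  then interpret sbm_snr k a b by unfold_locales
  show "converges_in_prob (\<lambda>n. SBM n k a b) (\<lambda>n (\<sigma>, G). estimator n G) (a, b, real k)"
    by (rule estimator_converges)
qed

end
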